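(* Assume that $\beta\ge 4$ and that the finite set of ordered multipliers $\mathcal{H}\subset\mathbb{R}^n$ satisfies, for some constants $K_\circ>0$ and $K^\circ>0$, $$\sum_{i=1}^n (h_i^2-g_i^2)\ \ge\ K_\circ\bigl(\|h\|_1-\|g\|_1\bigr)\quad\text{for all } h,g\in\mathcal{H} \text{ with } h\ge g,$$ $$\|h^+\|^2\le K^\circ\|h\|^2\quad\text{for all } h\in\mathcal{H},\ h\neq h^{\max}.$$ Let $\bar\mu(Y)$ be the exponential weighting estimate with parameter $\beta$ and prior weights $\pi^h$ (defined in the context). Then there exist a function $\Psi:[0,\infty)\to(0,\infty)$ and a constant $C$, depending only on $\beta,K_\circ,K^\circ$ (in particular not on $\mu$, $\sigma$, $n$ or the cardinality of $\mathcal{H}$), such that $\Psi$ is nondecreasing, bounded at $0$, satisfies $$\Psi(x)\le \frac{Cx}{\log(x)}\quad\text{for all } x>1,$$ and such that, uniformly in $\mu\in\mathbb{R}^n$, $$\mathbf{E}_\mu\|\bar{\mu}(Y)-\mu\|^2\le r^{\mathcal{H}}(\mu)+2\beta\sigma^2\log\biggl[\frac{r^{\mathcal{H}}(\mu)}{\sigma^2}+\Psi\biggl(\frac{r^{\mathcal{H}}(\mu)}{\sigma^2}\biggr)\biggr].$$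
   Context: Model: one observes $Y=(Y_1,\dots,Y_n)^\top$ with $Y_i=\mu_i+\sigma\xi_i$, $i=1,\dots,n$, where $\xi_i$ are i.i.d. $\mathcal{N}(0,1)$, $\sigma>0$ is known, and $\mu\in\mathbb{R}^n$ is unknown; $\mathbf{E}_\mu$ is the expectation under this model. $\|x\|^2=\sum_{i=1}^n x_i^2$ and $\|x\|_1=\sum_{i=1}^n|x_i|$. Ordered multipliers: $\mathcal{H}$ is a finite (nonempty) set of vectors in $\mathbb{R}^n$ such that (i) $h_i\in[0,1]$ for all $i=1,\dots,n$, $h\in\mathcal{H}$; (ii) $h_{i+1}\le h_i$ for $i=1,\dots,n-1$, $h\in\mathcal{H}$; (iii) if $h_k<g_k$ for some $k$ and some $h,g\in\mathcal{H}$, then $h_i\le g_i$ for all $i=1,\dots,n$. Thus $\mathcal{H}$ is totally ordered by the componentwise order: $h\ge g$ means $h_i\ge g_i$ for all $i$, and $h>g$ means $h\ge g$, $h\ne g$. $h^{\max}$ is the maximal element of $\mathcal{H}$, and for $h\ne h^{\max}$, $h^+=\min\{g\in\mathcal{H}: g>h\}$. Linear estimates: $\hat\mu^h_i(Y)=h_iY_i$, $h\in\mathcal{H}$. The oracle risk is $$r^{\mathcal{H}}(\mu)=\min_{h\in\mathcal{H}}\mathbf{E}_\mu\|\hat\mu^h(Y)-\mu\|^2=\min_{h\in\mathcal{H}}\Bigl\{\sum_{i=1}^n(1-h_i)^2\mu_i^2+\sigma^2\|h\|^2\Bigr\}.$$ The unbiased risk estimate is $\bar r(Y,\hat\mu^h)=\|Y-\hat\mu^h(Y)\|^2+2\sigma^2\sum_{i=1}^n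 h_i-\sigma^2 n$. Prior weights: $\pi^h=1-\exp\bigl\{-(\|h^+\|_1-\|h\|_1)/\beta\bigr\}$ for $h\ne h^{\max}$, and $\pi^{h^{\max}}=1$. Exponential weighting estimate: $\bar\mu(Y)=\sum_{h\in\mathcal{H}}w^h(Y)\hat\mu^h(Y)$ with $$w^h(Y)=\pi^h\exp\Bigl[-\frac{\bar r(Y,\hat\mu^h)}{2\beta\sigma^2}\Bigr]\Big/\sum_{g\in\mathcal{H}}\pi^g\exp\Bigl[-\frac{\bar r(Y,\hat\mu^g)}{2\beta\sigma^2}\Bigr].$$ *)

theory Defs
  imports "HOL-Probability.Probability"
begin

section \<open>Vectors\<close>

text \<open>
  The dimension \<open>n\<close> is quantified inside the theorem, so vectors in \<open>\<real>\<^sup>n\<close> are functions on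
  \<open>{1..n}\<close> that are \<^const>\<open>undefined\<close> elsewhere. On this carrier the equality and the
  pointwise order of the function type are exactly equality and the componentwise order of
  \<open>\<real>\<^sup>n\<close>, so \<open>h \<le> g\<close> and \<open>h < g\<close> have the intended meaning.
\<close>

abbreviation vectors :: "nat \<Rightarrow> (nat \<Rightarrow> real) set" where
  "vectors n \<equiv> {1..n} \<rightarrow>\<^sub>E (UNIV :: real set)"

definition sqnorm :: "nat \<Rightarrow> (nat \<Rightarrow> real) \<Rightarrow> real" where
  "sqnorm n x = (\<Sum>i=1..n. (x i)\<^sup>2)"

definition l1norm :: "nat \<Rightarrow> (nat \<Rightarrow> real) \<Rightarrow> real" where
  "l1norm n x = (\<Sum>i=1..n. \<bar>x i\<bar>)"

lemma vectors_le_iff: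
  assumes "h \<in> vectors n" "g \<in> vectors n"
  shows "h \<le> g \<longleftrightarrow> (\<forall>i\<in>{1..n}. h i \<le> g i)"
proof
  assume *: "\<forall>i\<in>{1..n}. h i \<le> g i"
  show "h \<le> g"
  proof (rule le_funI)
    fix i show "h i \<le> g i"
      using * PiE_arb[OF assms(1), of i] PiE_arb[OF assms(2), of i] by (cases "i \<in> {1..n}") simp_all
  qed
qed (simp add: le_fun_def)

section \<open>The Gaussian model\<close>

definition noise :: "nat \<Rightarrow> (nat \<Rightarrow> real) measure" where
  "noise n = Pi\<^sub>M {1..n} (\<lambda>_. density lborel std_normal_density)"

definition observation :: "nat \<Rightarrow> real \<Rightarrow> (nat \<Rightarrow> real) \<Rightarrow> (nat \<Rightarrow> real) \<Rightarrow> (nat \<Rightarrow> real)" where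
  "observation n \<sigma> \<mu> \<xi> = (\<lambda>i\<in>{1..n}. \<mu> i + \<sigma> * \<xi> i)"

text \<open>
  The Bochner integral is \<open>0\<close> on non-integrable functions; the losses it is applied to below
  are integrable, see \<open>integrable_loss_linear_est\<close> and \<open>integrable_loss_exp_weighting\<close>.
\<close>

definition expect :: "nat \<Rightarrow> real \<Rightarrow> (nat \<Rightarrow> real) \<Rightarrow> ((nat \<Rightarrow> real) \<Rightarrow> real) \<Rightarrow> real" where
  "expect n \<sigma> \<mu> F = (\<integral>\<xi>. F (observation n \<sigma> \<mu> \<xi>) \<partial>noise n)"

definition loss :: "nat \<Rightarrow> (nat \<Rightarrow> real) \<Rightarrow> (nat \<Rightarrow> real) \<Rightarrow> real" where
  "loss n x \<mu> = sqnorm n (\<lambda>i\<in>{1..n}. x i - \<mu> i)"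

section \<open>Ordered multipliers\<close>

definition ordered_multipliers :: "nat \<Rightarrow> (nat \<Rightarrow> real) set \<Rightarrow> bool" where
  "ordered_multipliers n H \<longleftrightarrow>
     finite H \<and> H \<noteq> {} \<and> H \<subseteq> vectors n \<and>
     (\<forall>h\<in>H. \<forall>i\<in>{1..n}. h i \<in> {0..1}) \<and>
     (\<forall>h\<in>H. \<forall>i\<in>{1..<n}. h (i + 1) \<le> h i) \<and>
     (\<forall>h\<in>H. \<forall>g\<in>H. (\<exists>k\<in>{1..n}. h k < g k) \<longrightarrow> (\<forall>i\<in>{1..n}. h i \<le> g i))"

definition hmax :: "(nat \<Rightarrow> real) set \<Rightarrow> (nat \<Rightarrow> real)" where
  "hmax H = (GREATEST h. h \<in> H)"

definition hsucc :: "(nat \<Rightarrow> real) set \<Rightarrow> (nat \<Rightarrow> real) \<Rightarrow> (nat \<Rightarrow> real)" where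
  "hsucc H h = (LEAST g. g \<in> H \<and> h < g)"

section \<open>Linear estimates and exponential weighting\<close>

definition linear_est :: "nat \<Rightarrow> (nat \<Rightarrow> real) \<Rightarrow> (nat \<Rightarrow> real) \<Rightarrow> (nat \<Rightarrow> real)" where
  "linear_est n h Y = (\<lambda>i\<in>{1..n}. h i * Y i)"

definition oracle_risk :: "nat \<Rightarrow> real \<Rightarrow> (nat \<Rightarrow> real) set \<Rightarrow> (nat \<Rightarrow> real) \<Rightarrow> real" where
  "oracle_risk n \<sigma> H \<mu> = (MIN h\<in>H. expect n \<sigma> \<mu> (\<lambda>Y. loss n (linear_est n h Y) \<mu>))"

definition risk_estimate :: "nat \<Rightarrow> real \<Rightarrow> (nat \<Rightarrow> real) \<Rightarrow> (nat \<Rightarrow> real) \<Rightarrow> real" where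
  "risk_estimate n \<sigma> Y h =
     sqnorm n (\<lambda>i\<in>{1..n}. Y i - linear_est n h Y i) + 2 * \<sigma>\<^sup>2 * (\<Sum>i=1..n. h i) - \<sigma>\<^sup>2 * real n"

definition prior :: "nat \<Rightarrow> real \<Rightarrow> (nat \<Rightarrow> real) set \<Rightarrow> (nat \<Rightarrow> real) \<Rightarrow> real" where
  "prior n \<beta> H h =
     (if h = hmax H then 1 else 1 - exp (- (l1norm n (hsucc H h) - l1norm n h) / \<beta>))"

definition weight ::
  "nat \<Rightarrow> real \<Rightarrow> real \<Rightarrow> (nat \<Rightarrow> real) set \<Rightarrow> (nat \<Rightarrow> real) \<Rightarrow> (nat \<Rightarrow> real) \<Rightarrow> real" where
  "weight n \<beta> \<sigma> H h Y =
     prior n \<beta> H h * exp (- risk_estimate n \<sigma> Y h / (2 * \<beta> * \<sigma>\<^sup>2)) /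
     (\<Sum>g\<in>H. prior n \<beta> H g * exp (- risk_estimate n \<sigma> Y g / (2 * \<beta> * \<sigma>\<^sup>2)))"

definition exp_weighting ::
  "nat \<Rightarrow> real \<Rightarrow> real \<Rightarrow> (nat \<Rightarrow> real) set \<Rightarrow> (nat \<Rightarrow> real) \<Rightarrow> (nat \<Rightarrow> real)" where
  "exp_weighting n \<beta> \<sigma> H Y = (\<lambda>i\<in>{1..n}. \<Sum>h\<in>H. weight n \<beta> \<sigma> H h Y * linear_est n h Y i)"

section \<open>Well-definedness\<close>

lemma ordered_multipliers_total:
  assumes "ordered_multipliers n H" "h \<in> H" "g \<in> H"
  shows "h \<le> g \<or> g \<le> h"
proof -
  have v: "h \<in> vectors n" "g \<in> vectors n"
    using assms unfolding ordered_multipliers_def by blast+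
  have "(\<exists>k\<in>{1..n}. h k < g k) \<longrightarrow> (\<forall>i\<in>{1..n}. h i \<le> g i)"
    using assms unfolding ordered_multipliers_def by blast
  then show ?thesis
    unfolding vectors_le_iff[OF v] vectors_le_iff[OF v(2,1)] by (meson not_less)
qed

lemma finite_chain_least:
  fixes A :: "'a::order set"
  assumes "finite A" "A \<noteq> {}" "\<And>x y. x \<in> A \<Longrightarrow> y \<in> A \<Longrightarrow> x \<le> y \<or> y \<le> x"
  shows "\<exists>m\<in>A. \<forall>x\<in>A. m \<le> x"
proof -
  obtain m where m: "m \<in> A" "\<And>x. x \<in> A \<Longrightarrow> x \<le> m \<Longrightarrow> x = m"
    using finite_has_minimal[OF assms(1,2)] by metis
  then have "m \<le> x" if "x \<in> A" for x using assms(3)[OF that m(1)] that m(2) by auto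
  with m(1) show ?thesis by blast
qed

lemma finite_chain_greatest:
  fixes A :: "'a::order set"
  assumes "finite A" "A \<noteq> {}" "\<And>x y. x \<in> A \<Longrightarrow> y \<in> A \<Longrightarrow> x \<le> y \<or> y \<le> x"
  shows "\<exists>m\<in>A. \<forall>x\<in>A. x \<le> m"
proof -
  obtain m where m: "m \<in> A" "\<And>x. x \<in> A \<Longrightarrow> m \<le> x \<Longrightarrow> x = m"
    using finite_has_maximal[OF assms(1,2)] by metis
  then have "x \<le> m" if "x \<in> A" for x using assms(3)[OF that m(1)] that m(2) by auto
  with m(1) show ?thesis by blast
qed

lemma hmax:
  assumes "ordered_multipliers n H"
  shows "hmax H \<in> H" and "h \<in> H \<Longrightarrow> h \<le> hmax H"
proof -
  have "finite H" "H \<noteq> {}" using assms unfolding ordered_multipliers_def by auto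
  then obtain m where m: "m \<in> H" "\<And>x. x \<in> H \<Longrightarrow> x \<le> m"
    using finite_chain_greatest ordered_multipliers_total[OF assms] by meson
  then have "hmax H = m" unfolding hmax_def by (intro Greatest_equality) auto
  with m show "hmax H \<in> H" "h \<in> H \<Longrightarrow> h \<le> hmax H" by auto
qed

lemma hsucc:
  assumes "ordered_multipliers n H" "h \<in> H" "h \<noteq> hmax H"
  shows "hsucc H h \<in> H" and "h < hsucc H h" and "g \<in> H \<Longrightarrow> h < g \<Longrightarrow> hsucc H h \<le> g"
proof -
  let ?A = "{g \<in> H. h < g}"
  have "finite ?A" using assms unfolding ordered_multipliers_def by auto
  moreover have "hmax H \<in> ?A" using hmax[OF assms(1)] assms(2,3) by (auto simp: order.strict_iff_order)
  ultimately have "\<exists>m\<in>?A. \<forall>x\<in>?A. m \<le> x"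
    using ordered_multipliers_total[OF assms(1)] by (intro finite_chain_least) auto
  then obtain m where m: "m \<in> ?A" "\<And>x. x \<in> ?A \<Longrightarrow> m \<le> x" by meson
  then have "hsucc H h = m" unfolding hsucc_def by (intro Least_equality) auto
  with m show "hsucc H h \<in> H" "h < hsucc H h" "g \<in> H \<Longrightarrow> h < g \<Longrightarrow> hsucc H h \<le> g" by auto
qed

lemma prob_space_std_normal: "prob_space (density lborel std_normal_density)"
  by (rule prob_space_normal_density) simp

lemma prob_space_noise: "prob_space (noise n)"
  unfolding noise_def by (intro prob_space_PiM prob_space_std_normal)

lemma noise_component_power:
  assumes "i \<in> {1..n}"
  shows "integrable (noise n) (\<lambda>\<xi>. (\<xi> i) ^ k)"
    and "(\<integral>\<xi>. (\<xi> i) ^ k \<partial>noise n) = (\<integral>x. std_normal_density x * x ^ k \<partial>lborel)"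
proof -
  have d: "distr (noise n) (density lborel std_normal_density) (\<lambda>\<xi>. \<xi> i)
             = density lborel std_normal_density"
    unfolding noise_def by (intro distr_PiM_component prob_space_std_normal assms finite_atLeastAtMost)
  have c: "(\<lambda>\<xi>. \<xi> i) \<in> measurable (noise n) (density lborel std_normal_density)"
    unfolding noise_def by (rule measurable_component_singleton[OF assms])
  have "integrable (density lborel std_normal_density) (\<lambda>x::real. x ^ k)"
    using integrable_std_normal_moment[of k] by (subst integrable_density) auto
  then show "integrable (noise n) (\<lambda>\<xi>. (\<xi> i) ^ k)"
    using integrable_distr_eq[OF c, of "\<lambda>x. x ^ k"] d by simp
  have "(\<integral>\<xi>. (\<xi> i) ^ k \<partial>noise n) = (\<integral>x. x ^ k \<partial>density lborel std_normal_density)"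
    using integral_distr[OF c, of "\<lambda>x. x ^ k"] d by simp
  also have "\<dots> = (\<integral>x. std_normal_density x * x ^ k \<partial>lborel)"
    by (subst integral_density) auto
  finally show "(\<integral>\<xi>. (\<xi> i) ^ k \<partial>noise n) = (\<integral>x. std_normal_density x * x ^ k \<partial>lborel)" .
qed

lemma noise_moments:
  assumes "i \<in> {1..n}"
  shows "integrable (noise n) (\<lambda>\<xi>. \<xi> i)" "(\<integral>\<xi>. \<xi> i \<partial>noise n) = 0"
    and "integrable (noise n) (\<lambda>\<xi>. (\<xi> i)\<^sup>2)" "(\<integral>\<xi>. (\<xi> i)\<^sup>2 \<partial>noise n) = 1"
  using noise_component_power[OF assms, of 1] noise_component_power[OF assms, of 2]
    integral_std_normal_moment_odd[of 0] integral_std_normal_moment_even[of 1]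
  by (simp_all add: mult.commute)

lemma integrable_affine_sq:
  assumes "i \<in> {1..n}"
  shows "integrable (noise n) (\<lambda>\<xi>. (a + b * \<xi> i)\<^sup>2)"
    and "(\<integral>\<xi>. (a + b * \<xi> i)\<^sup>2 \<partial>noise n) = a\<^sup>2 + b\<^sup>2"
proof -
  interpret prob_space "noise n" by (rule prob_space_noise)
  have e: "(a + b * x)\<^sup>2 = a\<^sup>2 + 2 * a * b * x + b\<^sup>2 * x\<^sup>2" for x
    by (simp add: power2_eq_square algebra_simps)
  show "integrable (noise n) (\<lambda>\<xi>. (a + b * \<xi> i)\<^sup>2)" "(\<integral>\<xi>. (a + b * \<xi> i)\<^sup>2 \<partial>noise n) = a\<^sup>2 + b\<^sup>2"
    unfolding e using noise_moments[OF assms] by (simp_all add: prob_space)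
qed

lemma loss_linear_est:
  "loss n (linear_est n h (observation n \<sigma> \<mu> \<xi>)) \<mu> =
     (\<Sum>i=1..n. (- (1 - h i) * \<mu> i + (\<sigma> * h i) * \<xi> i)\<^sup>2)"
  unfolding loss_def sqnorm_def linear_est_def observation_def
  by (intro sum.cong refl arg_cong[where f = "\<lambda>x. x\<^sup>2"]) (simp add: algebra_simps)

lemma integrable_loss_linear_est:
  "integrable (noise n) (\<lambda>\<xi>. loss n (linear_est n h (observation n \<sigma> \<mu> \<xi>)) \<mu>)"
  unfolding loss_linear_est by (intro Bochner_Integration.integrable_sum integrable_affine_sq)

lemma expect_loss_linear_est:
  "expect n \<sigma> \<mu> (\<lambda>Y. loss n (linear_est n h Y) \<mu>) =
     (\<Sum>i=1..n. (1 - h i)\<^sup>2 * (\<mu> i)\<^sup>2) + \<sigma>\<^sup>2 * sqnorm n h"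
proof -
  have "expect n \<sigma> \<mu> (\<lambda>Y. loss n (linear_est n h Y) \<mu>) =
      (\<Sum>i=1..n. \<integral>\<xi>. (- (1 - h i) * \<mu> i + (\<sigma> * h i) * \<xi> i)\<^sup>2 \<partial>noise n)"
    unfolding expect_def loss_linear_est
    by (intro Bochner_Integration.integral_sum integrable_affine_sq)
  also have "\<dots> = (\<Sum>i=1..n. (1 - h i)\<^sup>2 * (\<mu> i)\<^sup>2 + \<sigma>\<^sup>2 * (h i)\<^sup>2)"
    by (intro sum.cong refl, subst integrable_affine_sq(2))
      (auto simp: power_mult_distrib power2_commute)
  finally show ?thesis by (simp add: sum.distrib sqnorm_def sum_distrib_left)
qed

lemma oracle_risk_eq:
  "oracle_risk n \<sigma> H \<mu> =
     (MIN h\<in>H. (\<Sum>i=1..n. (1 - h i)\<^sup>2 * (\<mu> i)\<^sup>2) + \<sigma>\<^sup>2 * sqnorm n h)"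
  unfolding oracle_risk_def expect_loss_linear_est ..

lemma prior_nonneg:
  assumes "ordered_multipliers n H" "\<beta> > 0" "h \<in> H"
  shows "prior n \<beta> H h \<ge> 0"
proof (cases "h = hmax H")
  case False
  note s = hsucc[OF assms(1,3) False]
  have "\<bar>h i\<bar> \<le> \<bar>hsucc H h i\<bar>" if "i \<in> {1..n}" for i
  proof -
    have "0 \<le> h i" using assms(1,3) that unfolding ordered_multipliers_def by simp
    moreover have "h i \<le> hsucc H h i" using less_imp_le[OF s(2)] by (rule le_funD)
    ultimately show ?thesis by linarith
  qed
  then have "l1norm n h \<le> l1norm n (hsucc H h)"
    unfolding l1norm_def by (rule sum_mono)
  then show ?thesis using assms(2) by (simp add: prior_def False divide_nonpos_pos)
qed (simp add: prior_def)

lemma weight_bounds: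
  assumes "ordered_multipliers n H" "\<beta> > 0" "h \<in> H"
  shows "0 \<le> weight n \<beta> \<sigma> H h Y" "weight n \<beta> \<sigma> H h Y \<le> 1"
proof -
  have f: "finite H" using assms(1) unfolding ordered_multipliers_def by auto
  let ?t = "\<lambda>g. prior n \<beta> H g * exp (- risk_estimate n \<sigma> Y g / (2 * \<beta> * \<sigma>\<^sup>2))"
  have t: "?t g \<ge> 0" if "g \<in> H" for g using prior_nonneg[OF assms(1,2) that] by simp
  show "0 \<le> weight n \<beta> \<sigma> H h Y"
    unfolding weight_def using t assms(3) by (intro divide_nonneg_nonneg sum_nonneg) auto
  have "?t h \<le> sum ?t H" using t f assms(3) by (intro member_le_sum) auto
  then show "weight n \<beta> \<sigma> H h Y \<le> 1"
    unfolding weight_def using t[OF assms(3)] by (intro divide_le_eq_1[THEN iffD2]) linarith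
qed

lemma integrable_loss_exp_weighting:
  assumes "ordered_multipliers n H" "\<beta> > 0"
  shows "integrable (noise n) (\<lambda>\<xi>. loss n (exp_weighting n \<beta> \<sigma> H (observation n \<sigma> \<mu> \<xi>)) \<mu>)"
proof -
  let ?Y = "observation n \<sigma> \<mu>"
  interpret prob_space "noise n" by (rule prob_space_noise)
  have meas: "(\<lambda>\<xi>. \<xi> i) \<in> borel_measurable (noise n)" if "i \<in> {1..n}" for i
    using noise_moments(1)[OF that] by (rule borel_measurable_integrable)
  have obs: "(\<lambda>\<xi>. ?Y \<xi> i) \<in> borel_measurable (noise n)" if "i \<in> {1..n}" for i
    using meas[OF that] that by (simp add: observation_def)
  have est: "(\<lambda>\<xi>. linear_est n h (?Y \<xi>) i) \<in> borel_measurable (noise n)" if "i \<in> {1..n}" for h i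
    using obs[OF that] that by (simp add: linear_est_def)
  have re: "(\<lambda>\<xi>. risk_estimate n \<sigma> (?Y \<xi>) h) \<in> borel_measurable (noise n)" for h
    unfolding risk_estimate_def sqnorm_def
    by (intro borel_measurable_add borel_measurable_diff borel_measurable_sum borel_measurable_power
        borel_measurable_const) (use obs est in auto)
  have w: "(\<lambda>\<xi>. weight n \<beta> \<sigma> H h (?Y \<xi>)) \<in> borel_measurable (noise n)" for h
    unfolding weight_def using re by measurable
  have ew: "(\<lambda>\<xi>. exp_weighting n \<beta> \<sigma> H (?Y \<xi>) i) \<in> borel_measurable (noise n)" if "i \<in> {1..n}" for i
    unfolding exp_weighting_def using that w est[OF that] by simp
  have "integrable (noise n) (\<lambda>\<xi>. (exp_weighting n \<beta> \<sigma> H (?Y \<xi>) i - \<mu> i)\<^sup>2)" if i: "i \<in> {1..n}" for i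
  proof (rule Bochner_Integration.integrable_bound)
    show "integrable (noise n) (\<lambda>\<xi>. 2 * ((real (card H))\<^sup>2 * (\<mu> i + \<sigma> * \<xi> i)\<^sup>2) + 2 * (\<mu> i)\<^sup>2)"
      using integrable_affine_sq(1)[OF i] by simp
    show "(\<lambda>\<xi>. (exp_weighting n \<beta> \<sigma> H (?Y \<xi>) i - \<mu> i)\<^sup>2) \<in> borel_measurable (noise n)"
      using ew[OF i] by simp
    have "(exp_weighting n \<beta> \<sigma> H (?Y \<xi>) i - \<mu> i)\<^sup>2 \<le>
        2 * ((real (card H))\<^sup>2 * (\<mu> i + \<sigma> * \<xi> i)\<^sup>2) + 2 * (\<mu> i)\<^sup>2" for \<xi>
    proof -
      let ?a = "exp_weighting n \<beta> \<sigma> H (?Y \<xi>) i"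
      let ?y = "\<mu> i + \<sigma> * \<xi> i"
      have "\<bar>weight n \<beta> \<sigma> H h (?Y \<xi>) * linear_est n h (?Y \<xi>) i\<bar> \<le> \<bar>?y\<bar>" if "h \<in> H" for h
      proof -
        have "0 \<le> h i" "h i \<le> 1" using assms(1) that i unfolding ordered_multipliers_def by simp_all
        then have "weight n \<beta> \<sigma> H h (?Y \<xi>) * h i * \<bar>?y\<bar> \<le> 1 * 1 * \<bar>?y\<bar>"
          using weight_bounds[OF assms that] by (intro mult_right_mono mult_mono) auto
        then show ?thesis
          using \<open>0 \<le> h i\<close> weight_bounds[OF assms that] i
          by (simp add: linear_est_def observation_def abs_mult mult.assoc)
      qed
      then have "(\<Sum>h\<in>H. \<bar>weight n \<beta> \<sigma> H h (?Y \<xi>) * linear_est n h (?Y \<xi>) i\<bar>)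
          \<le> of_nat (card H) * \<bar>?y\<bar>"
        by (rule sum_bounded_above)
      moreover have "\<bar>?a\<bar> \<le> (\<Sum>h\<in>H. \<bar>weight n \<beta> \<sigma> H h (?Y \<xi>) * linear_est n h (?Y \<xi>) i\<bar>)"
        unfolding exp_weighting_def restrict_apply'[OF i] by (rule sum_abs)
      ultimately have "\<bar>?a\<bar> \<le> card H * \<bar>?y\<bar>" by linarith
      then have "?a\<^sup>2 \<le> (card H * \<bar>?y\<bar>)\<^sup>2"
        by (metis abs_ge_zero power2_abs power_mono)
      then have "?a\<^sup>2 \<le> (real (card H))\<^sup>2 * ?y\<^sup>2" by (simp add: power_mult_distrib)
      moreover have "(?a - \<mu> i)\<^sup>2 \<le> 2 * ?a\<^sup>2 + 2 * (\<mu> i)\<^sup>2"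
        using zero_le_power2[of "?a + \<mu> i"] unfolding power2_sum power2_diff by linarith
      ultimately show ?thesis by linarith
    qed
    then show "AE \<xi> in noise n. norm ((exp_weighting n \<beta> \<sigma> H (?Y \<xi>) i - \<mu> i)\<^sup>2) \<le>
        norm (2 * ((real (card H))\<^sup>2 * (\<mu> i + \<sigma> * \<xi> i)\<^sup>2) + 2 * (\<mu> i)\<^sup>2)"
      by (intro AE_I2) (simp add: order_trans[OF _ abs_ge_self])
  qed
  then have "integrable (noise n) (\<lambda>\<xi>. \<Sum>i=1..n. (exp_weighting n \<beta> \<sigma> H (?Y \<xi>) i - \<mu> i)\<^sup>2)"
    by (intro Bochner_Integration.integrable_sum) auto
  also have "(\<lambda>\<xi>. \<Sum>i=1..n. (exp_weighting n \<beta> \<sigma> H (?Y \<xi>) i - \<mu> i)\<^sup>2) =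
      (\<lambda>\<xi>. loss n (exp_weighting n \<beta> \<sigma> H (?Y \<xi>)) \<mu>)"
    unfolding loss_def sqnorm_def by (intro ext sum.cong) auto
  finally show ?thesis .
qed

end

theory Submission
  imports Defs "HOL-Real_Asymp.Real_Asymp"
begin

text \<open>
  Let \<open>x\<close> be the oracle risk divided by \<open>\<sigma>\<^sup>2\<close>, let \<open>hs\<close> attain the oracle risk, and call
  \<open>energy h\<close> the unbiased risk estimate of \<open>h\<close> minus that of \<open>hs\<close>, divided by \<open>2 * \<beta> * \<sigma>\<^sup>2\<close>.
  The exponential weights are the Gibbs weights of this energy relative to the prior. The proof
  shows that a constant function \<open>\<Psi>\<close> suffices, and rests on three ideas.

  \<^item> Integration by parts for the Gaussian law (Stein's identity) turns the risk of the aggregate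
  into the mean of an unbiased risk estimate. The derivative of the weights produces a covariance
  term, and the convexity of the squared loss a negative variance term; for \<open>\<beta> \<ge> 4\<close> the second
  pays for the first. So the risk is at most the expected weighted average of the unbiased risk
  estimates (\<open>risk_le_average_unbiased_risk\<close>), that is, the oracle risk plus
  \<open>2 * \<beta> * \<sigma>\<^sup>2 * mean_energy\<close>.

  \<^item> With \<open>Z t = (\<Sum>h\<in>H. \<pi> h * exp (- t * energy h))\<close>, Jensen's inequality for the weights gives
  \<open>(1 - t) * (average energy) \<le> ln (Z t) - ln (Z 1)\<close>. By concavity of the logarithm the
  expectation of \<open>ln (Z t)\<close> is at most the logarithm of the expectation of \<open>Z t\<close>, which involves only
  exponential moments of one Gaussian quadratic form at a time (\<open>exp_energy_moments\<close>): no supremum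
  over the family is ever controlled. The prior telescopes, whence \<open>Z 1 \<ge> exp (- energy h)\<close> for
  every \<open>h\<close> (\<open>gibbs_sum_ge\<close>); in particular \<open>Z 1 \<ge> 1\<close>.

  \<^item> The expectation of \<open>energy h\<close> is the excess \<open>R h \<ge> 0\<close> of the risk of \<open>h\<close> over the oracle risk,
  in units of \<open>2 * \<beta> * \<sigma>\<^sup>2\<close>, and its variance is at most of order \<open>x + R h\<close>. Taking \<open>t = 1 / sqrt x\<close> keeps the
  fluctuations bounded, and the expectation of \<open>Z t\<close> is then essentially the prior mass of those \<open>h\<close>
  whose \<open>R h\<close> is at most of order \<open>sqrt x\<close>. A priori this mass is only known to be at most of
  order \<open>x / K\<close>, which is too much when \<open>K\<close> is small. Call \<open>h\<close> far if its \<open>l1\<close> norm differs from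
  that of \<open>hs\<close> by more than \<open>x / 16\<close>. If all far \<open>h\<close> have \<open>R h \<ge> c * sqrt x\<close>, the
  expectation of \<open>Z t\<close> is at most \<open>x / 2\<close> for large \<open>x\<close> (\<open>mean_energy_le_if_far_costly\<close>). If some far \<open>h\<close> has a smaller \<open>R h\<close>, the
  lower bound on \<open>sqnorm\<close> increments forces its energy to fluctuate on the scale \<open>sqrt x\<close>
  (\<open>bias_gap_spread_ge\<close>), hence \<open>- energy h\<close> is of order \<open>sqrt x\<close> with probability bounded
  below, and \<open>ln (Z 1)\<close> has an expectation of order \<open>sqrt x\<close>, which outweighs \<open>ln (x / K)\<close>
  (\<open>mean_energy_le_if_far_cheap\<close>). In both cases \<open>mean_energy \<le> ln x\<close> once \<open>x\<close> exceeds a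
  threshold; below the threshold the choice \<open>t = 1 / 4\<close> bounds \<open>mean_energy\<close> by a constant.
\<close>

section \<open>Gaussian integrals\<close>

abbreviation gauss :: "real measure" where
  "gauss \<equiv> density lborel std_normal_density"

lemma gauss_integral:
  assumes "f \<in> borel_measurable borel"
  shows "integrable gauss f \<longleftrightarrow> integrable lborel (\<lambda>x. std_normal_density x * f x)"
    and "(\<integral>x. f x \<partial>gauss) = (\<integral>x. std_normal_density x * f x \<partial>lborel)"
  using assms by (auto simp: integrable_density integral_density)

lemma integrable_gauss_power [simp]: "integrable gauss (\<lambda>x. x ^ k)"
  using integrable_std_normal_moment[of k] by (subst gauss_integral(1)) auto

lemma integrable_gauss_quadratic_growth:
  assumes "f \<in> borel_measurable borel" "\<And>x. \<bar>f x\<bar> \<le> A * (1 + x\<^sup>2)"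
  shows "integrable gauss f"
proof (rule Bochner_Integration.integrable_bound)
  interpret prob_space gauss by (rule prob_space_std_normal)
  show "integrable gauss (\<lambda>x. A * (1 + x\<^sup>2))" by simp
  show "f \<in> borel_measurable gauss" using assms(1) by simp
  show "AE x in gauss. norm (f x) \<le> norm (A * (1 + x\<^sup>2))"
    using assms(2) by (intro AE_I2) (simp add: order_trans[OF _ abs_ge_self])
qed

text \<open>
  Completing the square: up to a constant factor, the integrand is again a normal density, with
  mean \<open>\<alpha> / (1 - 2 * \<gamma>)\<close> and variance \<open>1 / (1 - 2 * \<gamma>)\<close>.
\<close>

lemma gauss_exp_quadratic:
  assumes "2 * \<gamma> < 1"
  shows "integrable gauss (\<lambda>x. exp (\<alpha> * x + \<gamma> * x\<^sup>2))"
    and "(\<integral>x. exp (\<alpha> * x + \<gamma> * x\<^sup>2) \<partial>gauss) = exp (\<alpha>\<^sup>2 / (2 * (1 - 2 * \<gamma>))) / sqrt (1 - 2 * \<gamma>)"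
proof -
  define v where "v = 1 - 2 * \<gamma>"
  have v: "v > 0" using assms by (simp add: v_def)
  have e: "std_normal_density x * exp (\<alpha> * x + \<gamma> * x\<^sup>2) =
      exp (\<alpha>\<^sup>2 / (2 * v)) / sqrt v * normal_density (\<alpha> / v) (1 / sqrt v) x" for x
  proof -
    have g: "\<gamma> = (1 - v) / 2" by (simp add: v_def)
    have "- x\<^sup>2 / 2 + (\<alpha> * x + \<gamma> * x\<^sup>2) = \<alpha>\<^sup>2 / (2 * v) + - (x - \<alpha> / v)\<^sup>2 / (2 * (1 / sqrt v)\<^sup>2)"
      using v unfolding g by (simp add: power_divide power2_diff) (simp add: field_simps power2_eq_square)
    then have "exp (- x\<^sup>2 / 2) * exp (\<alpha> * x + \<gamma> * x\<^sup>2) =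
        exp (\<alpha>\<^sup>2 / (2 * v)) * exp (- (x - \<alpha> / v)\<^sup>2 / (2 * (1 / sqrt v)\<^sup>2))"
      by (simp only: exp_add[symmetric])
    moreover have "sqrt (2 * pi * (1 / sqrt v)\<^sup>2) * sqrt v = sqrt (2 * pi)"
      using v by (simp add: power_divide real_sqrt_mult real_sqrt_divide)
    ultimately show ?thesis
      using v unfolding std_normal_density_def normal_density_def
      by (simp add: field_simps)
  qed
  have s: "1 / sqrt v > 0" using v by simp
  show "integrable gauss (\<lambda>x. exp (\<alpha> * x + \<gamma> * x\<^sup>2))"
    by (subst gauss_integral(1)) (auto simp: e intro!: integrable_normal_density s)
  show "(\<integral>x. exp (\<alpha> * x + \<gamma> * x\<^sup>2) \<partial>gauss) = exp (\<alpha>\<^sup>2 / (2 * (1 - 2 * \<gamma>))) / sqrt (1 - 2 * \<gamma>)"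
    by (subst gauss_integral(2)) (auto simp: e integral_normal_density[OF s] v_def[symmetric])
qed

lemma std_normal_density_deriv:
  "(std_normal_density has_real_derivative - x * std_normal_density x) (at x)"
  unfolding std_normal_density_def by (auto intro!: derivative_eq_intros simp: field_simps)

text \<open>
  Boundary terms of the integration by parts: the Gaussian density beats quadratic growth.
\<close>

lemma std_normal_density_growth_tendsto:
  assumes "\<And>x. \<bar>f x\<bar> \<le> A * (1 + x\<^sup>2)"
  shows "((\<lambda>x. std_normal_density x * f x) \<longlongrightarrow> 0) at_top"
    and "((\<lambda>x. std_normal_density x * f x) \<longlongrightarrow> 0) at_bot"
proof -
  have lim: "((\<lambda>x::real. \<bar>A\<bar> * (1 + x\<^sup>2) * (exp (- x\<^sup>2 / 2) / sqrt (2 * pi))) \<longlongrightarrow> 0) F" if "F \<in> {at_top, at_bot}" for F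
    using that by (elim insertE emptyE; simp; real_asymp)
  have b: "norm (std_normal_density x * f x) \<le> \<bar>A\<bar> * (1 + x\<^sup>2) * (exp (- x\<^sup>2 / 2) / sqrt (2 * pi))" for x
  proof -
    have "\<bar>f x\<bar> \<le> \<bar>A\<bar> * (1 + x\<^sup>2)"
      using assms[of x] by (rule order_trans) (intro mult_right_mono, auto)
    then show ?thesis
      unfolding std_normal_density_def by (simp add: abs_mult divide_simps)
  qed
  show "((\<lambda>x. std_normal_density x * f x) \<longlongrightarrow> 0) at_top"
    by (rule tendsto_norm_zero_cancel, rule tendsto_sandwich[OF _ _ tendsto_const lim])
       (use b in \<open>auto simp del: real_norm_def intro!: always_eventually\<close>)
  show "((\<lambda>x. std_normal_density x * f x) \<longlongrightarrow> 0) at_bot"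
    by (rule tendsto_norm_zero_cancel, rule tendsto_sandwich[OF _ _ tendsto_const lim])
       (use b in \<open>auto simp del: real_norm_def intro!: always_eventually\<close>)
qed

text \<open>
  Stein's identity, from the fundamental theorem of calculus on the whole line: the density times
  \<open>f' x - x * f x\<close> is the derivative of the density times \<open>f x\<close>.
\<close>

lemma gauss_integration_by_parts:
  fixes f f' :: "real \<Rightarrow> real"
  assumes deriv: "\<And>x. (f has_real_derivative f' x) (at x)"
    and cont: "\<And>x. isCont f' x"
    and bound: "\<And>x. \<bar>f x\<bar> \<le> A * (1 + x\<^sup>2)" "\<And>x. \<bar>x * f x\<bar> \<le> A * (1 + x\<^sup>2)"
      "\<And>x. \<bar>f' x\<bar> \<le> A * (1 + x\<^sup>2)"
  shows "(\<integral>x. x * f x \<partial>gauss) = (\<integral>x. f' x \<partial>gauss)"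
proof -
  have cf: "isCont f x" for x using deriv DERIV_isCont by blast
  have mf: "f \<in> borel_measurable borel"
    using cf by (intro borel_measurable_continuous_onI continuous_at_imp_continuous_on) auto
  have mf': "f' \<in> borel_measurable borel"
    using cont by (intro borel_measurable_continuous_onI continuous_at_imp_continuous_on) auto
  have cd: "isCont std_normal_density x" for x
    using std_normal_density_deriv DERIV_isCont by blast
  have i1: "integrable gauss f'"
    using mf' bound(3) by (rule integrable_gauss_quadratic_growth)
  have i2: "integrable gauss (\<lambda>x. x * f x)"
    using mf bound(2) by (intro integrable_gauss_quadratic_growth) auto
  have i: "integrable lborel (\<lambda>x. std_normal_density x * (f' x - x * f x))"
    using Bochner_Integration.integrable_diff[OF i1 i2] mf mf' by (subst (asm) gauss_integral(1)) auto
  have "(LBINT x=-\<infinity>..\<infinity>. std_normal_density x * (f' x - x * f x)) = 0 - 0"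
  proof (rule interval_integral_FTC_integrable[where F = "\<lambda>x. std_normal_density x * f x"])
    show "((\<lambda>x. std_normal_density x * f x) has_vector_derivative std_normal_density x * (f' x - x * f x)) (at x)" for x
      unfolding has_real_derivative_iff_has_vector_derivative[symmetric]
      by (rule derivative_eq_intros std_normal_density_deriv deriv refl)+ (simp add: algebra_simps)
    show "isCont (\<lambda>x. std_normal_density x * (f' x - x * f x)) x" for x
      by (intro continuous_intros cd cont cf)
    show "set_integrable lborel (einterval (- \<infinity>) \<infinity>) (\<lambda>x. std_normal_density x * (f' x - x * f x))"
      using i by (simp add: set_integrable_def)
    show "(((\<lambda>x. std_normal_density x * f x) \<circ> real_of_ereal) \<longlongrightarrow> 0) (at_right (- \<infinity>))"
      using std_normal_density_growth_tendsto(2)[OF bound(1)] by (simp add: ereal_tendsto_simps)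
    show "(((\<lambda>x. std_normal_density x * f x) \<circ> real_of_ereal) \<longlongrightarrow> 0) (at_left \<infinity>)"
      using std_normal_density_growth_tendsto(1)[OF bound(1)] by (simp add: ereal_tendsto_simps)
  qed simp
  then have "(\<integral>x. std_normal_density x * (f' x - x * f x) \<partial>lborel) = 0"
    by (simp add: interval_lebesgue_integral_def set_lebesgue_integral_def)
  then have "(\<integral>x. f' x - x * f x \<partial>gauss) = 0"
    using mf mf' by (subst gauss_integral(2)) auto
  then show ?thesis using i1 i2 by simp
qed

section \<open>Unbiased risk estimation in one dimension\<close>

text \<open>
  On the nonnegative numbers \<open>a\<close> and \<open>a\<^sup>2\<close> are similarly ordered, so their covariance is
  nonnegative: it is the average of \<open>(a - m)\<^sup>2 * (a + m)\<close>, where \<open>m\<close> is the mean.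
\<close>

lemma weighted_cov_square_nonneg:
  fixes w a :: "'h \<Rightarrow> real"
  assumes "\<And>h. h \<in> H \<Longrightarrow> 0 \<le> w h" "(\<Sum>h\<in>H. w h) = 1" "\<And>h. h \<in> H \<Longrightarrow> 0 \<le> a h"
  shows "(\<Sum>h\<in>H. w h * a h) * (\<Sum>h\<in>H. w h * (a h)\<^sup>2) \<le> (\<Sum>h\<in>H. w h * (a h) ^ 3)"
proof -
  define m where "m = (\<Sum>h\<in>H. w h * a h)"
  have "0 \<le> m" unfolding m_def using assms by (intro sum_nonneg) auto
  then have "0 \<le> (\<Sum>h\<in>H. w h * ((a h - m)\<^sup>2 * (a h + m)))"
    using assms by (intro sum_nonneg mult_nonneg_nonneg) auto
  also have "\<dots> = (\<Sum>h\<in>H. w h * (a h) ^ 3 - m * (w h * (a h)\<^sup>2) - m\<^sup>2 * (w h * a h) + m ^ 3 * w h)"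
    by (intro sum.cong refl) (simp add: power2_eq_square power3_eq_cube algebra_simps)
  also have "\<dots> = (\<Sum>h\<in>H. w h * (a h) ^ 3) - m * (\<Sum>h\<in>H. w h * (a h)\<^sup>2) - m\<^sup>2 * m + m ^ 3 * 1"
    unfolding sum.distrib sum_subtractf sum_distrib_left[symmetric] assms(2) m_def[symmetric] ..
  finally show ?thesis unfolding m_def[symmetric] by (simp add: power2_eq_square power3_eq_cube)
qed

text \<open>
  The one-dimensional core of the risk bound, with \<open>a h\<close> in the role of the multiplier of one
  coordinate, \<open>c h\<close> collecting the prior and the other coordinates, and \<open>s = 1 / (2 * \<beta> * \<sigma>\<^sup>2)\<close>.
  With \<open>W\<close> and \<open>V\<close> the mean and variance of \<open>a\<close> under the weights, Stein's identity replaces the squared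
  loss by \<open>(y * (1 - W))\<^sup>2 + 2 * \<sigma>\<^sup>2 * W - \<sigma>\<^sup>2 + 2 * \<sigma> * y * W'\<close>. Here \<open>y * W'\<close> is
  \<open>2 * s * \<sigma> * y\<^sup>2\<close> times the covariance of \<open>a\<close> and \<open>2 * a - a\<^sup>2\<close>, which is at most \<open>2 * V\<close>. As
  \<open>8 * \<sigma>\<^sup>2 * s \<le> 1\<close>, the last term is at most \<open>y\<^sup>2 * V\<close>, which is what the square loses against
  the average of \<open>(1 - a)\<^sup>2 * y\<^sup>2\<close>.
  The bound is put as nonnegativity of the integral of a difference because in this form it can be
  integrated over the remaining coordinates knowing only that the difference is integrable.
\<close>

lemma gauss_unbiased_risk_bound:
  fixes a c :: "'h \<Rightarrow> real" and s \<sigma> \<mu> :: real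
  assumes H: "finite H" and a: "\<And>h. h \<in> H \<Longrightarrow> 0 \<le> a h \<and> a h \<le> 1"
    and c: "\<And>h. h \<in> H \<Longrightarrow> 0 \<le> c h" "\<exists>h\<in>H. 0 < c h"
    and s: "0 \<le> s" "8 * \<sigma>\<^sup>2 * s \<le> 1"
  defines "y \<equiv> \<lambda>x. \<mu> + \<sigma> * x"
  defines "p \<equiv> \<lambda>x h. c h * exp (- (s * (1 - a h)\<^sup>2 * (y x)\<^sup>2))"
  defines "w \<equiv> \<lambda>x h. p x h / (\<Sum>g\<in>H. p x g)"
  shows "0 \<le> (\<integral>x. (\<Sum>h\<in>H. w x h * ((1 - a h)\<^sup>2 * (y x)\<^sup>2 + 2 * \<sigma>\<^sup>2 * a h - \<sigma>\<^sup>2)) -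
    ((\<Sum>h\<in>H. w x h * a h) * y x - \<mu>)\<^sup>2 \<partial>gauss)"
proof -
  interpret prob_space gauss by (rule prob_space_std_normal)
  have D: "(\<Sum>g\<in>H. p x g) > 0" for x
  proof -
    obtain h where "h \<in> H" "0 < c h" using c(2) by blast
    then show ?thesis unfolding p_def using c(1) H by (intro sum_pos2[of _ h]) auto
  qed
  have p0: "0 \<le> p x h" if "h \<in> H" for x h using c(1)[OF that] by (simp add: p_def)
  have w0: "0 \<le> w x h" if "h \<in> H" for x h using p0[OF that] D[of x] by (simp add: w_def)
  have w1: "(\<Sum>h\<in>H. w x h) = 1" for x
    unfolding w_def sum_divide_distrib[symmetric] using D[of x] by simp
  have avg: "0 \<le> (\<Sum>h\<in>H. w x h * b h) \<and> (\<Sum>h\<in>H. w x h * b h) \<le> 1"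
    if "\<And>h. h \<in> H \<Longrightarrow> 0 \<le> b h \<and> b h \<le> 1" for x and b :: "'h \<Rightarrow> real"
  proof
    show "0 \<le> (\<Sum>h\<in>H. w x h * b h)" using that w0 by (intro sum_nonneg) auto
    have "(\<Sum>h\<in>H. w x h * b h) \<le> (\<Sum>h\<in>H. w x h * 1)"
      using that w0 by (intro sum_mono mult_left_mono) auto
    then show "(\<Sum>h\<in>H. w x h * b h) \<le> 1" using w1[of x] by simp
  qed
  define W where "W x = (\<Sum>h\<in>H. w x h * a h)" for x
  define B where "B x = (\<Sum>h\<in>H. w x h * (1 - a h)\<^sup>2)" for x
  define V where "V x = (\<Sum>h\<in>H. w x h * (a h)\<^sup>2) - (W x)\<^sup>2" for x
  define Cv where "Cv x = (\<Sum>h\<in>H. w x h * (a h * (B x - (1 - a h)\<^sup>2)))" for x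
  have W01: "0 \<le> W x \<and> W x \<le> 1" for x unfolding W_def using a by (intro avg) auto
  have sq01: "0 \<le> (1 - a h)\<^sup>2 \<and> (1 - a h)\<^sup>2 \<le> 1" if "h \<in> H" for h
    using a[OF that] by (auto simp: abs_square_le_1)
  have B01: "0 \<le> B x \<and> B x \<le> 1" for x unfolding B_def using sq01 by (rule avg)
  have dp: "((\<lambda>x. p x h) has_real_derivative p x h * (- (2 * s * \<sigma> * y x * (1 - a h)\<^sup>2))) (at x)" for x h
    unfolding p_def y_def
    by (rule derivative_eq_intros refl)+ (simp add: algebra_simps power2_eq_square)
  have dD: "((\<lambda>x. \<Sum>g\<in>H. p x g) has_real_derivative
      (\<Sum>g\<in>H. p x g) * (- (2 * s * \<sigma> * y x * B x))) (at x)" for x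
  proof -
    have "(\<Sum>g\<in>H. p x g * (- (2 * s * \<sigma> * y x * (1 - a g)\<^sup>2))) =
        (- (2 * s * \<sigma> * y x)) * (\<Sum>g\<in>H. p x g * (1 - a g)\<^sup>2)"
      by (simp add: sum_distrib_left algebra_simps)
    also have "(\<Sum>g\<in>H. p x g * (1 - a g)\<^sup>2) = (\<Sum>g\<in>H. p x g) * B x"
      unfolding B_def w_def sum_distrib_left using D[of x] by (intro sum.cong refl) simp
    finally have e: "(\<Sum>g\<in>H. p x g * (- (2 * s * \<sigma> * y x * (1 - a g)\<^sup>2))) =
        (\<Sum>g\<in>H. p x g) * (- (2 * s * \<sigma> * y x * B x))" by (simp add: algebra_simps)
    show ?thesis unfolding e[symmetric] by (intro DERIV_sum dp)
  qed
  have dw: "((\<lambda>x. w x h) has_real_derivative w x h * (2 * s * \<sigma> * y x * (B x - (1 - a h)\<^sup>2))) (at x)" for x h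
    unfolding w_def
    by (rule DERIV_cong[OF DERIV_divide[OF dp dD]]) (use D[of x] in \<open>simp_all add: field_simps\<close>)
  have dW: "(W has_real_derivative 2 * s * \<sigma> * y x * Cv x) (at x)" for x
  proof -
    have e: "2 * s * \<sigma> * y x * Cv x = (\<Sum>h\<in>H. w x h * (2 * s * \<sigma> * y x * (B x - (1 - a h)\<^sup>2)) * a h)"
      unfolding Cv_def sum_distrib_left by (intro sum.cong refl) (simp add: algebra_simps)
    show ?thesis
      unfolding W_def[abs_def] e by (intro DERIV_sum DERIV_cmult_right dw)
  qed
  have cw: "isCont (\<lambda>x. w x h) x" for x h using dw DERIV_isCont by blast
  have cW: "isCont W x" for x using dW DERIV_isCont by blast
  have cy: "isCont y x" for x unfolding y_def by (intro continuous_intros)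
  have cB: "isCont B x" for x unfolding B_def[abs_def] by (intro continuous_intros cw)
  have cC: "isCont Cv x" for x unfolding Cv_def[abs_def] by (intro continuous_intros cw cB)
  have meas: "g \<in> borel_measurable borel" if "\<And>x. isCont g x" for g :: "real \<Rightarrow> real"
    using that by (intro borel_measurable_continuous_onI continuous_at_imp_continuous_on) auto
  have y_sq: "(y x)\<^sup>2 \<le> (2 * \<mu>\<^sup>2 + 2 * \<sigma>\<^sup>2) * (1 + x\<^sup>2)" for x
  proof -
    have "(y x)\<^sup>2 + (\<mu> - \<sigma> * x)\<^sup>2 = 2 * \<mu>\<^sup>2 + 2 * \<sigma>\<^sup>2 * x\<^sup>2"
      by (simp add: y_def power2_eq_square algebra_simps)
    moreover have "0 \<le> (\<mu> - \<sigma> * x)\<^sup>2" "0 \<le> \<mu>\<^sup>2 * x\<^sup>2" "0 \<le> \<sigma>\<^sup>2" by simp_all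
    moreover have "(2 * \<mu>\<^sup>2 + 2 * \<sigma>\<^sup>2) * (1 + x\<^sup>2) =
        2 * \<mu>\<^sup>2 + 2 * \<sigma>\<^sup>2 * x\<^sup>2 + 2 * (\<mu>\<^sup>2 * x\<^sup>2) + 2 * \<sigma>\<^sup>2"
      by (simp add: algebra_simps)
    ultimately show ?thesis by linarith
  qed
  have rhs_eq: "(\<Sum>h\<in>H. w x h * ((1 - a h)\<^sup>2 * (y x)\<^sup>2 + 2 * \<sigma>\<^sup>2 * a h - \<sigma>\<^sup>2)) =
      (y x)\<^sup>2 * B x + 2 * \<sigma>\<^sup>2 * W x - \<sigma>\<^sup>2" for x
  proof -
    have "(\<Sum>h\<in>H. w x h * ((1 - a h)\<^sup>2 * (y x)\<^sup>2 + 2 * \<sigma>\<^sup>2 * a h - \<sigma>\<^sup>2)) =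
        (\<Sum>h\<in>H. (y x)\<^sup>2 * (w x h * (1 - a h)\<^sup>2) + 2 * \<sigma>\<^sup>2 * (w x h * a h) - \<sigma>\<^sup>2 * w x h)"
      by (intro sum.cong refl) (simp add: algebra_simps)
    also have "\<dots> = (y x)\<^sup>2 * B x + 2 * \<sigma>\<^sup>2 * W x - \<sigma>\<^sup>2 * 1"
      unfolding sum.distrib sum_subtractf sum_distrib_left[symmetric] w1 B_def W_def ..
    finally show ?thesis by simp
  qed
  define f where "f x = y x * (1 - W x)" for x
  define f' where "f' x = \<sigma> * (1 - W x) - 2 * s * \<sigma> * (y x)\<^sup>2 * Cv x" for x
  define A where "A = \<bar>\<mu>\<bar> + \<bar>\<sigma>\<bar> + 2 * s * \<bar>\<sigma>\<bar> * (2 * \<mu>\<^sup>2 + 2 * \<sigma>\<^sup>2)"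
  have A0: "0 \<le> 2 * s * \<bar>\<sigma>\<bar> * (2 * \<mu>\<^sup>2 + 2 * \<sigma>\<^sup>2)" using s by simp
  have df: "(f has_real_derivative f' x) (at x)" for x
    unfolding f_def[abs_def] f'_def y_def
    by (rule derivative_eq_intros dW refl)+ (simp add: y_def algebra_simps power2_eq_square)
  have cf: "isCont f x" for x using df DERIV_isCont by blast
  have cf': "isCont f' x" for x unfolding f'_def[abs_def] by (intro continuous_intros cW cC cy)
  have Cv1: "\<bar>Cv x\<bar> \<le> 1" for x
  proof -
    have "\<bar>Cv x\<bar> \<le> (\<Sum>h\<in>H. \<bar>w x h * (a h * (B x - (1 - a h)\<^sup>2))\<bar>)" unfolding Cv_def by (rule sum_abs)
    also have "\<dots> \<le> (\<Sum>h\<in>H. w x h * 1)"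
    proof (rule sum_mono)
      fix h assume h: "h \<in> H"
      have "\<bar>a h\<bar> * \<bar>B x - (1 - a h)\<^sup>2\<bar> \<le> 1 * 1"
      proof (rule mult_mono)
        show "\<bar>B x - (1 - a h)\<^sup>2\<bar> \<le> 1" using B01[of x] sq01[OF h] by linarith
      qed (use a[OF h] in auto)
      then show "\<bar>w x h * (a h * (B x - (1 - a h)\<^sup>2))\<bar> \<le> w x h * 1"
        unfolding abs_mult using w0[OF h, of x] by (intro mult_mono) auto
    qed
    also have "\<dots> = 1" using w1 by simp
    finally show ?thesis .
  qed
  have fy: "\<bar>f x\<bar> \<le> \<bar>\<mu>\<bar> + \<bar>\<sigma>\<bar> * \<bar>x\<bar>" for x
  proof -
    have "\<bar>f x\<bar> \<le> \<bar>y x\<bar> * 1"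
      unfolding f_def abs_mult using W01[of x] by (intro mult_left_mono) auto
    also have "\<dots> \<le> \<bar>\<mu>\<bar> + \<bar>\<sigma>\<bar> * \<bar>x\<bar>"
      unfolding y_def by (simp add: abs_mult[symmetric] abs_triangle_ineq)
    finally show ?thesis .
  qed
  have xsq: "\<bar>x\<bar> \<le> 1 + x\<^sup>2" for x :: real
  proof -
    have "0 \<le> (\<bar>x\<bar> - 1)\<^sup>2" by simp
    then have "2 * \<bar>x\<bar> \<le> 1 + x\<^sup>2" by (simp add: power2_eq_square algebra_simps)
    then show ?thesis by simp
  qed
  have lift: "z \<le> A * (1 + x\<^sup>2)" if "z \<le> (\<bar>\<mu>\<bar> + \<bar>\<sigma>\<bar>) * (1 + x\<^sup>2)" for z x :: real
  proof -
    have "(\<bar>\<mu>\<bar> + \<bar>\<sigma>\<bar>) * (1 + x\<^sup>2) \<le> A * (1 + x\<^sup>2)"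
      unfolding A_def using A0 by (intro mult_right_mono) auto
    with that show ?thesis by simp
  qed
  have b1: "\<bar>f x\<bar> \<le> A * (1 + x\<^sup>2)" for x
  proof (rule lift, rule order_trans[OF fy])
    have "\<bar>\<sigma>\<bar> * \<bar>x\<bar> \<le> \<bar>\<sigma>\<bar> * (1 + x\<^sup>2)" using xsq by (intro mult_left_mono) auto
    moreover have "0 \<le> \<bar>\<mu>\<bar> * x\<^sup>2" by simp
    ultimately show "\<bar>\<mu>\<bar> + \<bar>\<sigma>\<bar> * \<bar>x\<bar> \<le> (\<bar>\<mu>\<bar> + \<bar>\<sigma>\<bar>) * (1 + x\<^sup>2)" by (simp only: algebra_simps mult_1_right mult_1_left; linarith)
  qed
  have b2: "\<bar>x * f x\<bar> \<le> A * (1 + x\<^sup>2)" for x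
  proof (rule lift)
    have "\<bar>x * f x\<bar> \<le> \<bar>x\<bar> * (\<bar>\<mu>\<bar> + \<bar>\<sigma>\<bar> * \<bar>x\<bar>)" unfolding abs_mult using fy by (intro mult_left_mono) auto
    also have "\<dots> = \<bar>\<mu>\<bar> * \<bar>x\<bar> + \<bar>\<sigma>\<bar> * x\<^sup>2"
      using abs_mult_self_eq[of x] by (simp add: power2_eq_square algebra_simps)
    also have "\<dots> \<le> \<bar>\<mu>\<bar> * (1 + x\<^sup>2) + \<bar>\<sigma>\<bar> * (1 + x\<^sup>2)"
      using xsq by (intro add_mono mult_left_mono) auto
    finally show "\<bar>x * f x\<bar> \<le> (\<bar>\<mu>\<bar> + \<bar>\<sigma>\<bar>) * (1 + x\<^sup>2)" by (simp add: algebra_simps)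
  qed
  have b3: "\<bar>f' x\<bar> \<le> A * (1 + x\<^sup>2)" for x
  proof -
    have "\<bar>\<sigma> * (1 - W x)\<bar> \<le> \<bar>\<sigma>\<bar> * 1" unfolding abs_mult using W01[of x] by (intro mult_left_mono) auto
    moreover have "\<bar>2 * s * \<sigma> * (y x)\<^sup>2 * Cv x\<bar> \<le> 2 * s * \<bar>\<sigma>\<bar> * (y x)\<^sup>2 * 1"
      unfolding abs_mult using Cv1 s by (intro mult_mono) auto
    moreover have "2 * s * \<bar>\<sigma>\<bar> * (y x)\<^sup>2 \<le> 2 * s * \<bar>\<sigma>\<bar> * ((2 * \<mu>\<^sup>2 + 2 * \<sigma>\<^sup>2) * (1 + x\<^sup>2))"
      using s y_sq by (intro mult_left_mono) auto
    moreover have "\<bar>f' x\<bar> \<le> \<bar>\<sigma> * (1 - W x)\<bar> + \<bar>2 * s * \<sigma> * (y x)\<^sup>2 * Cv x\<bar>"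
      unfolding f'_def by (rule abs_triangle_ineq4)
    moreover have "0 \<le> \<bar>\<mu>\<bar> * (1 + x\<^sup>2)" "0 \<le> \<bar>\<sigma>\<bar> * x\<^sup>2" by simp_all
    moreover have "A * (1 + x\<^sup>2) = \<bar>\<mu>\<bar> * (1 + x\<^sup>2) + \<bar>\<sigma>\<bar> + \<bar>\<sigma>\<bar> * x\<^sup>2 +
        2 * s * \<bar>\<sigma>\<bar> * ((2 * \<mu>\<^sup>2 + 2 * \<sigma>\<^sup>2) * (1 + x\<^sup>2))"
      unfolding A_def by (simp add: algebra_simps)
    ultimately show ?thesis by linarith
  qed
  have stein: "(\<integral>x. x * f x \<partial>gauss) = (\<integral>x. f' x \<partial>gauss)"
    by (rule gauss_integration_by_parts[OF df cf' b1 b2 b3])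
  have if': "integrable gauss f'" using meas[OF cf'] b3 by (rule integrable_gauss_quadratic_growth)
  have ixf: "integrable gauss (\<lambda>x. x * f x)"
    using b2 by (intro integrable_gauss_quadratic_growth meas continuous_intros cf) auto
  have if2: "integrable gauss (\<lambda>x. (f x)\<^sup>2)"
  proof (rule integrable_gauss_quadratic_growth)
    show "(\<lambda>x. (f x)\<^sup>2) \<in> borel_measurable borel" by (intro meas continuous_intros cf)
    fix x
    have "(y x)\<^sup>2 * (1 - W x)\<^sup>2 \<le> (y x)\<^sup>2 * 1"
      using W01[of x] by (intro mult_left_mono) (auto simp: abs_square_le_1)
    then show "\<bar>(f x)\<^sup>2\<bar> \<le> (2 * \<mu>\<^sup>2 + 2 * \<sigma>\<^sup>2) * (1 + x\<^sup>2)"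
      using y_sq[of x] by (simp add: f_def power_mult_distrib)
  qed
  have ix2: "integrable gauss (\<lambda>x. x\<^sup>2)" "(\<integral>x. x\<^sup>2 \<partial>gauss) = 1"
    using integral_std_normal_moment_even[of 1] by (simp_all add: gauss_integral(2))
  have irhs: "integrable gauss (\<lambda>x. \<Sum>h\<in>H. w x h * ((1 - a h)\<^sup>2 * (y x)\<^sup>2 + 2 * \<sigma>\<^sup>2 * a h - \<sigma>\<^sup>2))"
  proof (rule integrable_gauss_quadratic_growth)
    show "(\<lambda>x. \<Sum>h\<in>H. w x h * ((1 - a h)\<^sup>2 * (y x)\<^sup>2 + 2 * \<sigma>\<^sup>2 * a h - \<sigma>\<^sup>2)) \<in> borel_measurable borel"
      by (intro meas continuous_intros cw cy)
    fix x
    have "0 \<le> (y x)\<^sup>2 * B x" "(y x)\<^sup>2 * B x \<le> (y x)\<^sup>2 * 1"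
      using B01[of x] by (auto intro!: mult_left_mono simp del: mult_1_right)
    moreover have "0 \<le> \<sigma>\<^sup>2 * W x" "\<sigma>\<^sup>2 * W x \<le> \<sigma>\<^sup>2 * 1"
      using W01[of x] by (auto intro!: mult_left_mono simp del: mult_1_right)
    moreover have "0 \<le> 2 * \<sigma>\<^sup>2 * x\<^sup>2" "0 \<le> \<sigma>\<^sup>2" by simp_all
    ultimately show "\<bar>\<Sum>h\<in>H. w x h * ((1 - a h)\<^sup>2 * (y x)\<^sup>2 + 2 * \<sigma>\<^sup>2 * a h - \<sigma>\<^sup>2)\<bar> \<le>
        (2 * \<mu>\<^sup>2 + 4 * \<sigma>\<^sup>2) * (1 + x\<^sup>2)"
      using y_sq[of x] unfolding rhs_eq distrib_left distrib_right by (simp only: abs_le_iff mult_1_right; linarith)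
  qed
  \<comment> \<open>\<open>W x * y x - \<mu> = \<sigma> * x - f x\<close>, and Stein's identity applies to the cross term \<open>x * f x\<close>\<close>
  have lhs_eq: "(\<lambda>x. (W x * y x - \<mu>)\<^sup>2) = (\<lambda>x. (f x)\<^sup>2 - 2 * \<sigma> * (x * f x) + \<sigma>\<^sup>2 * x\<^sup>2)"
    by (intro ext) (simp add: f_def y_def power2_eq_square algebra_simps)
  have ilhs: "integrable gauss (\<lambda>x. (W x * y x - \<mu>)\<^sup>2)" unfolding lhs_eq using if2 ixf ix2 by simp
  have "(\<integral>x. (W x * y x - \<mu>)\<^sup>2 \<partial>gauss) = (\<integral>x. (f x)\<^sup>2 - 2 * \<sigma> * (x * f x) + \<sigma>\<^sup>2 * x\<^sup>2 \<partial>gauss)"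
    unfolding lhs_eq ..
  also have "\<dots> = (\<integral>x. (f x)\<^sup>2 - 2 * \<sigma> * f' x + \<sigma>\<^sup>2 \<partial>gauss)"
    using if2 ixf if' ix2 stein prob_space by simp
  also have "\<dots> \<le> (\<integral>x. (\<Sum>h\<in>H. w x h * ((1 - a h)\<^sup>2 * (y x)\<^sup>2 + 2 * \<sigma>\<^sup>2 * a h - \<sigma>\<^sup>2)) \<partial>gauss)"
  proof (rule integral_mono)
    show "integrable gauss (\<lambda>x. (f x)\<^sup>2 - 2 * \<sigma> * f' x + \<sigma>\<^sup>2)" using if2 if' by simp
    fix x
    let ?m2 = "\<Sum>h\<in>H. w x h * (a h)\<^sup>2" and ?m3 = "\<Sum>h\<in>H. w x h * (a h) ^ 3"
    have Be: "B x = 1 - 2 * W x + ?m2"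
    proof -
      have "B x = (\<Sum>h\<in>H. w x h) - 2 * W x + ?m2"
        unfolding B_def W_def sum_distrib_left sum.distrib[symmetric] sum_subtractf[symmetric]
        by (intro sum.cong refl) (simp add: power2_eq_square algebra_simps)
      then show ?thesis using w1 by simp
    qed
    have "Cv x = B x * (\<Sum>h\<in>H. w x h * a h) - (\<Sum>h\<in>H. w x h * a h) + 2 * ?m2 - ?m3"
      unfolding Cv_def sum_distrib_left sum.distrib[symmetric] sum_subtractf[symmetric]
      by (intro sum.cong refl) (simp add: power2_eq_square power3_eq_cube algebra_simps)
    moreover have "W x * ?m2 \<le> ?m3"
      unfolding W_def using w0 w1 a by (intro weighted_cov_square_nonneg) auto
    ultimately have "Cv x \<le> 2 * V x"
      unfolding V_def Be W_def[symmetric] by (simp add: power2_eq_square algebra_simps)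
    moreover have V: "V x = B x - (1 - W x)\<^sup>2" unfolding V_def Be by (simp add: power2_eq_square algebra_simps)
    moreover have V0: "0 \<le> V x"
    proof -
      have "0 \<le> (\<Sum>h\<in>H. w x h * (a h - W x)\<^sup>2)" using w0 by (intro sum_nonneg) auto
      also have "\<dots> = ?m2 - 2 * W x * (\<Sum>h\<in>H. w x h * a h) + (W x)\<^sup>2 * (\<Sum>h\<in>H. w x h)"
        unfolding sum_distrib_left sum.distrib[symmetric] sum_subtractf[symmetric]
        by (intro sum.cong refl) (simp add: power2_eq_square algebra_simps)
      finally show ?thesis unfolding V_def W_def[symmetric] using w1[of x] by (simp add: power2_eq_square)
    qed
    ultimately have "4 * s * \<sigma>\<^sup>2 * (y x)\<^sup>2 * Cv x \<le> 4 * s * \<sigma>\<^sup>2 * (y x)\<^sup>2 * (2 * V x)"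
      using s by (intro mult_left_mono) auto
    also have "\<dots> = (8 * \<sigma>\<^sup>2 * s) * ((y x)\<^sup>2 * V x)" by simp
    also have "\<dots> \<le> 1 * ((y x)\<^sup>2 * V x)" using s V0 by (intro mult_right_mono) auto
    finally have *: "4 * s * \<sigma>\<^sup>2 * (y x)\<^sup>2 * Cv x \<le> (y x)\<^sup>2 * (B x - (1 - W x)\<^sup>2)" unfolding V by simp
    have "(f x)\<^sup>2 - 2 * \<sigma> * f' x + \<sigma>\<^sup>2 =
        (y x)\<^sup>2 * (1 - W x)\<^sup>2 + 2 * \<sigma>\<^sup>2 * W x - \<sigma>\<^sup>2 + 4 * s * \<sigma>\<^sup>2 * (y x)\<^sup>2 * Cv x"
      by (simp add: f_def f'_def power2_eq_square algebra_simps)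
    also have "\<dots> \<le> (y x)\<^sup>2 * B x + 2 * \<sigma>\<^sup>2 * W x - \<sigma>\<^sup>2"
      using * by (simp add: algebra_simps)
    also have "\<dots> = (\<Sum>h\<in>H. w x h * ((1 - a h)\<^sup>2 * (y x)\<^sup>2 + 2 * \<sigma>\<^sup>2 * a h - \<sigma>\<^sup>2))"
      by (rule rhs_eq[symmetric])
    finally show "(f x)\<^sup>2 - 2 * \<sigma> * f' x + \<sigma>\<^sup>2 \<le>
        (\<Sum>h\<in>H. w x h * ((1 - a h)\<^sup>2 * (y x)\<^sup>2 + 2 * \<sigma>\<^sup>2 * a h - \<sigma>\<^sup>2))" .
  qed (rule irhs)
  finally show ?thesis
    unfolding W_def[symmetric] Bochner_Integration.integral_diff[OF irhs ilhs] by simp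
qed

section \<open>The risk of the aggregate\<close>

lemma observation_apply: "i \<in> {1..n} \<Longrightarrow> observation n \<sigma> \<mu> \<xi> i = \<mu> i + \<sigma> * \<xi> i"
  by (simp add: observation_def)

lemma risk_estimate_eq_sum:
  "risk_estimate n \<sigma> Y h = (\<Sum>i=1..n. (1 - h i)\<^sup>2 * (Y i)\<^sup>2 + 2 * \<sigma>\<^sup>2 * h i - \<sigma>\<^sup>2)"
proof -
  have "sqnorm n (\<lambda>i\<in>{1..n}. Y i - linear_est n h Y i) = (\<Sum>i=1..n. (1 - h i)\<^sup>2 * (Y i)\<^sup>2)"
    unfolding sqnorm_def linear_est_def
    by (intro sum.cong refl) (simp add: power_mult_distrib[symmetric] algebra_simps)
  then show ?thesis
    unfolding risk_estimate_def by (simp add: sum.distrib sum_subtractf sum_distrib_left)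
qed

locale smoothing_model =
  fixes n :: nat and \<beta> \<sigma> :: real and H :: "(nat \<Rightarrow> real) set" and \<mu> :: "nat \<Rightarrow> real"
  assumes ordered: "ordered_multipliers n H" and beta: "4 \<le> \<beta>" and sigma: "0 < \<sigma>"
begin

abbreviation "obs \<equiv> observation n \<sigma> \<mu>"
abbreviation "urisk \<xi> h \<equiv> risk_estimate n \<sigma> (obs \<xi>) h"
abbreviation "wt \<xi> h \<equiv> weight n \<beta> \<sigma> H h (obs \<xi>)"
abbreviation "pr \<equiv> prior n \<beta> H"

sublocale prob_space "noise n" by (rule prob_space_noise)

lemma finite_H: "finite H" and nonempty_H: "H \<noteq> {}"
  using ordered unfolding ordered_multipliers_def by auto

lemma multiplier_bounds: "h \<in> H \<Longrightarrow> i \<in> {1..n} \<Longrightarrow> 0 \<le> h i \<and> h i \<le> 1"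
  using ordered unfolding ordered_multipliers_def by auto

lemma pr_nonneg: "h \<in> H \<Longrightarrow> 0 \<le> pr h"
  using prior_nonneg[OF ordered] beta by simp

lemma pr_hmax: "pr (hmax H) = 1" by (simp add: prior_def)

lemma wt_bounds: "h \<in> H \<Longrightarrow> 0 \<le> wt \<xi> h \<and> wt \<xi> h \<le> 1"
  using weight_bounds[OF ordered] beta by simp

lemma measurable_component [measurable]:
  "i \<in> {1..n} \<Longrightarrow> (\<lambda>\<xi>. \<xi> i) \<in> borel_measurable (noise n)"
  by (intro borel_measurable_integrable noise_moments(1))

lemma measurable_obs: "i \<in> {1..n} \<Longrightarrow> (\<lambda>\<xi>. obs \<xi> i) \<in> borel_measurable (noise n)"
  by (simp add: observation_apply)

lemma measurable_urisk [measurable]: "(\<lambda>\<xi>. urisk \<xi> h) \<in> borel_measurable (noise n)"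
  unfolding risk_estimate_eq_sum using measurable_obs by measurable

lemma measurable_wt [measurable]: "(\<lambda>\<xi>. wt \<xi> h) \<in> borel_measurable (noise n)"
  unfolding weight_def by measurable

lemma integrable_urisk_term:
  assumes "i \<in> {1..n}"
  shows "integrable (noise n) (\<lambda>\<xi>. (1 - h i)\<^sup>2 * (obs \<xi> i)\<^sup>2 + 2 * \<sigma>\<^sup>2 * h i - \<sigma>\<^sup>2)"
  using integrable_affine_sq(1)[OF assms] by (simp add: observation_apply[OF assms])

lemma integrable_wt_mult:
  assumes "h \<in> H" "integrable (noise n) f"
  shows "integrable (noise n) (\<lambda>\<xi>. wt \<xi> h * f \<xi>)"
proof (rule Bochner_Integration.integrable_bound[OF assms(2)])
  show "(\<lambda>\<xi>. wt \<xi> h * f \<xi>) \<in> borel_measurable (noise n)"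
    using assms(2) by measurable
  show "AE \<xi> in noise n. norm (wt \<xi> h * f \<xi>) \<le> norm (f \<xi>)"
    using wt_bounds[OF assms(1)] by (intro AE_I2) (auto simp: abs_mult intro!: mult_left_le_one_le)
qed

lemma integrable_urisk: "integrable (noise n) (\<lambda>\<xi>. urisk \<xi> h)"
  unfolding risk_estimate_eq_sum by (intro Bochner_Integration.integrable_sum integrable_urisk_term)

lemma expectation_urisk:
  "(\<integral>\<xi>. urisk \<xi> h \<partial>noise n) = (\<Sum>i=1..n. (1 - h i)\<^sup>2 * (\<mu> i)\<^sup>2) + \<sigma>\<^sup>2 * sqnorm n h"
proof -
  have "(\<integral>\<xi>. urisk \<xi> h \<partial>noise n) =
      (\<Sum>i=1..n. \<integral>\<xi>. (1 - h i)\<^sup>2 * (obs \<xi> i)\<^sup>2 + 2 * \<sigma>\<^sup>2 * h i - \<sigma>\<^sup>2 \<partial>noise n)"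
    unfolding risk_estimate_eq_sum by (intro Bochner_Integration.integral_sum integrable_urisk_term)
  also have "\<dots> = (\<Sum>i=1..n. (1 - h i)\<^sup>2 * (\<mu> i)\<^sup>2 + \<sigma>\<^sup>2 * (h i)\<^sup>2)"
  proof (intro sum.cong refl)
    fix i assume i: "i \<in> {1..n}"
    have "(\<integral>\<xi>. (1 - h i)\<^sup>2 * (\<mu> i + \<sigma> * \<xi> i)\<^sup>2 + 2 * \<sigma>\<^sup>2 * h i - \<sigma>\<^sup>2 \<partial>noise n) =
        (1 - h i)\<^sup>2 * ((\<mu> i)\<^sup>2 + \<sigma>\<^sup>2) + 2 * \<sigma>\<^sup>2 * h i - \<sigma>\<^sup>2"
      using integrable_affine_sq[OF i, of "\<mu> i" \<sigma>] prob_space by simp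
    then show "(\<integral>\<xi>. (1 - h i)\<^sup>2 * (obs \<xi> i)\<^sup>2 + 2 * \<sigma>\<^sup>2 * h i - \<sigma>\<^sup>2 \<partial>noise n) =
        (1 - h i)\<^sup>2 * (\<mu> i)\<^sup>2 + \<sigma>\<^sup>2 * (h i)\<^sup>2"
      by (simp add: observation_apply[OF i] power2_eq_square algebra_simps)
  qed
  finally show ?thesis by (simp add: sum.distrib sqnorm_def sum_distrib_left)
qed

text \<open>
  Freezing all coordinates but the \<open>i\<close>-th, the weights take the form of the one-dimensional bound:
  the contribution of the frozen coordinates to the risk estimates is absorbed in \<open>c h\<close>.
\<close>

lemma coordinate_risk_bound:
  assumes i: "i \<in> {1..n}"
  defines "L \<equiv> \<lambda>\<xi>. (exp_weighting n \<beta> \<sigma> H (obs \<xi>) i - \<mu> i)\<^sup>2"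
    and "R \<equiv> \<lambda>\<xi>. \<Sum>h\<in>H. wt \<xi> h * ((1 - h i)\<^sup>2 * (obs \<xi> i)\<^sup>2 + 2 * \<sigma>\<^sup>2 * h i - \<sigma>\<^sup>2)"
  shows "0 \<le> (\<integral>\<xi>. R \<xi> - L \<xi> \<partial>noise n)"
proof (cases "integrable (noise n) (\<lambda>\<xi>. R \<xi> - L \<xi>)")
  case True
  interpret PS: product_sigma_finite "\<lambda>_::nat. gauss"
    by (intro product_sigma_finite.intro prob_space_imp_sigma_finite prob_space_std_normal)
  define I where "I = {1..n} - {i}"
  have I: "finite I" "i \<notin> I" "{1..n} = insert i I" using i by (auto simp: I_def)
  define s where "s = 1 / (2 * \<beta> * \<sigma>\<^sup>2)"
  have s: "0 \<le> s" "8 * \<sigma>\<^sup>2 * s \<le> 1"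
    using beta sigma by (auto simp: s_def field_simps)
  have inner: "0 \<le> (\<integral>x. R (\<xi>(i := x)) - L (\<xi>(i := x)) \<partial>gauss)" for \<xi>
  proof -
    define rest where "rest h = (\<Sum>j\<in>I. (1 - h j)\<^sup>2 * (obs \<xi> j)\<^sup>2 + 2 * \<sigma>\<^sup>2 * h j - \<sigma>\<^sup>2) +
        2 * \<sigma>\<^sup>2 * h i - \<sigma>\<^sup>2" for h :: "nat \<Rightarrow> real"
    define c where "c h = pr h * exp (- s * rest h)" for h
    define y where "y x = \<mu> i + \<sigma> * x" for x
    define p where "p x h = c h * exp (- (s * (1 - h i)\<^sup>2 * (y x)\<^sup>2))" for x and h :: "nat \<Rightarrow> real"
    have yi: "obs (\<xi>(i := x)) i = y x" for x
      using i by (simp add: observation_apply y_def)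
    have yj: "obs (\<xi>(i := x)) j = obs \<xi> j" if "j \<in> I" for x j
      using that by (auto simp: I_def observation_apply)
    have r: "urisk (\<xi>(i := x)) h = (1 - h i)\<^sup>2 * (y x)\<^sup>2 + rest h" for x h
      unfolding risk_estimate_eq_sum I(3) rest_def using I(1,2) yi yj by simp
    have e: "pr h * exp (- urisk (\<xi>(i := x)) h / (2 * \<beta> * \<sigma>\<^sup>2)) = p x h" for x h
    proof -
      have "- urisk (\<xi>(i := x)) h / (2 * \<beta> * \<sigma>\<^sup>2) = - s * rest h + - (s * (1 - h i)\<^sup>2 * (y x)\<^sup>2)"
      proof -
        have "- urisk (\<xi>(i := x)) h / (2 * \<beta> * \<sigma>\<^sup>2) = - s * urisk (\<xi>(i := x)) h"
          by (simp add: s_def)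
        then show ?thesis unfolding r by (simp add: algebra_simps)
      qed
      then show ?thesis by (simp only: p_def c_def exp_add mult.assoc)
    qed
    have w: "wt (\<xi>(i := x)) h = p x h / (\<Sum>g\<in>H. p x g)" for x h
      unfolding weight_def e ..
    have ew: "exp_weighting n \<beta> \<sigma> H (obs (\<xi>(i := x))) i =
        (\<Sum>h\<in>H. p x h / (\<Sum>g\<in>H. p x g) * h i) * y x" for x
      unfolding exp_weighting_def linear_est_def w using i
      by (simp add: yi sum_distrib_right mult.assoc)
    have c0: "0 \<le> c h" if "h \<in> H" for h using pr_nonneg[OF that] by (simp add: c_def)
    have c1: "\<exists>h\<in>H. 0 < c h"
      using hmax(1)[OF ordered] by (intro bexI[of _ "hmax H"]) (simp_all add: c_def pr_hmax)
    have b: "0 \<le> h i \<and> h i \<le> 1" if "h \<in> H" for h using multiplier_bounds[OF that i] .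
    show ?thesis
      unfolding R_def L_def w ew yi
      using gauss_unbiased_risk_bound[OF finite_H b c0 c1 s, where \<mu> = "\<mu> i"]
      unfolding p_def y_def .
  qed
  have "(\<integral>\<xi>. R \<xi> - L \<xi> \<partial>noise n) =
      (\<integral>\<xi>. (\<integral>x. R (\<xi>(i := x)) - L (\<xi>(i := x)) \<partial>gauss) \<partial>Pi\<^sub>M I (\<lambda>_. gauss))"
    unfolding noise_def I(3)
    using True unfolding noise_def I(3) by (intro PS.product_integral_insert I(1,2))
  also have "\<dots> \<ge> 0" by (intro Bochner_Integration.integral_nonneg inner)
  finally show ?thesis .
qed (simp add: not_integrable_integral_eq)

lemma risk_le_average_unbiased_risk:
  "expect n \<sigma> \<mu> (\<lambda>Y. loss n (exp_weighting n \<beta> \<sigma> H Y) \<mu>)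
    \<le> (\<integral>\<xi>. (\<Sum>h\<in>H. wt \<xi> h * urisk \<xi> h) \<partial>noise n)"
proof -
  let ?L = "\<lambda>i \<xi>. (exp_weighting n \<beta> \<sigma> H (obs \<xi>) i - \<mu> i)\<^sup>2"
  let ?R = "\<lambda>i \<xi>. \<Sum>h\<in>H. wt \<xi> h * ((1 - h i)\<^sup>2 * (obs \<xi> i)\<^sup>2 + 2 * \<sigma>\<^sup>2 * h i - \<sigma>\<^sup>2)"
  have loss: "loss n (exp_weighting n \<beta> \<sigma> H (obs \<xi>)) \<mu> = (\<Sum>i=1..n. ?L i \<xi>)" for \<xi>
    unfolding loss_def sqnorm_def by (intro sum.cong) auto
  have iR: "integrable (noise n) (?R i)" if "i \<in> {1..n}" for i
    using that by (intro Bochner_Integration.integrable_sum integrable_wt_mult integrable_urisk_term)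
  have iL: "integrable (noise n) (?L i)" if i: "i \<in> {1..n}" for i
  proof (rule Bochner_Integration.integrable_bound)
    show "integrable (noise n) (\<lambda>\<xi>. loss n (exp_weighting n \<beta> \<sigma> H (obs \<xi>)) \<mu>)"
      using integrable_loss_exp_weighting[OF ordered] beta by simp
    have "(\<lambda>\<xi>. exp_weighting n \<beta> \<sigma> H (obs \<xi>) i) \<in> borel_measurable (noise n)"
      unfolding exp_weighting_def linear_est_def using i measurable_obs[OF i] by simp
    then show "?L i \<in> borel_measurable (noise n)" by measurable
    show "AE \<xi> in noise n. norm (?L i \<xi>) \<le> norm (loss n (exp_weighting n \<beta> \<sigma> H (obs \<xi>)) \<mu>)"
    proof (rule AE_I2)
      fix \<xi>
      have "?L i \<xi> \<le> (\<Sum>i=1..n. ?L i \<xi>)" using i by (intro member_le_sum) auto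
      then show "norm (?L i \<xi>) \<le> norm (loss n (exp_weighting n \<beta> \<sigma> H (obs \<xi>)) \<mu>)"
        unfolding loss by simp
    qed
  qed
  have "expect n \<sigma> \<mu> (\<lambda>Y. loss n (exp_weighting n \<beta> \<sigma> H Y) \<mu>) = (\<Sum>i=1..n. \<integral>\<xi>. ?L i \<xi> \<partial>noise n)"
    unfolding expect_def loss by (intro Bochner_Integration.integral_sum iL)
  also have "\<dots> \<le> (\<Sum>i=1..n. \<integral>\<xi>. ?R i \<xi> \<partial>noise n)"
  proof (rule sum_mono)
    fix i assume i: "i \<in> {1..n}"
    show "(\<integral>\<xi>. ?L i \<xi> \<partial>noise n) \<le> (\<integral>\<xi>. ?R i \<xi> \<partial>noise n)"
      using coordinate_risk_bound[OF i]
      unfolding Bochner_Integration.integral_diff[OF iR[OF i] iL[OF i]] by simp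
  qed
  also have "\<dots> = (\<integral>\<xi>. (\<Sum>i=1..n. ?R i \<xi>) \<partial>noise n)"
    by (intro Bochner_Integration.integral_sum[symmetric] iR)
  also have "\<dots> = (\<integral>\<xi>. (\<Sum>h\<in>H. wt \<xi> h * urisk \<xi> h) \<partial>noise n)"
    unfolding risk_estimate_eq_sum sum_distrib_left by (subst sum.swap) (rule refl)
  finally show ?thesis .
qed

end

section \<open>Prior mass\<close>

text \<open>
  Both sides are compared with \<open>(1 + k) * t / (1 + t)\<close>, using that \<open>1 - exp (- k * t)\<close> is at most
  \<open>k * t\<close> and at most \<open>1\<close>.
\<close>

lemma one_minus_exp_scale_le:
  fixes k t :: real
  assumes "0 \<le> k" "0 \<le> t"
  shows "1 - exp (- (k * t)) \<le> (1 + k) * (1 - exp (- t))"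
proof -
  have "exp (- t) \<le> 1 / (1 + t)"
    using exp_ge_add_one_self[of t] assms(2) by (simp add: exp_minus field_simps)
  then have "(1 + k) * (t / (1 + t)) \<le> (1 + k) * (1 - exp (- t))"
    using assms by (intro mult_left_mono) (simp_all add: field_simps)
  moreover have "1 - exp (- (k * t)) \<le> (1 + k) * (t / (1 + t))"
  proof (cases "k * t \<le> 1")
    case True
    have "1 - exp (- (k * t)) \<le> k * t" using exp_ge_add_one_self[of "- (k * t)"] by simp
    moreover have "k * t * t \<le> 1 * t" using True assms by (intro mult_right_mono) auto
    then have "k * t \<le> (1 + k) * (t / (1 + t))" using assms by (simp add: field_simps)
    ultimately show ?thesis by linarith
  next
    case False
    then have "1 \<le> (1 + k) * (t / (1 + t))" using assms by (simp add: field_simps)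
    then show ?thesis using exp_gt_zero[of "- (k * t)"] by linarith
  qed
  ultimately show ?thesis by linarith
qed

context smoothing_model
begin

lemma le_total: "h \<in> H \<Longrightarrow> g \<in> H \<Longrightarrow> h \<le> g \<or> g \<le> h"
  by (rule ordered_multipliers_total[OF ordered])

lemma l1norm_eq_sum: "h \<in> H \<Longrightarrow> l1norm n h = (\<Sum>i=1..n. h i)"
  unfolding l1norm_def using multiplier_bounds by (intro sum.cong) auto

lemma l1norm_mono:
  assumes "h \<in> H" "g \<in> H" "h \<le> g"
  shows "l1norm n h \<le> l1norm n g"
  unfolding l1norm_eq_sum[OF assms(1)] l1norm_eq_sum[OF assms(2)]
  using assms(3) by (intro sum_mono) (auto simp: le_fun_def)

text \<open>
  The part of the family above \<open>h\<close> is the chain \<open>h\<close>, its successor, and so on up to the maximum,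
  so the increments of \<open>F\<close> along the chain telescope.
\<close>

lemma chain_telescope:
  fixes F :: "(nat \<Rightarrow> real) \<Rightarrow> real"
  assumes "h \<in> H"
  shows "(\<Sum>g\<in>{g\<in>H. h \<le> g}. if g = hmax H then F g else F g - F (hsucc H g)) = F h"
  using assms
proof (induction "card {g\<in>H. h \<le> g}" arbitrary: h rule: less_induct)
  case less
  show ?case
  proof (cases "h = hmax H")
    case True
    then have "{g\<in>H. h \<le> g} = {hmax H}"
      using hmax[OF ordered] by (auto intro: antisym)
    then show ?thesis using True by simp
  next
    case False
    note s = hsucc[OF ordered less.prems False]
    have split: "{g\<in>H. h \<le> g} = insert h {g\<in>H. hsucc H h \<le> g}"
    proof (intro equalityI subsetI)
      fix g assume "g \<in> {g\<in>H. h \<le> g}"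
      then show "g \<in> insert h {g\<in>H. hsucc H h \<le> g}"
        using s(3)[of g] by (auto simp: order.order_iff_strict)
    next
      fix g assume "g \<in> insert h {g\<in>H. hsucc H h \<le> g}"
      then show "g \<in> {g\<in>H. h \<le> g}"
        using less.prems s(2) by auto
    qed
    have new: "h \<notin> {g\<in>H. hsucc H h \<le> g}" using s(2) by auto
    have fin: "finite {g\<in>H. hsucc H h \<le> g}" using finite_H by simp
    have "card {g\<in>H. hsucc H h \<le> g} < card {g\<in>H. h \<le> g}"
      unfolding split using new fin by simp
    from less.hyps[OF this s(1)] show ?thesis
      unfolding split using new fin False by simp
  qed
qed

lemma prior_mult_exp:
  assumes "g \<in> H"
  shows "pr g * exp (- (l1norm n g - c) / \<beta>) =
    (if g = hmax H then exp (- (l1norm n g - c) / \<beta>)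
     else exp (- (l1norm n g - c) / \<beta>) - exp (- (l1norm n (hsucc H g) - c) / \<beta>))"
proof (cases "g = hmax H")
  case False
  have "exp (- (l1norm n (hsucc H g) - l1norm n g) / \<beta>) * exp (- (l1norm n g - c) / \<beta>) =
      exp (- (l1norm n (hsucc H g) - c) / \<beta>)"
    unfolding exp_add[symmetric] add_divide_distrib[symmetric] by simp
  then show ?thesis using False by (simp add: prior_def left_diff_distrib)
qed (simp add: pr_hmax)

text \<open>
  This is what the prior weights are made for: \<open>\<pi> g * exp (- l1norm g / \<beta>)\<close> is exactly the decrement of
  \<open>exp (- l1norm / \<beta>)\<close> from \<open>g\<close> to its successor.
\<close>

lemma prior_exp_telescope:
  assumes "h \<in> H"
  shows "(\<Sum>g\<in>{g\<in>H. h \<le> g}. pr g * exp (- (l1norm n g - l1norm n h) / \<beta>)) = 1"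
proof -
  let ?F = "\<lambda>g. exp (- (l1norm n g - l1norm n h) / \<beta>)"
  have "(\<Sum>g\<in>{g\<in>H. h \<le> g}. pr g * ?F g) =
      (\<Sum>g\<in>{g\<in>H. h \<le> g}. if g = hmax H then ?F g else ?F g - ?F (hsucc H g))"
    by (intro sum.cong refl prior_mult_exp) simp
  also have "\<dots> = 1" unfolding chain_telescope[OF assms, where F = ?F] by simp
  finally show ?thesis .
qed

text \<open>
  With a discount rate \<open>a\<close> other than \<open>1 / \<beta>\<close> the sum no longer telescopes exactly, but each term
  is at most \<open>1 + 1 / (a * \<beta>)\<close> times the decrement of \<open>exp (- a * l1norm)\<close>.
\<close>

lemma prior_discounted_mass:
  assumes "h \<in> H" "0 < a"
  shows "(\<Sum>g\<in>{g\<in>H. h \<le> g}. pr g * exp (- a * (l1norm n g - l1norm n h))) \<le> 1 + 1 / (a * \<beta>)"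
proof -
  let ?F = "\<lambda>g. exp (- a * (l1norm n g - l1norm n h))"
  let ?k = "1 / (a * \<beta>)"
  have k: "0 \<le> ?k" using assms beta by simp
  have "(\<Sum>g\<in>{g\<in>H. h \<le> g}. pr g * ?F g) \<le>
      (\<Sum>g\<in>{g\<in>H. h \<le> g}. (1 + ?k) * (if g = hmax H then ?F g else ?F g - ?F (hsucc H g)))"
  proof (rule sum_mono)
    fix g assume g: "g \<in> {g\<in>H. h \<le> g}"
    show "pr g * ?F g \<le> (1 + ?k) * (if g = hmax H then ?F g else ?F g - ?F (hsucc H g))"
    proof (cases "g = hmax H")
      case True
      have "1 * ?F g \<le> (1 + ?k) * ?F g" using k by (intro mult_right_mono) auto
      then show ?thesis using True by (simp add: pr_hmax)
    next
      case False
      let ?D = "l1norm n (hsucc H g) - l1norm n g"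
      note s = hsucc[OF ordered _ False]
      have D: "0 \<le> ?D" using l1norm_mono[of g "hsucc H g"] g s by auto
      have "?k * (a * ?D) = ?D / \<beta>" using assms(2) by simp
      moreover have "1 - exp (- (?k * (a * ?D))) \<le> (1 + ?k) * (1 - exp (- (a * ?D)))"
        using D assms(2) by (intro one_minus_exp_scale_le k) auto
      moreover have "pr g = 1 - exp (- (?D / \<beta>))"
        using False by (simp only: prior_def if_False minus_divide_left)
      ultimately have "pr g \<le> (1 + ?k) * (1 - exp (- (a * ?D)))" by (simp only:)
      then have "pr g * ?F g \<le> (1 + ?k) * (1 - exp (- (a * ?D))) * ?F g"
        by (intro mult_right_mono) auto
      also have "\<dots> = (1 + ?k) * (?F g - exp (- (a * ?D)) * ?F g)"
        by (simp add: algebra_simps)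
      also have "exp (- (a * ?D)) * ?F g = ?F (hsucc H g)"
        unfolding exp_add[symmetric] by (simp add: algebra_simps)
      finally show ?thesis using False by simp
    qed
  qed
  also have "\<dots> = 1 + ?k"
    unfolding sum_distrib_left[symmetric] chain_telescope[OF assms(1), where F = ?F] by simp
  finally show ?thesis .
qed

text \<open>
  Discounting at the rate \<open>1 / w\<close> costs at most a factor \<open>exp 1\<close> on an interval of length \<open>w\<close>.
\<close>

lemma prior_mass_l1_interval:
  assumes "0 < w" "\<And>h. h \<in> A \<Longrightarrow> h \<in> H \<and> c \<le> l1norm n h \<and> l1norm n h \<le> c + w"
  shows "(\<Sum>h\<in>A. pr h) \<le> exp 1 * (1 + w / \<beta>)"
proof (cases "A = {}")
  case True
  then show ?thesis using assms(1) beta by simp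
next
  case False
  have A: "A \<subseteq> H" using assms(2) by blast
  have "finite A" using A finite_H by (rule finite_subset)
  then obtain h where h: "h \<in> A" "\<And>g. g \<in> A \<Longrightarrow> h \<le> g"
    using finite_chain_least[of A] False le_total A by (metis subsetD)
  have hH: "h \<in> H" using h A by blast
  have sub: "A \<subseteq> {g\<in>H. h \<le> g}" using h A by blast
  let ?F = "\<lambda>g. exp (- (1 / w) * (l1norm n g - l1norm n h))"
  have "pr g \<le> exp 1 * (pr g * ?F g)" if g: "g \<in> A" for g
  proof -
    have "l1norm n g - l1norm n h \<le> w" using assms(2)[OF g] assms(2)[OF h(1)] by linarith
    then have "0 \<le> 1 + - (1 / w) * (l1norm n g - l1norm n h)" using assms(1) by (simp add: field_simps)
    then have "1 \<le> exp 1 * ?F g" unfolding exp_add[symmetric] one_le_exp_iff .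
    then have "pr g * 1 \<le> pr g * (exp 1 * ?F g)" using pr_nonneg g A by (intro mult_left_mono) auto
    then show ?thesis by (simp add: mult.left_commute)
  qed
  then have "(\<Sum>g\<in>A. pr g) \<le> (\<Sum>g\<in>A. exp 1 * (pr g * ?F g))" by (rule sum_mono)
  also have "\<dots> \<le> (\<Sum>g\<in>{g\<in>H. h \<le> g}. exp 1 * (pr g * ?F g))"
    using finite_H pr_nonneg by (intro sum_mono2 sub) auto
  also have "\<dots> = exp 1 * (\<Sum>g\<in>{g\<in>H. h \<le> g}. pr g * ?F g)" by (simp add: sum_distrib_left)
  also have "\<dots> \<le> exp 1 * (1 + 1 / (1 / w * \<beta>))"
    using assms(1) by (intro mult_left_mono prior_discounted_mass hH) auto
  finally show ?thesis by simp
qed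

end

locale regular_smoothing_model = smoothing_model +
  fixes K :: real
  assumes K: "0 < K" "K \<le> 1"
    and regular: "\<And>h g. h \<in> H \<Longrightarrow> g \<in> H \<Longrightarrow> g \<le> h \<Longrightarrow>
      K * (l1norm n h - l1norm n g) \<le> sqnorm n h - sqnorm n g"
begin

text \<open>
  The regularity condition, applied against the least multiplier, bounds \<open>sqnorm\<close> from below by \<open>K\<close>
  times the increase of \<open>l1norm\<close>, so a discount in \<open>sqnorm\<close> is one in \<open>l1norm\<close>.
\<close>

lemma prior_mass_sqnorm:
  assumes "0 < a"
  shows "(\<Sum>h\<in>H. pr h * exp (- a * sqnorm n h)) \<le> 1 + 1 / (a * K * \<beta>)"
proof -
  obtain m where m: "m \<in> H" "\<And>g. g \<in> H \<Longrightarrow> m \<le> g"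
    using finite_chain_least[OF finite_H nonempty_H le_total] by blast
  have H: "{g\<in>H. m \<le> g} = H" using m by blast
  have "(\<Sum>h\<in>H. pr h * exp (- a * sqnorm n h)) \<le>
      (\<Sum>h\<in>H. pr h * exp (- (a * K) * (l1norm n h - l1norm n m)))"
  proof (intro sum_mono mult_left_mono pr_nonneg)
    fix h assume h: "h \<in> H"
    have "0 \<le> sqnorm n m" by (simp add: sqnorm_def sum_nonneg)
    then have "K * (l1norm n h - l1norm n m) \<le> sqnorm n h"
      using regular[OF h m(1) m(2)[OF h]] by linarith
    then have "a * (K * (l1norm n h - l1norm n m)) \<le> a * sqnorm n h"
      using assms by (intro mult_left_mono) auto
    then show "exp (- a * sqnorm n h) \<le> exp (- (a * K) * (l1norm n h - l1norm n m))"
      by (simp add: mult.assoc)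
  qed
  also have "\<dots> \<le> 1 + 1 / (a * K * \<beta>)"
    using prior_discounted_mass[OF m(1), of "a * K"] assms K unfolding H by simp
  finally show ?thesis .
qed

lemma prior_mass_sqnorm_ball:
  assumes "0 < r" "\<And>h. h \<in> A \<Longrightarrow> h \<in> H \<and> sqnorm n h \<le> r"
  shows "(\<Sum>h\<in>A. pr h) \<le> exp 1 * (1 + r / (K * \<beta>))"
proof -
  have A: "A \<subseteq> H" using assms(2) by blast
  let ?F = "\<lambda>h. exp (- (1 / r) * sqnorm n h)"
  have "pr h \<le> exp 1 * (pr h * ?F h)" if h: "h \<in> A" for h
  proof -
    have "0 \<le> 1 + - (1 / r) * sqnorm n h" using assms(1) assms(2)[OF h] by (simp add: field_simps)
    then have "1 \<le> exp 1 * ?F h" unfolding exp_add[symmetric] one_le_exp_iff .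
    then have "pr h * 1 \<le> pr h * (exp 1 * ?F h)" using pr_nonneg h A by (intro mult_left_mono) auto
    then show ?thesis by (simp add: mult.left_commute)
  qed
  then have "(\<Sum>h\<in>A. pr h) \<le> (\<Sum>h\<in>A. exp 1 * (pr h * ?F h))" by (rule sum_mono)
  also have "\<dots> \<le> (\<Sum>h\<in>H. exp 1 * (pr h * ?F h))"
    using finite_H pr_nonneg by (intro sum_mono2 A) auto
  also have "\<dots> = exp 1 * (\<Sum>h\<in>H. pr h * ?F h)" by (simp add: sum_distrib_left)
  also have "\<dots> \<le> exp 1 * (1 + 1 / (1 / r * K * \<beta>))"
    using assms(1) by (intro mult_left_mono prior_mass_sqnorm) auto
  finally show ?thesis by simp
qed

end

section \<open>Gibbs weights and mean energy\<close>

text \<open>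
  Jensen's inequality for a finite average, from the tangent line of \<open>exp\<close> at the mean.
\<close>

lemma exp_weighted_mean_le:
  fixes w z :: "'h \<Rightarrow> real"
  assumes "\<And>h. h \<in> H \<Longrightarrow> 0 \<le> w h" "(\<Sum>h\<in>H. w h) = 1"
  shows "exp (\<Sum>h\<in>H. w h * z h) \<le> (\<Sum>h\<in>H. w h * exp (z h))"
proof -
  define m where "m = (\<Sum>h\<in>H. w h * z h)"
  have "exp m = (\<Sum>h\<in>H. w h * (exp m * (1 + (z h - m))))"
  proof -
    have "(\<Sum>h\<in>H. w h * (exp m * (1 + (z h - m)))) =
        exp m * (\<Sum>h\<in>H. w h) + exp m * (\<Sum>h\<in>H. w h * z h) - exp m * m * (\<Sum>h\<in>H. w h)"
      unfolding sum_distrib_left sum.distrib[symmetric] sum_subtractf[symmetric]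
      by (intro sum.cong refl) (simp add: algebra_simps)
    then show ?thesis unfolding assms(2) m_def[symmetric] by simp
  qed
  also have "\<dots> \<le> (\<Sum>h\<in>H. w h * exp (z h))"
  proof (intro sum_mono mult_left_mono assms(1))
    fix h
    have "exp m * (1 + (z h - m)) \<le> exp m * exp (z h - m)"
      by (intro mult_left_mono exp_ge_add_one_self) simp
    then show "exp m * (1 + (z h - m)) \<le> exp (z h)" by (simp add: exp_diff)
  qed
  finally show ?thesis unfolding m_def .
qed

definition (in smoothing_model) risk :: "(nat \<Rightarrow> real) \<Rightarrow> real" where
  "risk h = (\<Sum>i=1..n. (1 - h i)\<^sup>2 * (\<mu> i)\<^sup>2) + \<sigma>\<^sup>2 * sqnorm n h"

locale oracle_model = smoothing_model +
  fixes hs :: "nat \<Rightarrow> real"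
  assumes hs: "hs \<in> H" and risk_oracle_le: "\<And>h. h \<in> H \<Longrightarrow> risk hs \<le> risk h"
begin

definition excess :: "(nat \<Rightarrow> real) \<Rightarrow> real" where
  "excess h = (risk h - risk hs) / (2 * \<beta> * \<sigma>\<^sup>2)"

definition energy :: "(nat \<Rightarrow> real) \<Rightarrow> (nat \<Rightarrow> real) \<Rightarrow> real" where
  "energy \<xi> h = (urisk \<xi> h - urisk \<xi> hs) / (2 * \<beta> * \<sigma>\<^sup>2)"

definition gibbs_sum :: "real \<Rightarrow> (nat \<Rightarrow> real) \<Rightarrow> real" where
  "gibbs_sum t \<xi> = (\<Sum>h\<in>H. pr h * exp (- t * energy \<xi> h))"

lemma gibbs_sum_pos: "0 < gibbs_sum t \<xi>"
proof -
  have "0 < pr (hmax H) * exp (- t * energy \<xi> (hmax H))" by (simp add: pr_hmax)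
  then show ?thesis
    unfolding gibbs_sum_def using pr_nonneg finite_H hmax(1)[OF ordered]
    by (intro sum_pos2[of _ "hmax H"]) auto
qed

lemma wt_eq: "wt \<xi> h = pr h * exp (- energy \<xi> h) / gibbs_sum 1 \<xi>"
proof -
  define b where "b = 2 * \<beta> * \<sigma>\<^sup>2"
  define z where "z = exp (- urisk \<xi> hs / b)"
  have z: "z \<noteq> 0" by (simp add: z_def)
  have e: "exp (- urisk \<xi> g / b) = exp (- energy \<xi> g) * z" for g
    unfolding energy_def b_def[symmetric] z_def exp_add[symmetric] by (simp add: diff_divide_distrib)
  have "(\<Sum>g\<in>H. pr g * exp (- urisk \<xi> g / b)) = gibbs_sum 1 \<xi> * z"
    unfolding gibbs_sum_def e by (simp add: sum_distrib_right mult.assoc)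
  then show ?thesis unfolding weight_def b_def[symmetric] e using z by simp
qed

lemma sum_wt: "(\<Sum>h\<in>H. wt \<xi> h) = 1"
  unfolding wt_eq sum_divide_distrib[symmetric] using gibbs_sum_pos[of 1 \<xi>]
  by (simp add: gibbs_sum_def)

lemma urisk_diff_le:
  assumes "g \<in> H" "h \<in> H" "g \<le> h"
  shows "urisk \<xi> h - urisk \<xi> g \<le> 2 * \<sigma>\<^sup>2 * (l1norm n h - l1norm n g)"
proof -
  have "urisk \<xi> h \<le> (\<Sum>i=1..n. ((1 - g i)\<^sup>2 * (obs \<xi> i)\<^sup>2 + 2 * \<sigma>\<^sup>2 * g i - \<sigma>\<^sup>2) +
      2 * \<sigma>\<^sup>2 * (h i - g i))"
    unfolding risk_estimate_eq_sum
  proof (rule sum_mono)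
    fix i assume i: "i \<in> {1..n}"
    have "g i \<le> h i" using assms(3) by (simp add: le_fun_def)
    then have "(1 - h i)\<^sup>2 \<le> (1 - g i)\<^sup>2"
      using multiplier_bounds[OF assms(2) i] by (intro power_mono) auto
    then have "(1 - h i)\<^sup>2 * (obs \<xi> i)\<^sup>2 \<le> (1 - g i)\<^sup>2 * (obs \<xi> i)\<^sup>2"
      by (intro mult_right_mono) auto
    then show "(1 - h i)\<^sup>2 * (obs \<xi> i)\<^sup>2 + 2 * \<sigma>\<^sup>2 * h i - \<sigma>\<^sup>2 \<le>
        ((1 - g i)\<^sup>2 * (obs \<xi> i)\<^sup>2 + 2 * \<sigma>\<^sup>2 * g i - \<sigma>\<^sup>2) + 2 * \<sigma>\<^sup>2 * (h i - g i)"
      by (simp add: algebra_simps)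
  qed
  also have "\<dots> = urisk \<xi> g + 2 * \<sigma>\<^sup>2 * (l1norm n h - l1norm n g)"
    unfolding risk_estimate_eq_sum l1norm_eq_sum[OF assms(1)] l1norm_eq_sum[OF assms(2)]
      sum_subtractf[symmetric] sum_distrib_left sum.distrib[symmetric] ..
  finally show ?thesis by simp
qed

text \<open>
  Passing from \<open>g\<close> to a larger multiplier decreases the residual sum of squares, so the risk estimate grows by
  at most \<open>2 * \<sigma>\<^sup>2\<close> times the increase of \<open>l1norm\<close>. Hence the terms of the Gibbs sum above \<open>g\<close> dominate
  \<open>exp (- energy g)\<close> times the telescoping sum, whose value is \<open>1\<close>.
\<close>

lemma gibbs_sum_ge:
  assumes g: "g \<in> H"
  shows "exp (- energy \<xi> g) \<le> gibbs_sum 1 \<xi>"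
proof -
  let ?F = "\<lambda>h. exp (- (l1norm n h - l1norm n g) / \<beta>)"
  have "exp (- energy \<xi> g) = (\<Sum>h\<in>{h\<in>H. g \<le> h}. pr h * ?F h) * exp (- energy \<xi> g)"
    unfolding prior_exp_telescope[OF g] by simp
  also have "\<dots> = (\<Sum>h\<in>{h\<in>H. g \<le> h}. pr h * exp (- (energy \<xi> g + (l1norm n h - l1norm n g) / \<beta>)))"
    unfolding sum_distrib_right by (intro sum.cong refl) (simp add: mult.assoc diff_divide_distrib flip: exp_add)
  also have "\<dots> \<le> (\<Sum>h\<in>{h\<in>H. g \<le> h}. pr h * exp (- 1 * energy \<xi> h))"
  proof (intro sum_mono mult_left_mono)
    fix h assume h: "h \<in> {h\<in>H. g \<le> h}"
    have b: "0 < 2 * \<beta> * \<sigma>\<^sup>2" using beta sigma by simp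
    have "(urisk \<xi> h - urisk \<xi> g) / (2 * \<beta> * \<sigma>\<^sup>2) \<le>
        (2 * \<sigma>\<^sup>2 * (l1norm n h - l1norm n g)) / (2 * \<beta> * \<sigma>\<^sup>2)"
      using urisk_diff_le[OF g, of h \<xi>] h b by (intro divide_right_mono) auto
    also have "\<dots> = (l1norm n h - l1norm n g) / \<beta>" using sigma by simp
    finally show "exp (- (energy \<xi> g + (l1norm n h - l1norm n g) / \<beta>)) \<le> exp (- 1 * energy \<xi> h)"
      unfolding energy_def by (simp add: diff_divide_distrib)
    show "0 \<le> pr h" using h pr_nonneg by simp
  qed
  also have "\<dots> \<le> gibbs_sum 1 \<xi>"
    unfolding gibbs_sum_def using finite_H pr_nonneg by (intro sum_mono2) auto
  finally show ?thesis .
qed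

lemma energy_oracle [simp]: "energy \<xi> hs = 0"
  by (simp add: energy_def)

lemma gibbs_sum_ge_1: "1 \<le> gibbs_sum 1 \<xi>"
  using gibbs_sum_ge[OF hs, of \<xi>] by simp

text \<open>
  The ratio of the two Gibbs sums is the weighted average of \<open>exp ((1 - t) * energy)\<close>.
\<close>

lemma gibbs_mean_energy_le:
  "(1 - t) * (\<Sum>h\<in>H. wt \<xi> h * energy \<xi> h) \<le> ln (gibbs_sum t \<xi>) - ln (gibbs_sum 1 \<xi>)"
proof -
  have "exp ((1 - t) * (\<Sum>h\<in>H. wt \<xi> h * energy \<xi> h)) =
      exp (\<Sum>h\<in>H. wt \<xi> h * ((1 - t) * energy \<xi> h))"
    by (simp add: sum_distrib_left mult.left_commute)
  also have "\<dots> \<le> (\<Sum>h\<in>H. wt \<xi> h * exp ((1 - t) * energy \<xi> h))"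
    using wt_bounds sum_wt by (intro exp_weighted_mean_le) auto
  also have "\<dots> = (\<Sum>h\<in>H. pr h * exp (- t * energy \<xi> h)) / gibbs_sum 1 \<xi>"
    unfolding sum_divide_distrib
  proof (intro sum.cong refl)
    fix h
    have "exp (- energy \<xi> h) * exp ((1 - t) * energy \<xi> h) = exp (- t * energy \<xi> h)"
      unfolding exp_add[symmetric] by (simp add: algebra_simps)
    then show "wt \<xi> h * exp ((1 - t) * energy \<xi> h) = pr h * exp (- t * energy \<xi> h) / gibbs_sum 1 \<xi>"
      unfolding wt_eq by (simp add: mult.assoc)
  qed
  finally have "exp ((1 - t) * (\<Sum>h\<in>H. wt \<xi> h * energy \<xi> h)) \<le> gibbs_sum t \<xi> / gibbs_sum 1 \<xi>"
    unfolding gibbs_sum_def[of t] .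
  then have "(1 - t) * (\<Sum>h\<in>H. wt \<xi> h * energy \<xi> h) \<le> ln (gibbs_sum t \<xi> / gibbs_sum 1 \<xi>)"
    using gibbs_sum_pos by (subst ln_ge_iff) auto
  then show ?thesis using gibbs_sum_pos[of t \<xi>] gibbs_sum_pos[of 1 \<xi>] by (simp add: ln_div)
qed

definition mean_energy :: real where
  "mean_energy = (\<integral>\<xi>. (\<Sum>h\<in>H. wt \<xi> h * energy \<xi> h) \<partial>noise n)"

lemma integrable_energy: "integrable (noise n) (\<lambda>\<xi>. energy \<xi> h)"
  unfolding energy_def using integrable_urisk by simp

lemma integrable_mean_energy: "integrable (noise n) (\<lambda>\<xi>. \<Sum>h\<in>H. wt \<xi> h * energy \<xi> h)"
  by (intro Bochner_Integration.integrable_sum integrable_wt_mult integrable_energy)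

lemma risk_le_mean_energy:
  "expect n \<sigma> \<mu> (\<lambda>Y. loss n (exp_weighting n \<beta> \<sigma> H Y) \<mu>) \<le> risk hs + 2 * \<beta> * \<sigma>\<^sup>2 * mean_energy"
proof -
  define b where "b = 2 * \<beta> * \<sigma>\<^sup>2"
  have b: "b \<noteq> 0" using beta sigma by (simp add: b_def)
  have "(\<Sum>h\<in>H. wt \<xi> h * urisk \<xi> h) = urisk \<xi> hs + b * (\<Sum>h\<in>H. wt \<xi> h * energy \<xi> h)" for \<xi>
  proof -
    have e: "urisk \<xi> h = urisk \<xi> hs + b * energy \<xi> h" for h
      unfolding energy_def b_def[symmetric] using b by simp
    have "(\<Sum>h\<in>H. wt \<xi> h * urisk \<xi> h) = (\<Sum>h\<in>H. wt \<xi> h * (urisk \<xi> hs + b * energy \<xi> h))"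
      by (intro sum.cong refl arg_cong2[where f = times] e)
    also have "\<dots> = (\<Sum>h\<in>H. wt \<xi> h) * urisk \<xi> hs + b * (\<Sum>h\<in>H. wt \<xi> h * energy \<xi> h)"
      unfolding sum_distrib_left sum_distrib_right sum.distrib[symmetric]
      by (intro sum.cong refl) (simp add: algebra_simps)
    finally show ?thesis unfolding sum_wt by simp
  qed
  then have "(\<integral>\<xi>. (\<Sum>h\<in>H. wt \<xi> h * urisk \<xi> h) \<partial>noise n) = risk hs + b * mean_energy"
    unfolding mean_energy_def risk_def expectation_urisk[symmetric]
    using integrable_urisk integrable_mean_energy by simp
  then show ?thesis using risk_le_average_unbiased_risk unfolding b_def by simp
qed

text \<open>
  The expectation of \<open>ln (gibbs_sum t)\<close> is handled by the tangent line of the logarithm at \<open>b\<close>. The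
  function \<open>L\<close> stands for any integrable minorant of \<open>ln (gibbs_sum 1)\<close>.
\<close>

lemma mean_energy_le:
  assumes int: "\<And>h. h \<in> H \<Longrightarrow> integrable (noise n) (\<lambda>\<xi>. exp (- t * energy \<xi> h))"
    and b: "0 < b" "(\<Sum>h\<in>H. pr h * (\<integral>\<xi>. exp (- t * energy \<xi> h) \<partial>noise n)) \<le> b"
    and L: "integrable (noise n) L" "\<And>\<xi>. L \<xi> \<le> ln (gibbs_sum 1 \<xi>)"
  shows "(1 - t) * mean_energy \<le> ln b - (\<integral>\<xi>. L \<xi> \<partial>noise n)"
proof -
  have ip: "integrable (noise n) (gibbs_sum t)"
    unfolding gibbs_sum_def[abs_def] using int by (intro Bochner_Integration.integrable_sum) auto
  have ep: "(\<integral>\<xi>. gibbs_sum t \<xi> \<partial>noise n) \<le> b"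
    unfolding gibbs_sum_def using b(2) int by (subst Bochner_Integration.integral_sum) auto
  have "(1 - t) * mean_energy = (\<integral>\<xi>. (1 - t) * (\<Sum>h\<in>H. wt \<xi> h * energy \<xi> h) \<partial>noise n)"
    unfolding mean_energy_def by simp
  also have "\<dots> \<le> (\<integral>\<xi>. ln b + gibbs_sum t \<xi> / b - 1 - L \<xi> \<partial>noise n)"
  proof (rule integral_mono)
    show "integrable (noise n) (\<lambda>\<xi>. (1 - t) * (\<Sum>h\<in>H. wt \<xi> h * energy \<xi> h))"
      using integrable_mean_energy by simp
    show "integrable (noise n) (\<lambda>\<xi>. ln b + gibbs_sum t \<xi> / b - 1 - L \<xi>)"
      using ip L(1) by simp
    fix \<xi>
    have "ln (gibbs_sum t \<xi> / b) \<le> gibbs_sum t \<xi> / b - 1"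
      using gibbs_sum_pos b(1) by (intro ln_le_minus_one) auto
    then have "ln (gibbs_sum t \<xi>) \<le> ln b + gibbs_sum t \<xi> / b - 1"
      using gibbs_sum_pos[of t \<xi>] b(1) by (simp add: ln_div)
    then show "(1 - t) * (\<Sum>h\<in>H. wt \<xi> h * energy \<xi> h) \<le> ln b + gibbs_sum t \<xi> / b - 1 - L \<xi>"
      using gibbs_mean_energy_le[of t \<xi>] L(2)[of \<xi>] by linarith
  qed
  also have "\<dots> = ln b + (\<integral>\<xi>. gibbs_sum t \<xi> \<partial>noise n) / b - 1 - (\<integral>\<xi>. L \<xi> \<partial>noise n)"
    using ip L(1) prob_space by simp
  also have "\<dots> \<le> ln b - (\<integral>\<xi>. L \<xi> \<partial>noise n)"
    using ep b(1) by (simp add: divide_le_eq)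
  finally show ?thesis .
qed

end

section \<open>Exponential moments of the energy\<close>

text \<open>
  Via \<open>ln (1 - u) = 2 * ln (sqrt (1 - u)) \<le> 2 * (sqrt (1 - u) - 1)\<close>.
\<close>

lemma ln_one_minus_le_quadratic:
  fixes u :: real
  assumes "\<bar>u\<bar> \<le> 1 / 4"
  shows "ln (1 - u) \<le> - u - u\<^sup>2 / 8"
proof -
  have u: "- 1 / 4 \<le> u" "u \<le> 1 / 4" using assms by auto
  have c: "0 \<le> 1 - u / 2 - u\<^sup>2 / 16"
  proof -
    have "u\<^sup>2 \<le> 1" using assms by (simp add: abs_square_le_1)
    then show ?thesis using u by linarith
  qed
  have "sqrt (1 - u) \<le> 1 - u / 2 - u\<^sup>2 / 16"
  proof (rule real_le_lsqrt[OF c])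
    have "0 \<le> u\<^sup>2 * (1 / 8 + u / 16 + u\<^sup>2 / 256)"
    proof (rule mult_nonneg_nonneg)
      have "0 \<le> u\<^sup>2 / 256" by simp
      then show "0 \<le> 1 / 8 + u / 16 + u\<^sup>2 / 256" using u by linarith
    qed simp
    also have "\<dots> = (1 - u / 2 - u\<^sup>2 / 16)\<^sup>2 - (1 - u)"
      by (simp add: power2_eq_square field_simps)
    finally show "1 - u \<le> (1 - u / 2 - u\<^sup>2 / 16)\<^sup>2" by simp
  qed
  moreover have "ln (1 - u) = 2 * ln (sqrt (1 - u))" using u by (simp add: ln_sqrt)
  moreover have "ln (sqrt (1 - u)) \<le> sqrt (1 - u) - 1" using u by (intro ln_le_minus_one) simp
  ultimately show ?thesis by linarith
qed

text \<open>
  The linear part of the exponent can only increase the exponential moment, so the lower bound keeps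
  the quadratic part alone.
\<close>

lemma gauss_exp_centered_quadratic:
  assumes "\<bar>2 * \<gamma>\<bar> \<le> 1 / 4"
  shows "integrable gauss (\<lambda>x. exp (\<alpha> * x + \<gamma> * (x\<^sup>2 - 1)))"
    and "exp ((2 * \<gamma>)\<^sup>2 / 16) \<le> (\<integral>x. exp (\<alpha> * x + \<gamma> * (x\<^sup>2 - 1)) \<partial>gauss)"
    and "(\<integral>x. exp (\<alpha> * x + \<gamma> * (x\<^sup>2 - 1)) \<partial>gauss) \<le> exp ((2 * \<gamma>)\<^sup>2 + \<alpha>\<^sup>2)"
proof -
  define u where "u = 2 * \<gamma>"
  have u: "\<bar>u\<bar> \<le> 1 / 4" "u < 1" "1 \<le> 2 * (1 - u)" using assms by (auto simp: u_def)
  have e: "exp (\<alpha> * x + \<gamma> * (x\<^sup>2 - 1)) = exp (- u / 2) * exp (\<alpha> * x + \<gamma> * x\<^sup>2)" for x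
    unfolding exp_add[symmetric] u_def by (simp add: algebra_simps)
  note q = gauss_exp_quadratic[of \<gamma> \<alpha>, folded u_def, OF u(2)]
  show "integrable gauss (\<lambda>x. exp (\<alpha> * x + \<gamma> * (x\<^sup>2 - 1)))" unfolding e using q(1) by simp
  have "sqrt (1 - u) = exp (ln (1 - u) / 2)"
    using u(2) exp_ln[of "sqrt (1 - u)"] by (simp add: ln_sqrt)
  then have i: "(\<integral>x. exp (\<alpha> * x + \<gamma> * (x\<^sup>2 - 1)) \<partial>gauss) =
      exp (- u / 2 + \<alpha>\<^sup>2 / (2 * (1 - u)) - ln (1 - u) / 2)"
    unfolding e exp_diff exp_add[of "- u / 2"] integral_mult_right_zero q(2) by simp
  have a: "0 \<le> \<alpha>\<^sup>2 / (2 * (1 - u))" "\<alpha>\<^sup>2 / (2 * (1 - u)) \<le> \<alpha>\<^sup>2 / 1"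
    using u by (auto intro!: divide_nonneg_nonneg divide_left_mono simp del: div_by_1)
  have "\<bar>ln (1 + - u) - - u\<bar> \<le> 2 * (- u)\<^sup>2"
    using u(1) by (intro abs_ln_one_plus_x_minus_x_bound) auto
  then have "\<bar>ln (1 - u) + u\<bar> \<le> 2 * u\<^sup>2" by simp
  then show "(\<integral>x. exp (\<alpha> * x + \<gamma> * (x\<^sup>2 - 1)) \<partial>gauss) \<le> exp ((2 * \<gamma>)\<^sup>2 + \<alpha>\<^sup>2)"
    unfolding i u_def[symmetric] exp_le_cancel_iff using a by linarith
  show "exp ((2 * \<gamma>)\<^sup>2 / 16) \<le> (\<integral>x. exp (\<alpha> * x + \<gamma> * (x\<^sup>2 - 1)) \<partial>gauss)"
    unfolding i u_def[symmetric] exp_le_cancel_iff using a ln_one_minus_le_quadratic[OF u(1)] by linarith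
qed

context oracle_model
begin

definition bias_gap :: "(nat \<Rightarrow> real) \<Rightarrow> nat \<Rightarrow> real" where
  "bias_gap h i = (1 - h i)\<^sup>2 - (1 - hs i)\<^sup>2"

definition rel_risk :: real where "rel_risk = risk hs / \<sigma>\<^sup>2"

lemma excess_oracle: "excess hs = 0"
  by (simp add: excess_def)

lemma excess_nonneg: "h \<in> H \<Longrightarrow> 0 \<le> excess h"
  unfolding excess_def using risk_oracle_le beta by simp

lemma risk_eq_excess: "risk h / \<sigma>\<^sup>2 = rel_risk + 2 * \<beta> * excess h"
  unfolding excess_def rel_risk_def using beta sigma by (simp add: field_simps)

lemma sqnorm_nonneg: "0 \<le> sqnorm n h"
  by (simp add: sqnorm_def sum_nonneg)

lemma sqnorm_le_excess: "sqnorm n h \<le> rel_risk + 2 * \<beta> * excess h"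
proof -
  have "0 \<le> (\<Sum>i=1..n. (1 - h i)\<^sup>2 * (\<mu> i)\<^sup>2)" by (intro sum_nonneg) auto
  then have "\<sigma>\<^sup>2 * sqnorm n h / \<sigma>\<^sup>2 \<le> risk h / \<sigma>\<^sup>2"
    unfolding risk_def by (intro divide_right_mono) auto
  then show ?thesis unfolding risk_eq_excess using sigma by simp
qed

lemma rel_risk_nonneg: "0 \<le> rel_risk"
  using sqnorm_le_excess[of hs] sqnorm_nonneg[of hs] by (simp add: excess_def)

text \<open>
  The energy is its mean, the excess risk, plus a centered Gaussian quadratic form with independent
  terms.
\<close>

lemma energy_eq:
  "energy \<xi> h = excess h + (\<Sum>i=1..n. bias_gap h i / (2 * \<beta>) * (2 * (\<mu> i / \<sigma>) * \<xi> i + ((\<xi> i)\<^sup>2 - 1)))"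
proof -
  define b where "b = 2 * \<beta> * \<sigma>\<^sup>2"
  have b: "b \<noteq> 0" using beta sigma by (simp add: b_def)
  have "b * energy \<xi> h = urisk \<xi> h - urisk \<xi> hs" unfolding energy_def b_def[symmetric] using b by simp
  also have "\<dots> = (\<Sum>i=1..n. ((1 - h i)\<^sup>2 * (\<mu> i)\<^sup>2 + \<sigma>\<^sup>2 * (h i)\<^sup>2) -
      ((1 - hs i)\<^sup>2 * (\<mu> i)\<^sup>2 + \<sigma>\<^sup>2 * (hs i)\<^sup>2) +
      b * (bias_gap h i / (2 * \<beta>) * (2 * (\<mu> i / \<sigma>) * \<xi> i + ((\<xi> i)\<^sup>2 - 1))))"
    unfolding risk_estimate_eq_sum sum_subtractf[symmetric]
  proof (intro sum.cong refl)
    fix i assume i: "i \<in> {1..n}"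
    have "b * (bias_gap h i / (2 * \<beta>) * (2 * (\<mu> i / \<sigma>) * \<xi> i + ((\<xi> i)\<^sup>2 - 1))) =
        bias_gap h i * (2 * \<sigma> * \<mu> i * \<xi> i + \<sigma>\<^sup>2 * ((\<xi> i)\<^sup>2 - 1))"
      unfolding b_def using beta sigma by (simp add: field_simps power2_eq_square)
    then show "(1 - h i)\<^sup>2 * (obs \<xi> i)\<^sup>2 + 2 * \<sigma>\<^sup>2 * h i - \<sigma>\<^sup>2 -
        ((1 - hs i)\<^sup>2 * (obs \<xi> i)\<^sup>2 + 2 * \<sigma>\<^sup>2 * hs i - \<sigma>\<^sup>2) =
        ((1 - h i)\<^sup>2 * (\<mu> i)\<^sup>2 + \<sigma>\<^sup>2 * (h i)\<^sup>2) -
        ((1 - hs i)\<^sup>2 * (\<mu> i)\<^sup>2 + \<sigma>\<^sup>2 * (hs i)\<^sup>2) +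
        b * (bias_gap h i / (2 * \<beta>) * (2 * (\<mu> i / \<sigma>) * \<xi> i + ((\<xi> i)\<^sup>2 - 1)))"
      unfolding bias_gap_def by (simp only: observation_apply[OF i]) (simp add: power2_eq_square algebra_simps)
  qed
  also have "\<dots> = (risk h - risk hs) +
      b * (\<Sum>i=1..n. bias_gap h i / (2 * \<beta>) * (2 * (\<mu> i / \<sigma>) * \<xi> i + ((\<xi> i)\<^sup>2 - 1)))"
    by (simp only: sum.distrib sum_subtractf sum_distrib_left[symmetric] risk_def sqnorm_def)
  also have "risk h - risk hs = b * excess h" unfolding excess_def b_def[symmetric] using b by simp
  finally have "b * energy \<xi> h =
      b * (excess h + (\<Sum>i=1..n. bias_gap h i / (2 * \<beta>) * (2 * (\<mu> i / \<sigma>) * \<xi> i + ((\<xi> i)\<^sup>2 - 1))))"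
    by (simp only: distrib_left)
  then show ?thesis using b by simp
qed

lemma bias_gap_eq: "bias_gap h i = (hs i - h i) * (2 - h i - hs i)"
  by (simp add: bias_gap_def power2_eq_square algebra_simps)

text \<open>
  The factorization \<open>bias_gap h i = (hs i - h i) * (2 - h i - hs i)\<close> yields the second and the fourth bound.
  The fourth uses that \<open>2 - h i - hs i \<ge> \<bar>h i - hs i\<bar>\<close>: the fluctuations of the energy cannot
  degenerate where both multipliers are close to \<open>1\<close> but differ.
\<close>

lemma bias_gap_bounds:
  assumes "h \<in> H" "i \<in> {1..n}"
  shows "\<bar>bias_gap h i\<bar> \<le> 1" "(bias_gap h i)\<^sup>2 \<le> 4 * ((h i)\<^sup>2 + (hs i)\<^sup>2)"
    "(bias_gap h i)\<^sup>2 \<le> (1 - h i)\<^sup>2 + (1 - hs i)\<^sup>2" "(h i - hs i) ^ 4 \<le> (bias_gap h i)\<^sup>2"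
proof -
  have b: "0 \<le> h i" "h i \<le> 1" "0 \<le> hs i" "hs i \<le> 1"
    using multiplier_bounds assms hs by auto
  define p where "p = (1 - h i)\<^sup>2"
  define q where "q = (1 - hs i)\<^sup>2"
  have pq: "0 \<le> p" "p \<le> 1" "0 \<le> q" "q \<le> 1"
    using b by (auto simp: p_def q_def abs_square_le_1)
  show s1: "\<bar>bias_gap h i\<bar> \<le> 1" unfolding bias_gap_def p_def[symmetric] q_def[symmetric] using pq by linarith
  have "\<bar>bias_gap h i\<bar> * \<bar>bias_gap h i\<bar> \<le> 1 * \<bar>bias_gap h i\<bar>" using s1 by (intro mult_right_mono) auto
  then have "(bias_gap h i)\<^sup>2 \<le> \<bar>bias_gap h i\<bar>" by (simp add: power2_eq_square)
  also have "\<dots> \<le> p + q" unfolding bias_gap_def p_def[symmetric] q_def[symmetric] using pq by linarith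
  finally show "(bias_gap h i)\<^sup>2 \<le> (1 - h i)\<^sup>2 + (1 - hs i)\<^sup>2" by (simp add: p_def q_def)
  have "(2 - h i - hs i)\<^sup>2 \<le> 2\<^sup>2" using b by (intro power_mono) auto
  then have "(hs i - h i)\<^sup>2 * (2 - h i - hs i)\<^sup>2 \<le> (hs i - h i)\<^sup>2 * 4" by (intro mult_left_mono) auto
  also have "(hs i - h i)\<^sup>2 * 4 \<le> 4 * ((h i)\<^sup>2 + (hs i)\<^sup>2)"
    using b by (simp add: power2_diff)
  finally show "(bias_gap h i)\<^sup>2 \<le> 4 * ((h i)\<^sup>2 + (hs i)\<^sup>2)"
    unfolding bias_gap_eq power_mult_distrib .
  have "\<bar>h i - hs i\<bar> ^ 2 \<le> (2 - h i - hs i)\<^sup>2" using b by (intro power_mono) auto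
  then have "(h i - hs i)\<^sup>2 * (h i - hs i)\<^sup>2 \<le> (hs i - h i)\<^sup>2 * (2 - h i - hs i)\<^sup>2"
    by (intro mult_mono) (auto simp: power2_commute)
  then show "(h i - hs i) ^ 4 \<le> (bias_gap h i)\<^sup>2"
    unfolding bias_gap_eq power_mult_distrib by (simp flip: power_add)
qed

text \<open>
  The variance is controlled by the risks themselves: the quadratic part by the variance terms
  \<open>sqnorm\<close>, the linear part by the bias terms.
\<close>

lemma noise_variance_le:
  assumes h: "h \<in> H"
  shows "(\<Sum>i=1..n. (bias_gap h i)\<^sup>2 * (1 + (\<mu> i / \<sigma>)\<^sup>2)) / \<beta>\<^sup>2 \<le> rel_risk + 2 * excess h"
proof -
  have "(\<Sum>i=1..n. (bias_gap h i)\<^sup>2 * (1 + (\<mu> i / \<sigma>)\<^sup>2)) \<le>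
      (\<Sum>i=1..n. 4 * ((h i)\<^sup>2 + (hs i)\<^sup>2) + 4 * (((1 - h i)\<^sup>2 + (1 - hs i)\<^sup>2) * (\<mu> i / \<sigma>)\<^sup>2))"
  proof (rule sum_mono)
    fix i assume i: "i \<in> {1..n}"
    have "(bias_gap h i)\<^sup>2 * (\<mu> i / \<sigma>)\<^sup>2 \<le> ((1 - h i)\<^sup>2 + (1 - hs i)\<^sup>2) * (\<mu> i / \<sigma>)\<^sup>2"
      using bias_gap_bounds(3)[OF h i] by (intro mult_right_mono) auto
    moreover have "0 \<le> ((1 - h i)\<^sup>2 + (1 - hs i)\<^sup>2) * (\<mu> i / \<sigma>)\<^sup>2" by simp
    moreover have "(bias_gap h i)\<^sup>2 * (1 + (\<mu> i / \<sigma>)\<^sup>2) = (bias_gap h i)\<^sup>2 + (bias_gap h i)\<^sup>2 * (\<mu> i / \<sigma>)\<^sup>2"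
      by (simp add: distrib_left)
    ultimately show "(bias_gap h i)\<^sup>2 * (1 + (\<mu> i / \<sigma>)\<^sup>2) \<le>
        4 * ((h i)\<^sup>2 + (hs i)\<^sup>2) + 4 * (((1 - h i)\<^sup>2 + (1 - hs i)\<^sup>2) * (\<mu> i / \<sigma>)\<^sup>2)"
      using bias_gap_bounds(2)[OF h i] by linarith
  qed
  also have "\<dots> = 4 * (risk h / \<sigma>\<^sup>2 + risk hs / \<sigma>\<^sup>2)"
  proof -
    have r: "risk g / \<sigma>\<^sup>2 = (\<Sum>i=1..n. (1 - g i)\<^sup>2 * (\<mu> i / \<sigma>)\<^sup>2) + (\<Sum>i=1..n. (g i)\<^sup>2)" for g
      unfolding risk_def sqnorm_def using sigma
      by (simp add: add_divide_distrib sum_divide_distrib power_divide)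
    show ?thesis unfolding r sum_distrib_left sum.distrib[symmetric]
      by (intro sum.cong refl) (simp add: algebra_simps)
  qed
  also have "\<dots> = 8 * rel_risk + 8 * \<beta> * excess h"
    unfolding risk_eq_excess excess_oracle by (simp add: algebra_simps)
  finally have "(\<Sum>i=1..n. (bias_gap h i)\<^sup>2 * (1 + (\<mu> i / \<sigma>)\<^sup>2)) \<le> 8 * rel_risk + 8 * \<beta> * excess h" .
  also have "\<dots> \<le> (rel_risk + 2 * excess h) * \<beta>\<^sup>2"
  proof -
    have "4 * 4 \<le> \<beta> * \<beta>" using beta by (intro mult_mono) auto
    then have "rel_risk * 8 \<le> rel_risk * (\<beta> * \<beta>)" using rel_risk_nonneg by (intro mult_left_mono) auto
    moreover have "excess h * \<beta> * 4 \<le> excess h * \<beta> * \<beta>"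
      using excess_nonneg[OF h] beta by (intro mult_left_mono) auto
    ultimately show ?thesis by (simp add: power2_eq_square algebra_simps)
  qed
  finally show ?thesis using beta by (simp add: divide_le_eq)
qed

lemma exp_energy_moments:
  assumes h: "h \<in> H" and t: "0 < t" "t \<le> 1"
  shows "integrable (noise n) (\<lambda>\<xi>. exp (- t * energy \<xi> h))"
    and "exp (- t * excess h + t\<^sup>2 / (16 * \<beta>\<^sup>2) * (\<Sum>i=1..n. (bias_gap h i)\<^sup>2)) \<le>
      (\<integral>\<xi>. exp (- t * energy \<xi> h) \<partial>noise n)"
    and "(\<integral>\<xi>. exp (- t * energy \<xi> h) \<partial>noise n) \<le>
      exp (- t * excess h + t\<^sup>2 * (rel_risk + 2 * excess h))"
proof -
  interpret PS: product_sigma_finite "\<lambda>_::nat. gauss"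
    by (intro product_sigma_finite.intro prob_space_imp_sigma_finite prob_space_std_normal)
  define \<gamma> where "\<gamma> i = - t * bias_gap h i / (2 * \<beta>)" for i
  define \<alpha> where "\<alpha> i = - t * bias_gap h i * (\<mu> i / \<sigma>) / \<beta>" for i
  define f where "f i x = exp (\<alpha> i * x + \<gamma> i * (x\<^sup>2 - 1))" for i x
  have g: "\<bar>2 * \<gamma> i\<bar> \<le> 1 / 4" if i: "i \<in> {1..n}" for i
  proof -
    have "t * \<bar>bias_gap h i\<bar> \<le> 1 * 1" using t bias_gap_bounds(1)[OF h i] by (intro mult_mono) auto
    moreover have "\<bar>2 * \<gamma> i\<bar> = t * \<bar>bias_gap h i\<bar> / \<beta>"
      unfolding \<gamma>_def using t beta by (simp add: abs_mult)
    ultimately show ?thesis using beta by (simp add: divide_le_eq)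
  qed
  have e: "exp (- t * energy \<xi> h) = exp (- t * excess h) * (\<Prod>i\<in>{1..n}. f i (\<xi> i))" for \<xi>
  proof -
    have "- t * (bias_gap h i / (2 * \<beta>) * (2 * (\<mu> i / \<sigma>) * \<xi> i + ((\<xi> i)\<^sup>2 - 1))) =
        \<alpha> i * \<xi> i + \<gamma> i * ((\<xi> i)\<^sup>2 - 1)" for i
      unfolding \<alpha>_def \<gamma>_def using beta sigma by (simp add: field_simps)
    then have "- t * energy \<xi> h = - t * excess h + (\<Sum>i=1..n. \<alpha> i * \<xi> i + \<gamma> i * ((\<xi> i)\<^sup>2 - 1))"
      unfolding energy_eq distrib_left[of "- t" "excess h"] sum_distrib_left by simp
    then show ?thesis unfolding f_def exp_sum[OF finite_atLeastAtMost, symmetric] exp_add[symmetric] by (simp only:)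
  qed
  have fi: "integrable gauss (f i)" if "i \<in> {1..n}" for i
    unfolding f_def[abs_def] using gauss_exp_centered_quadratic(1)[OF g[OF that]] .
  have "integrable (noise n) (\<lambda>\<xi>. \<Prod>i\<in>{1..n}. f i (\<xi> i))"
    unfolding noise_def by (intro PS.product_integrable_prod fi) auto
  then show "integrable (noise n) (\<lambda>\<xi>. exp (- t * energy \<xi> h))" unfolding e by simp
  have E: "(\<integral>\<xi>. exp (- t * energy \<xi> h) \<partial>noise n) =
      exp (- t * excess h) * (\<Prod>i\<in>{1..n}. \<integral>x. f i x \<partial>gauss)"
    unfolding e noise_def using PS.product_integral_prod[of "{1..n}" f] fi by simp
  have "(\<Prod>i\<in>{1..n}. exp ((2 * \<gamma> i)\<^sup>2 / 16)) \<le> (\<Prod>i\<in>{1..n}. \<integral>x. f i x \<partial>gauss)"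
    unfolding f_def using gauss_exp_centered_quadratic(2)[OF g] by (intro prod_mono) auto
  also have "(\<Prod>i\<in>{1..n}. exp ((2 * \<gamma> i)\<^sup>2 / 16)) = exp (t\<^sup>2 / (16 * \<beta>\<^sup>2) * (\<Sum>i=1..n. (bias_gap h i)\<^sup>2))"
    unfolding exp_sum[OF finite_atLeastAtMost, symmetric] sum_distrib_left \<gamma>_def
    using beta by (intro arg_cong[where f = exp] sum.cong refl) (simp add: power_divide power_mult_distrib)
  finally show "exp (- t * excess h + t\<^sup>2 / (16 * \<beta>\<^sup>2) * (\<Sum>i=1..n. (bias_gap h i)\<^sup>2)) \<le>
      (\<integral>\<xi>. exp (- t * energy \<xi> h) \<partial>noise n)"
    unfolding E exp_add by (intro mult_left_mono) auto
  have "(\<Prod>i\<in>{1..n}. \<integral>x. f i x \<partial>gauss) \<le> (\<Prod>i\<in>{1..n}. exp ((2 * \<gamma> i)\<^sup>2 + (\<alpha> i)\<^sup>2))"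
    unfolding f_def using gauss_exp_centered_quadratic(3)[OF g]
    by (intro prod_mono) (auto intro: Bochner_Integration.integral_nonneg)
  also have "\<dots> = exp (t\<^sup>2 * ((\<Sum>i=1..n. (bias_gap h i)\<^sup>2 * (1 + (\<mu> i / \<sigma>)\<^sup>2)) / \<beta>\<^sup>2))"
    unfolding exp_sum[OF finite_atLeastAtMost, symmetric] sum_distrib_left sum_divide_distrib \<gamma>_def \<alpha>_def
    using beta by (intro arg_cong[where f = exp] sum.cong refl)
      (simp add: power_divide power_mult_distrib distrib_left add_divide_distrib)
  also have "\<dots> \<le> exp (t\<^sup>2 * (rel_risk + 2 * excess h))"
    unfolding exp_le_cancel_iff by (intro mult_left_mono noise_variance_le h) auto
  finally show "(\<integral>\<xi>. exp (- t * energy \<xi> h) \<partial>noise n) \<le>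
      exp (- t * excess h + t\<^sup>2 * (rel_risk + 2 * excess h))"
    unfolding E exp_add by (intro mult_left_mono) auto
qed

end

section \<open>Mean energy for small and large oracle risk\<close>

text \<open>
  \<open>spread_const K * x\<close> is the lower bound for the variance of the energy of a far multiplier; the power
  of \<open>K\<close> comes from the quartic weight in \<open>quartic_domination\<close>.
\<close>

definition spread_const :: "real \<Rightarrow> real" where
  "spread_const K = K / (128 * (1024 / K\<^sup>2) ^ 3)"

lemma spread_const_bounds:
  assumes "0 < K" "K \<le> 1"
  shows "0 < spread_const K" "spread_const K \<le> 1"
proof -
  show "0 < spread_const K" using assms by (simp add: spread_const_def)
  have "K\<^sup>2 \<le> 1" using assms by (simp add: abs_square_le_1)
  then have "1 \<le> 1024 / K\<^sup>2" using assms by (simp add: le_divide_eq)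
  then have "1 \<le> (1024 / K\<^sup>2) ^ 3" by (rule one_le_power)
  then show "spread_const K \<le> 1" unfolding spread_const_def using assms
    by (simp add: divide_le_eq_1)
qed

text \<open>
  Applied with \<open>t\<close> the difference of two multipliers and \<open>s\<close> the larger one. If \<open>s\<close> is small the first
  term dominates, if \<open>t\<close> is small compared to \<open>s\<close> the second; otherwise \<open>t\<close> is bounded below by
  a multiple of \<open>K\<^sup>2\<close>, and the quartic term dominates.
\<close>

lemma quartic_domination:
  fixes K s t :: real
  assumes K: "0 < K" "K \<le> 1" and ts: "0 \<le> t" "t \<le> s" "s \<le> 1"
  shows "2 * t * s \<le> K / 2 * t + K / 128 * s\<^sup>2 + 2 * (1024 / K\<^sup>2) ^ 3 * t ^ 4"
proof -
  have n: "0 \<le> K / 2 * t" "0 \<le> K / 128 * s\<^sup>2" "0 \<le> 2 * (1024 / K\<^sup>2) ^ 3 * t ^ 4"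
    using K ts by auto
  consider "s \<le> K / 4" | "t \<le> K / 256 * s" | "K / 4 < s" "K / 256 * s < t" by linarith
  then show ?thesis
  proof cases
    case 1
    then have "(2 * t) * s \<le> (2 * t) * (K / 4)" using ts by (intro mult_left_mono) auto
    also have "\<dots> = K / 2 * t" by simp
    finally show ?thesis using n by linarith
  next
    case 2
    then have "t * (2 * s) \<le> (K / 256 * s) * (2 * s)" using ts by (intro mult_right_mono) auto
    also have "\<dots> = K / 128 * s\<^sup>2" by (simp add: power2_eq_square)
    finally have "2 * t * s \<le> K / 128 * s\<^sup>2" by simp
    then show ?thesis using n by linarith
  next
    case 3
    have "K / 256 * (K / 4) < t" using 3 K by (intro order.strict_trans2[OF _ less_imp_le[OF 3(2)]]) auto
    then have "1 \<le> 1024 / K\<^sup>2 * t" using K by (simp add: field_simps power2_eq_square)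
    then have "1 \<le> (1024 / K\<^sup>2 * t) ^ 3" by (rule one_le_power)
    then have "2 * t * 1 \<le> 2 * t * (1024 / K\<^sup>2 * t) ^ 3" using ts by (intro mult_left_mono) auto
    also have "\<dots> = 2 * (1024 / K\<^sup>2) ^ 3 * t ^ 4"
      unfolding power_mult_distrib by (simp add: power4_eq_xxxx power3_eq_cube)
    finally have "2 * t \<le> 2 * (1024 / K\<^sup>2) ^ 3 * t ^ 4" by simp
    moreover have "2 * t * s \<le> 2 * t * 1" using ts by (intro mult_left_mono) auto
    ultimately show ?thesis using n by linarith
  qed
qed

locale regular_oracle_model = oracle_model n \<beta> \<sigma> H \<mu> hs + regular_smoothing_model n \<beta> \<sigma> H \<mu> K
  for n \<beta> \<sigma> H \<mu> hs K
begin

text \<open>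
  By regularity, an increase of \<open>l1norm\<close> by \<open>r / 16\<close> raises \<open>sqnorm\<close> by at least \<open>K * r / 16\<close>.
  A sum of \<open>2 * t * s\<close> of this size cannot be carried by the first two terms of \<open>quartic_domination\<close>, so the
  quartic term is of order \<open>r\<close>.
\<close>

lemma quartic_spread_ge:
  assumes "g \<in> H" "h \<in> H" "g \<le> h" "sqnorm n h \<le> 2 * r" "r / 16 \<le> l1norm n h - l1norm n g"
  shows "spread_const K * r \<le> (\<Sum>i=1..n. (h i - g i) ^ 4)"
proof -
  define A where "A = 2 * (1024 / K\<^sup>2) ^ 3"
  have A: "0 < A" using K by (simp add: A_def)
  have "K * (l1norm n h - l1norm n g) \<le> (\<Sum>i=1..n. (h i)\<^sup>2 - (g i)\<^sup>2)"
    using regular[OF assms(2,1,3)] by (simp add: sqnorm_def sum_subtractf)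
  also have "\<dots> \<le> (\<Sum>i=1..n. K / 2 * (h i - g i) + K / 128 * (h i)\<^sup>2 + A * (h i - g i) ^ 4)"
  proof (rule sum_mono)
    fix i assume i: "i \<in> {1..n}"
    have b: "0 \<le> g i" "g i \<le> h i" "h i \<le> 1"
      using multiplier_bounds[OF assms(1) i] multiplier_bounds[OF assms(2) i] assms(3)
      by (auto simp: le_fun_def)
    have "(h i)\<^sup>2 - (g i)\<^sup>2 = (h i - g i) * (h i + g i)"
      by (simp add: power2_eq_square algebra_simps)
    also have "\<dots> \<le> (h i - g i) * (2 * h i)" using b by (intro mult_left_mono) auto
    also have "\<dots> = 2 * (h i - g i) * h i" by simp
    also have "\<dots> \<le> K / 2 * (h i - g i) + K / 128 * (h i)\<^sup>2 + A * (h i - g i) ^ 4"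
      unfolding A_def using b by (intro quartic_domination K) auto
    finally show "(h i)\<^sup>2 - (g i)\<^sup>2 \<le> K / 2 * (h i - g i) + K / 128 * (h i)\<^sup>2 + A * (h i - g i) ^ 4" .
  qed
  also have "\<dots> = K / 2 * (l1norm n h - l1norm n g) + K / 128 * sqnorm n h +
      A * (\<Sum>i=1..n. (h i - g i) ^ 4)"
    unfolding l1norm_eq_sum[OF assms(1)] l1norm_eq_sum[OF assms(2)] sqnorm_def
      sum_subtractf[symmetric] sum_distrib_left sum.distrib[symmetric] ..
  finally have "K / 2 * (l1norm n h - l1norm n g) \<le> K / 128 * sqnorm n h + A * (\<Sum>i=1..n. (h i - g i) ^ 4)"
    by (simp add: algebra_simps)
  moreover have "K / 2 * (r / 16) \<le> K / 2 * (l1norm n h - l1norm n g)"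
    using assms(5) K by (intro mult_left_mono) auto
  moreover have "K / 128 * sqnorm n h \<le> K / 128 * (2 * r)"
    using assms(4) K by (intro mult_left_mono) auto
  \<comment> \<open>\<open>K * r / 32\<close>, of which at most half can come from the term with \<open>sqnorm\<close>\<close>
  ultimately have "K / 64 * r \<le> A * (\<Sum>i=1..n. (h i - g i) ^ 4)" by simp
  then have "K / 64 * r / A \<le> (\<Sum>i=1..n. (h i - g i) ^ 4)" using A by (simp add: divide_le_eq mult.commute)
  moreover have "K / 64 * r / A = spread_const K * r" by (simp add: spread_const_def A_def)
  ultimately show ?thesis by simp
qed

lemma bias_gap_spread_ge:
  assumes h: "h \<in> H" and sq: "sqnorm n h \<le> 2 * rel_risk"
    and far: "rel_risk / 16 < \<bar>l1norm n h - l1norm n hs\<bar>"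
  shows "spread_const K * rel_risk \<le> (\<Sum>i=1..n. (bias_gap h i)\<^sup>2)"
proof -
  have sqs: "sqnorm n hs \<le> 2 * rel_risk"
    using sqnorm_le_excess[of hs] rel_risk_nonneg by (simp add: excess_oracle)
  have "spread_const K * rel_risk \<le> (\<Sum>i=1..n. (h i - hs i) ^ 4)"
  proof (cases "hs \<le> h")
    case True
    then show ?thesis
      using far l1norm_mono[OF hs h] by (intro quartic_spread_ge hs h sq) auto
  next
    case False
    then have le: "h \<le> hs" using le_total[OF h hs] by blast
    have "spread_const K * rel_risk \<le> (\<Sum>i=1..n. (hs i - h i) ^ 4)"
      using far l1norm_mono[OF h hs le] by (intro quartic_spread_ge hs h sqs le) auto
    moreover have "(hs i - h i) ^ 4 = (h i - hs i) ^ 4" for i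
      using power_minus_even[of 4 "hs i - h i"] by simp
    ultimately show ?thesis by simp
  qed
  also have "\<dots> \<le> (\<Sum>i=1..n. (bias_gap h i)\<^sup>2)"
    using bias_gap_bounds(4)[OF h] by (intro sum_mono) auto
  finally show ?thesis .
qed

text \<open>
  For \<open>t \<le> 1 / 4\<close> the part \<open>2 * t\<^sup>2 * excess\<close> of the fluctuations is absorbed by half of
  \<open>t * excess\<close>.
\<close>

lemma mean_energy_le_prior_sum:
  assumes t: "0 < t" "t \<le> 1 / 4"
    and b: "0 < b" "(\<Sum>h\<in>H. pr h * exp (t\<^sup>2 * rel_risk - t / 2 * excess h)) \<le> b"
    and L: "integrable (noise n) L" "\<And>\<xi>. L \<xi> \<le> ln (gibbs_sum 1 \<xi>)"
  shows "(1 - t) * mean_energy \<le> ln b - (\<integral>\<xi>. L \<xi> \<partial>noise n)"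
proof (rule mean_energy_le[OF _ b(1) _ L])
  show "integrable (noise n) (\<lambda>\<xi>. exp (- t * energy \<xi> h))" if "h \<in> H" for h
    using exp_energy_moments(1)[OF that, of t] t by simp
  have "(\<Sum>h\<in>H. pr h * (\<integral>\<xi>. exp (- t * energy \<xi> h) \<partial>noise n)) \<le>
      (\<Sum>h\<in>H. pr h * exp (t\<^sup>2 * rel_risk - t / 2 * excess h))"
  proof (intro sum_mono mult_left_mono pr_nonneg)
    fix h assume h: "h \<in> H"
    have "t * (t * excess h) \<le> 1 / 4 * (t * excess h)"
      using t excess_nonneg[OF h] by (intro mult_right_mono) auto
    then have "- t * excess h + t\<^sup>2 * (rel_risk + 2 * excess h) \<le> t\<^sup>2 * rel_risk - t / 2 * excess h"
      by (simp add: power2_eq_square algebra_simps)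
    then show "(\<integral>\<xi>. exp (- t * energy \<xi> h) \<partial>noise n) \<le> exp (t\<^sup>2 * rel_risk - t / 2 * excess h)"
      using t by (intro order_trans[OF exp_energy_moments(3)[OF h]]) auto
  qed
  then show "(\<Sum>h\<in>H. pr h * (\<integral>\<xi>. exp (- t * energy \<xi> h) \<partial>noise n)) \<le> b" using b(2) by linarith
qed

text \<open>
  A bound that is useful when the oracle risk is of the order of the noise level. It uses only
  that \<open>excess h\<close> is at least \<open>(sqnorm h - rel_risk) / (2 * \<beta>)\<close>.
\<close>

lemma mean_energy_le_rel_risk: "mean_energy \<le> rel_risk + 2 * ln (1 + 16 / K)"
proof -
  have "(\<Sum>h\<in>H. pr h * exp ((1 / 4)\<^sup>2 * rel_risk - (1 / 4) / 2 * excess h)) \<le>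
      (\<Sum>h\<in>H. exp (rel_risk / 8) * (pr h * exp (- (1 / (16 * \<beta>)) * sqnorm n h)))"
  proof (rule sum_mono)
    fix h assume h: "h \<in> H"
    have "1 / (16 * \<beta>) * sqnorm n h \<le> 1 / (16 * \<beta>) * (rel_risk + 2 * \<beta> * excess h)"
      using beta by (intro mult_left_mono sqnorm_le_excess) auto
    also have "\<dots> = rel_risk / (16 * \<beta>) + excess h / 8" using beta by (simp add: field_simps)
    also have "rel_risk / (16 * \<beta>) \<le> rel_risk / 16" using beta rel_risk_nonneg by (intro divide_left_mono) auto
    finally have "(1 / 4)\<^sup>2 * rel_risk - (1 / 4) / 2 * excess h \<le> rel_risk / 8 + - (1 / (16 * \<beta>)) * sqnorm n h"
      by (simp add: power2_eq_square)
    then have "exp ((1 / 4)\<^sup>2 * rel_risk - (1 / 4) / 2 * excess h) \<le>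
        exp (rel_risk / 8) * exp (- (1 / (16 * \<beta>)) * sqnorm n h)"
      unfolding exp_add[symmetric] exp_le_cancel_iff .
    then have "pr h * exp ((1 / 4)\<^sup>2 * rel_risk - (1 / 4) / 2 * excess h) \<le>
        pr h * (exp (rel_risk / 8) * exp (- (1 / (16 * \<beta>)) * sqnorm n h))"
      by (intro mult_left_mono pr_nonneg h)
    then show "pr h * exp ((1 / 4)\<^sup>2 * rel_risk - (1 / 4) / 2 * excess h) \<le>
        exp (rel_risk / 8) * (pr h * exp (- (1 / (16 * \<beta>)) * sqnorm n h))" by (simp only: mult.left_commute)
  qed
  also have "\<dots> = exp (rel_risk / 8) * (\<Sum>h\<in>H. pr h * exp (- (1 / (16 * \<beta>)) * sqnorm n h))"
    by (simp only: sum_distrib_left)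
  also have "\<dots> \<le> exp (rel_risk / 8) * (1 + 1 / (1 / (16 * \<beta>) * K * \<beta>))"
    using beta by (intro mult_left_mono prior_mass_sqnorm) auto
  also have "1 / (1 / (16 * \<beta>) * K * \<beta>) = 16 / K" using beta by simp
  finally have "(\<Sum>h\<in>H. pr h * exp ((1 / 4)\<^sup>2 * rel_risk - (1 / 4) / 2 * excess h)) \<le>
      exp (rel_risk / 8) * (1 + 16 / K)" .
  moreover have K16: "0 < 1 + 16 / K" using K by (simp add: add_pos_pos)
  ultimately have "(1 - 1 / 4) * mean_energy \<le> ln (exp (rel_risk / 8) * (1 + 16 / K)) - (\<integral>\<xi>. 0 \<partial>noise n)"
    using gibbs_sum_ge_1 by (intro mean_energy_le_prior_sum) auto
  also have "\<dots> = rel_risk / 8 + ln (1 + 16 / K)" using K16 by (simp add: ln_mult_pos)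
  finally have "3 / 4 * mean_energy \<le> rel_risk / 8 + ln (1 + 16 / K)" by simp
  moreover have "0 \<le> ln (1 + 16 / K)" using K by simp
  ultimately show ?thesis using rel_risk_nonneg by linarith
qed

text \<open>
  Multipliers whose variance term alone is twice the oracle risk have an excess of order \<open>sqnorm\<close>, and
  contribute only of order \<open>sqrt x\<close>.
\<close>

lemma prior_sum_heavy_le:
  assumes x: "0 < rel_risk"
  shows "(\<Sum>h\<in>{h\<in>H. 2 * rel_risk < sqnorm n h}. pr h * exp (1 - excess h / (2 * sqrt rel_risk)))
    \<le> 3 * (1 + 8 * sqrt rel_risk / K)"
proof -
  define a where "a = 1 / (8 * \<beta> * sqrt rel_risk)"
  have a: "0 < a" using x beta by (simp add: a_def)
  have "(\<Sum>h\<in>{h\<in>H. 2 * rel_risk < sqnorm n h}. pr h * exp (1 - excess h / (2 * sqrt rel_risk))) \<le>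
      (\<Sum>h\<in>{h\<in>H. 2 * rel_risk < sqnorm n h}. exp 1 * (pr h * exp (- a * sqnorm n h)))"
  proof (rule sum_mono)
    fix h assume h: "h \<in> {h\<in>H. 2 * rel_risk < sqnorm n h}"
    have "sqnorm n h \<le> 4 * \<beta> * excess h" using sqnorm_le_excess[of h] h by auto
    then have "a * sqnorm n h \<le> a * (4 * \<beta> * excess h)" using a by (intro mult_left_mono) auto
    also have "\<dots> = excess h / (2 * sqrt rel_risk)" unfolding a_def using beta x by (simp add: field_simps)
    finally have "exp (1 - excess h / (2 * sqrt rel_risk)) \<le> exp 1 * exp (- a * sqnorm n h)"
      unfolding exp_add[symmetric] exp_le_cancel_iff by simp
    then have "pr h * exp (1 - excess h / (2 * sqrt rel_risk)) \<le> pr h * (exp 1 * exp (- a * sqnorm n h))"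
      using h by (intro mult_left_mono pr_nonneg) auto
    then show "pr h * exp (1 - excess h / (2 * sqrt rel_risk)) \<le> exp 1 * (pr h * exp (- a * sqnorm n h))"
      by (simp only: mult.left_commute)
  qed
  also have "\<dots> \<le> (\<Sum>h\<in>H. exp 1 * (pr h * exp (- a * sqnorm n h)))"
    using finite_H pr_nonneg by (intro sum_mono2) auto
  also have "\<dots> = exp 1 * (\<Sum>h\<in>H. pr h * exp (- a * sqnorm n h))" by (simp only: sum_distrib_left)
  also have "\<dots> \<le> 3 * (1 + 1 / (a * K * \<beta>))"
    using a pr_nonneg exp_le by (intro mult_mono prior_mass_sqnorm sum_nonneg) auto
  also have "1 / (a * K * \<beta>) = 8 * sqrt rel_risk / K" unfolding a_def using beta by simp
  finally show ?thesis .
qed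

lemma prior_mass_light_le:
  assumes x: "0 < rel_risk" and A: "\<And>h. h \<in> A \<Longrightarrow> h \<in> H \<and> sqnorm n h \<le> 2 * rel_risk"
  shows "(\<Sum>h\<in>A. pr h) \<le> 3 * (1 + rel_risk / (2 * K))"
proof -
  have "(\<Sum>h\<in>A. pr h) \<le> exp 1 * (1 + 2 * rel_risk / (K * \<beta>))"
    using x A by (intro prior_mass_sqnorm_ball) auto
  also have "\<dots> \<le> 3 * (1 + rel_risk / (2 * K))"
  proof (intro mult_mono exp_le add_mono order_refl)
    have "2 * rel_risk / (K * \<beta>) \<le> 2 * rel_risk / (K * 4)"
      using x K beta by (intro divide_left_mono mult_left_mono) auto
    then show "2 * rel_risk / (K * \<beta>) \<le> rel_risk / (2 * K)" by simp
  qed (use x K beta in auto)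
  finally show ?thesis .
qed

lemma prior_mass_near_le:
  assumes x: "0 < rel_risk"
  shows "(\<Sum>h\<in>{h\<in>H. \<bar>l1norm n h - l1norm n hs\<bar> \<le> rel_risk / 16}. pr h) \<le> 3 * (1 + rel_risk / 32)"
proof -
  have "(\<Sum>h\<in>{h\<in>H. \<bar>l1norm n h - l1norm n hs\<bar> \<le> rel_risk / 16}. pr h) \<le> exp 1 * (1 + (rel_risk / 8) / \<beta>)"
  proof (rule prior_mass_l1_interval)
    fix h assume "h \<in> {h\<in>H. \<bar>l1norm n h - l1norm n hs\<bar> \<le> rel_risk / 16}"
    then have "h \<in> H" "\<bar>l1norm n h - l1norm n hs\<bar> \<le> rel_risk / 16" by auto
    then show "h \<in> H \<and> l1norm n hs - rel_risk / 16 \<le> l1norm n h \<and>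
        l1norm n h \<le> l1norm n hs - rel_risk / 16 + rel_risk / 8"
      unfolding abs_le_iff by (intro conjI) linarith+
  qed (use x in simp)
  also have "\<dots> \<le> 3 * (1 + rel_risk / 32)"
  proof (intro mult_mono exp_le add_mono order_refl)
    have "rel_risk / 8 / \<beta> \<le> rel_risk / 8 / 4" using x beta by (intro divide_left_mono) auto
    then show "rel_risk / 8 / \<beta> \<le> rel_risk / 32" by simp
  qed (use x beta in auto)
  finally show ?thesis .
qed

lemma inverse_sqrt_rel_risk:
  assumes "16 \<le> rel_risk"
  shows "0 < 1 / sqrt rel_risk" "1 / sqrt rel_risk \<le> 1 / 4"
    "(1 / sqrt rel_risk)\<^sup>2 * rel_risk - 1 / sqrt rel_risk / 2 * excess h = 1 - excess h / (2 * sqrt rel_risk)"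
proof -
  have "sqrt 16 \<le> sqrt rel_risk" using assms by (rule real_sqrt_le_mono)
  moreover have "sqrt 16 = (4::real)" by (rule real_sqrt_unique) auto
  ultimately have s: "4 \<le> sqrt rel_risk" by simp
  show "0 < 1 / sqrt rel_risk" using assms by simp
  show "1 / sqrt rel_risk \<le> 1 / 4" using s assms by (intro divide_left_mono) auto
  show "(1 / sqrt rel_risk)\<^sup>2 * rel_risk - 1 / sqrt rel_risk / 2 * excess h = 1 - excess h / (2 * sqrt rel_risk)"
    using assms by (simp add: power_divide)
qed

text \<open>
  The family is split into the near multipliers, whose prior mass is a small multiple of \<open>x\<close>, the far
  ones, whose possibly large prior mass \<open>x / K\<close> is compensated by the factor
  \<open>exp (- c / 2) = K / 36\<close>, and the heavy ones.
\<close>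

lemma mean_energy_le_if_far_costly:
  assumes x: "16 \<le> rel_risk" and c: "c = 2 * ln (36 / K)"
    and gap: "\<And>h. h \<in> H \<Longrightarrow> rel_risk / 16 < \<bar>l1norm n h - l1norm n hs\<bar> \<Longrightarrow> c * sqrt rel_risk \<le> excess h"
  shows "(1 - 1 / sqrt rel_risk) * mean_energy \<le> ln (13 + 13 / 32 * rel_risk + 24 * sqrt rel_risk / K)"
proof -
  have x0: "0 < rel_risk" using x by simp
  define G where "G h = pr h * exp (1 - excess h / (2 * sqrt rel_risk))" for h
  have G0: "0 \<le> G h" if "h \<in> H" for h using pr_nonneg[OF that] by (simp add: G_def)
  define N where "N = {h\<in>H. \<bar>l1norm n h - l1norm n hs\<bar> \<le> rel_risk / 16}"
  define F where "F = {h\<in>H. rel_risk / 16 < \<bar>l1norm n h - l1norm n hs\<bar> \<and> sqnorm n h \<le> 2 * rel_risk}"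
  define V where "V = {h\<in>H. 2 * rel_risk < sqnorm n h}"
  have fin: "finite N" "finite F" "finite V" using finite_H by (auto simp: N_def F_def V_def)
  have "(\<Sum>h\<in>H. G h) \<le> (\<Sum>h\<in>N \<union> F \<union> V. G h)"
    using fin by (intro sum_mono2) (auto simp: N_def F_def V_def intro!: G0)
  also have "\<dots> \<le> (\<Sum>h\<in>N. G h) + (\<Sum>h\<in>F. G h) + (\<Sum>h\<in>V. G h)"
  proof -
    have un: "(\<Sum>h\<in>A \<union> B. G h) \<le> (\<Sum>h\<in>A. G h) + (\<Sum>h\<in>B. G h)" if "A \<subseteq> H" "B \<subseteq> H" for A B
    proof -
      have "finite A" "finite B" using that finite_H finite_subset by auto
      then have "(\<Sum>h\<in>A \<union> B. G h) = (\<Sum>h\<in>A. G h) + (\<Sum>h\<in>B. G h) - (\<Sum>h\<in>A \<inter> B. G h)"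
        by (rule sum_Un)
      moreover have "0 \<le> (\<Sum>h\<in>A \<inter> B. G h)" using that G0 by (intro sum_nonneg) auto
      ultimately show ?thesis by linarith
    qed
    have "N \<subseteq> H" "F \<subseteq> H" "V \<subseteq> H" by (auto simp: N_def F_def V_def)
    then show ?thesis using un[of "N \<union> F" V] un[of N F] by simp
  qed
  also have "(\<Sum>h\<in>N. G h) \<le> 9 * (1 + rel_risk / 32)"
  proof -
    have "(\<Sum>h\<in>N. G h) \<le> (\<Sum>h\<in>N. pr h * exp 1)"
      unfolding G_def using excess_nonneg pr_nonneg x0
      by (intro sum_mono mult_left_mono) (auto simp: N_def)
    also have "\<dots> = exp 1 * (\<Sum>h\<in>N. pr h)" by (simp add: sum_distrib_left mult.commute)
    also have "\<dots> \<le> 3 * (3 * (1 + rel_risk / 32))"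
      using prior_mass_near_le[OF x0] pr_nonneg unfolding N_def
      by (intro mult_mono exp_le sum_nonneg) auto
    finally show ?thesis by simp
  qed
  also have "(\<Sum>h\<in>F. G h) \<le> 1 / 4 + rel_risk / 8"
  proof -
    have "(\<Sum>h\<in>F. G h) \<le> (\<Sum>h\<in>F. pr h * (exp 1 * (K / 36)))"
      unfolding G_def
    proof (intro sum_mono mult_left_mono)
      fix h assume h: "h \<in> F"
      then show "0 \<le> pr h" using pr_nonneg by (simp add: F_def)
      have "c * sqrt rel_risk \<le> excess h" using gap h by (auto simp: F_def)
      then have "c / 2 \<le> excess h / (2 * sqrt rel_risk)" using x0 by (simp add: field_simps)
      then have "exp (1 - excess h / (2 * sqrt rel_risk)) \<le> exp (1 + ln (K / 36))"
        using K by (simp add: c ln_div)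
      then show "exp (1 - excess h / (2 * sqrt rel_risk)) \<le> exp 1 * (K / 36)"
        using K by (simp add: exp_add)
    qed
    also have "\<dots> = exp 1 * (K / 36) * (\<Sum>h\<in>F. pr h)" by (simp add: sum_distrib_left mult.commute)
    also have "\<dots> \<le> 3 * (K / 36) * (3 * (1 + rel_risk / (2 * K)))"
      using prior_mass_light_le[OF x0, of F] pr_nonneg K exp_le
      by (intro mult_mono sum_nonneg) (auto simp: F_def)
    also have "\<dots> = K / 4 + rel_risk / 8" using K by (simp add: field_simps)
    finally show ?thesis using K by simp
  qed
  also have "(\<Sum>h\<in>V. G h) \<le> 3 * (1 + 8 * sqrt rel_risk / K)"
    unfolding V_def G_def by (rule prior_sum_heavy_le[OF x0])
  also have "9 * (1 + rel_risk / 32) + (1 / 4 + rel_risk / 8) + 3 * (1 + 8 * sqrt rel_risk / K) \<le>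
      13 + 13 / 32 * rel_risk + 24 * sqrt rel_risk / K" by (simp add: algebra_simps)
  finally have b: "(\<Sum>h\<in>H. G h) \<le> 13 + 13 / 32 * rel_risk + 24 * sqrt rel_risk / K" by simp
  have "(1 - 1 / sqrt rel_risk) * mean_energy \<le> ln (13 + 13 / 32 * rel_risk + 24 * sqrt rel_risk / K) - (\<integral>\<xi>. 0 \<partial>noise n)"
  proof (rule mean_energy_le_prior_sum[OF inverse_sqrt_rel_risk(1,2)[OF x]])
    show "0 < 13 + 13 / 32 * rel_risk + 24 * sqrt rel_risk / K" using x K by (intro add_pos_nonneg) auto
    show "(\<Sum>h\<in>H. pr h * exp ((1 / sqrt rel_risk)\<^sup>2 * rel_risk - 1 / sqrt rel_risk / 2 * excess h)) \<le>
        13 + 13 / 32 * rel_risk + 24 * sqrt rel_risk / K"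
      using b unfolding G_def inverse_sqrt_rel_risk(3)[OF x] .
  qed (use gibbs_sum_ge_1 in auto)
  then show ?thesis by simp
qed

text \<open>
  A quadratic minorant turns moments of \<open>u\<close> into a lower bound for the mean of the positive part of \<open>ln u\<close>.
  It serves the same purpose as the Paley-Zygmund inequality without mentioning probabilities.
\<close>

lemma ln_minorant:
  fixes u M :: real
  assumes "0 < u" "1 \<le> M"
  shows "(u - 1) * (M - u) / M\<^sup>2 \<le> max 0 (ln u)"
proof (cases "1 \<le> u")
  case True
  have "ln (1 / u) \<le> 1 / u - 1" using assms(1) by (intro ln_le_minus_one) auto
  then have "1 - 1 / u \<le> ln u" using assms(1) by (simp add: ln_div)
  moreover have "(u - 1) * (M - u) / M\<^sup>2 \<le> 1 - 1 / u"
  proof -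
    have "0 \<le> (M - u / 2)\<^sup>2 + 3 / 4 * u\<^sup>2 " by simp
    then have "u * (M - u) \<le> M\<^sup>2" by (simp add: power2_eq_square algebra_simps)
    then have "(u - 1) * (u * (M - u)) \<le> (u - 1) * M\<^sup>2" using True by (intro mult_left_mono) auto
    then show ?thesis using assms by (simp add: field_simps)
  qed
  ultimately show ?thesis by linarith
next
  case False
  then have "(u - 1) * (M - u) \<le> 0" using assms by (intro mult_nonpos_nonneg) auto
  then have "(u - 1) * (M - u) / M\<^sup>2 \<le> 0" by (intro divide_nonpos_nonneg) auto
  then show ?thesis by linarith
qed

text \<open>
  Let \<open>u = exp (- \<theta> * energy h)\<close> with \<open>\<theta> = B / sqrt x\<close>. Its mean is at least
  \<open>exp (- c * B + B\<^sup>2 * spread_const K / (16 * \<beta>\<^sup>2))\<close>, and the choice of \<open>B\<close> makes the exponent equal to \<open>B\<close>;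
  its second moment is at most the constant \<open>M\<close>. Applying \<open>ln_minorant\<close> to \<open>u\<close> yields a lower bound
  of order \<open>1 / \<theta>\<close>, that is of order \<open>sqrt x\<close>, for the mean of the positive part of \<open>- energy h\<close>, hence
  for that of \<open>ln (gibbs_sum 1)\<close>.
\<close>

lemma mean_energy_le_if_far_cheap:
  assumes x: "16 \<le> rel_risk" and c: "0 \<le> c" and h: "h \<in> H"
    and far: "rel_risk / 16 < \<bar>l1norm n h - l1norm n hs\<bar>" and low: "excess h \<le> c * sqrt rel_risk"
    and light: "2 * \<beta> * (c * sqrt rel_risk) \<le> rel_risk"
    and B: "B = 16 * \<beta>\<^sup>2 * (c + 1) / spread_const K" "2 * B \<le> sqrt rel_risk"
    and M: "M = exp (4 * B\<^sup>2 * (1 + 2 * c))"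
  shows "(1 - 1 / sqrt rel_risk) * mean_energy \<le>
    ln (12 + 9 * rel_risk / (2 * K) + 24 * sqrt rel_risk / K) - 2 * sqrt rel_risk / (B * M\<^sup>2)"
proof -
  have x0: "0 < rel_risk" using x by simp
  have s1: "1 \<le> sqrt rel_risk" using x by simp
  have ss: "sqrt rel_risk * sqrt rel_risk = rel_risk" using x0 by simp
  define k where "k = spread_const K"
  have k: "0 < k" "k \<le> 1" using spread_const_bounds K by (auto simp: k_def)
  have B1: "1 \<le> B"
  proof -
    have "1 \<le> \<beta>\<^sup>2" using beta by simp
    then have "1 * 1 \<le> (16 * \<beta>\<^sup>2) * (c + 1)" using c by (intro mult_mono) auto
    then have "k \<le> 16 * \<beta>\<^sup>2 * (c + 1)" using k by simp
    then show ?thesis unfolding B k_def[symmetric] using k by (simp add: le_divide_eq)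
  qed
  have M1: "1 \<le> M" unfolding M using c by simp
  define \<theta> where "\<theta> = B / sqrt rel_risk"
  have \<theta>: "0 < \<theta>" "\<theta> \<le> 1" "0 < 2 * \<theta>" "2 * \<theta> \<le> 1"
    using B1 B(2) s1 by (auto simp: \<theta>_def divide_simps)
  have \<theta>s: "\<theta> * sqrt rel_risk = B" "\<theta>\<^sup>2 * rel_risk = B\<^sup>2"
    using x0 by (simp_all add: \<theta>_def power_divide)
  define u where "u \<xi> = exp (- \<theta> * energy \<xi> h)" for \<xi>
  have u2: "(u \<xi>)\<^sup>2 = exp (- (2 * \<theta>) * energy \<xi> h)" for \<xi>
    unfolding u_def exp_double[symmetric] by simp
  have iu: "integrable (noise n) u" unfolding u_def[abs_def] by (rule exp_energy_moments(1)[OF h \<theta>(1,2)])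
  have iu2: "integrable (noise n) (\<lambda>\<xi>. (u \<xi>)\<^sup>2)" unfolding u2 by (rule exp_energy_moments(1)[OF h \<theta>(3,4)])
  \<comment> \<open>a small excess also keeps the variance term of \<open>h\<close> comparable to the oracle risk\<close>
  have sq: "sqnorm n h \<le> 2 * rel_risk"
  proof -
    have "2 * \<beta> * excess h \<le> 2 * \<beta> * (c * sqrt rel_risk)" using low beta by (intro mult_left_mono) auto
    then show ?thesis using sqnorm_le_excess[of h] light by linarith
  qed
  have Eu: "2 \<le> (\<integral>\<xi>. u \<xi> \<partial>noise n)"
  proof -
    have "\<theta> * excess h \<le> \<theta> * (c * sqrt rel_risk)" using low \<theta> by (intro mult_left_mono) auto
    also have "\<dots> = c * B" using \<theta>s(1) by (simp add: mult.left_commute)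
    finally have 1: "\<theta> * excess h \<le> c * B" .
    have "\<theta>\<^sup>2 / (16 * \<beta>\<^sup>2) * (k * rel_risk) \<le> \<theta>\<^sup>2 / (16 * \<beta>\<^sup>2) * (\<Sum>i=1..n. (bias_gap h i)\<^sup>2)"
      unfolding k_def by (intro mult_left_mono bias_gap_spread_ge h sq far) auto
    moreover have "\<theta>\<^sup>2 / (16 * \<beta>\<^sup>2) * (k * rel_risk) = B * (B * k / (16 * \<beta>\<^sup>2))"
    proof -
      have "\<theta>\<^sup>2 / (16 * \<beta>\<^sup>2) * (k * rel_risk) = (\<theta>\<^sup>2 * rel_risk) * k / (16 * \<beta>\<^sup>2)" by simp
      then show ?thesis unfolding \<theta>s by (simp add: power2_eq_square)
    qed
    \<comment> \<open>this identity fixes the choice of \<open>B\<close>\<close>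
    moreover have "B * k / (16 * \<beta>\<^sup>2) = c + 1" unfolding B k_def[symmetric] using k beta by simp
    ultimately have "B * (c + 1) \<le> \<theta>\<^sup>2 / (16 * \<beta>\<^sup>2) * (\<Sum>i=1..n. (bias_gap h i)\<^sup>2)" by simp
    then have "1 \<le> - \<theta> * excess h + \<theta>\<^sup>2 / (16 * \<beta>\<^sup>2) * (\<Sum>i=1..n. (bias_gap h i)\<^sup>2)"
      using 1 B1 by (simp add: algebra_simps)
    then have "exp 1 \<le> exp (- \<theta> * excess h + \<theta>\<^sup>2 / (16 * \<beta>\<^sup>2) * (\<Sum>i=1..n. (bias_gap h i)\<^sup>2))" by simp
    also have "\<dots> \<le> (\<integral>\<xi>. u \<xi> \<partial>noise n)"
      unfolding u_def by (rule exp_energy_moments(2)[OF h \<theta>(1,2)])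
    finally show ?thesis using exp_ge_add_one_self[of 1] by simp
  qed
  have Eu2: "(\<integral>\<xi>. (u \<xi>)\<^sup>2 \<partial>noise n) \<le> M"
  proof -
    have "(\<integral>\<xi>. (u \<xi>)\<^sup>2 \<partial>noise n) \<le> exp (- (2 * \<theta>) * excess h + (2 * \<theta>)\<^sup>2 * (rel_risk + 2 * excess h))"
      unfolding u2 by (rule exp_energy_moments(3)[OF h \<theta>(3,4)])
    also have "\<dots> \<le> M"
      unfolding M exp_le_cancel_iff
    proof -
      have "1 * sqrt rel_risk \<le> sqrt rel_risk * sqrt rel_risk" using s1 by (intro mult_right_mono) auto
      then have "c * sqrt rel_risk \<le> c * rel_risk" unfolding ss using c by (intro mult_left_mono) auto
      then have "\<theta>\<^sup>2 * excess h \<le> \<theta>\<^sup>2 * (c * rel_risk)" using low by (intro mult_left_mono) auto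
      also have "\<dots> = c * B\<^sup>2" using \<theta>s(2) by (simp add: mult.left_commute)
      finally have "\<theta>\<^sup>2 * excess h \<le> c * B\<^sup>2" .
      moreover have "0 \<le> \<theta> * excess h" using \<theta> excess_nonneg[OF h] by simp
      moreover have "(2 * \<theta>)\<^sup>2 * (rel_risk + 2 * excess h) = 4 * (\<theta>\<^sup>2 * rel_risk) + 8 * (\<theta>\<^sup>2 * excess h)"
        by (simp add: power2_eq_square algebra_simps)
      ultimately show "- (2 * \<theta>) * excess h + (2 * \<theta>)\<^sup>2 * (rel_risk + 2 * excess h) \<le> 4 * B\<^sup>2 * (1 + 2 * c)"
        unfolding \<theta>s by (simp add: algebra_simps)
    qed
    finally show ?thesis .
  qed
  define L where "L \<xi> = ((M + 1) * u \<xi> - (u \<xi>)\<^sup>2 - M) / (\<theta> * M\<^sup>2)" for \<xi>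
  have iL: "integrable (noise n) L" unfolding L_def[abs_def] using iu iu2 by simp
  have L: "L \<xi> \<le> ln (gibbs_sum 1 \<xi>)" for \<xi>
  proof -
    have "L \<xi> = (u \<xi> - 1) * (M - u \<xi>) / M\<^sup>2 / \<theta>"
      unfolding L_def by (simp add: power2_eq_square algebra_simps)
    also have "\<dots> \<le> max 0 (ln (u \<xi>)) / \<theta>"
      using \<theta> M1 by (intro divide_right_mono ln_minorant) (auto simp: u_def)
    also have "\<dots> = max 0 (- energy \<xi> h)" unfolding u_def using \<theta> by (simp add: max_def zero_le_mult_iff mult_le_0_iff)
    also have "\<dots> \<le> ln (gibbs_sum 1 \<xi>)"
      using gibbs_sum_ge[OF h, of \<xi>] gibbs_sum_ge_1[of \<xi>] gibbs_sum_pos[of 1 \<xi>] by (simp add: ln_ge_iff)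
    finally show ?thesis .
  qed
  have EL: "2 * sqrt rel_risk / (B * M\<^sup>2) \<le> (\<integral>\<xi>. L \<xi> \<partial>noise n)"
  proof -
    define m where "m = (\<integral>\<xi>. u \<xi> \<partial>noise n)"
    have "(M + 1) * 2 \<le> (M + 1) * m" using Eu M1 unfolding m_def by (intro mult_left_mono) auto
    moreover have "(M + 1) * 2 = M + M + 2" by simp
    ultimately have "2 \<le> (M + 1) * m - (\<integral>\<xi>. (u \<xi>)\<^sup>2 \<partial>noise n) - M" using Eu2 by linarith
    then have "2 / (\<theta> * M\<^sup>2) \<le>
        ((M + 1) * m - (\<integral>\<xi>. (u \<xi>)\<^sup>2 \<partial>noise n) - M) / (\<theta> * M\<^sup>2)"
      using \<theta> by (intro divide_right_mono) auto
    also have "\<dots> = (\<integral>\<xi>. L \<xi> \<partial>noise n)"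
      unfolding L_def m_def using iu iu2 prob_space
      by (simp only: integral_divide_zero Bochner_Integration.integral_diff integral_mult_right_zero
          Bochner_Integration.integrable_diff integrable_mult_right integrable_const lebesgue_integral_const) simp
    also have "2 / (\<theta> * M\<^sup>2) = 2 * sqrt rel_risk / (B * M\<^sup>2)" unfolding \<theta>_def by simp
    finally show ?thesis .
  qed
  have b: "(\<Sum>h\<in>H. pr h * exp (1 - excess h / (2 * sqrt rel_risk))) \<le> 12 + 9 * rel_risk / (2 * K) + 24 * sqrt rel_risk / K"
  proof -
    let ?G = "\<lambda>h. pr h * exp (1 - excess h / (2 * sqrt rel_risk))"
    let ?V = "{h\<in>H. 2 * rel_risk < sqnorm n h}" and ?F = "{h\<in>H. sqnorm n h \<le> 2 * rel_risk}"
    have "H = ?F \<union> ?V" "?F \<inter> ?V = {}" by auto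
    then have "(\<Sum>h\<in>H. ?G h) = (\<Sum>h\<in>?F. ?G h) + (\<Sum>h\<in>?V. ?G h)"
      using finite_H by (metis (no_types, lifting) finite_Un sum.union_disjoint)
    moreover have "(\<Sum>h\<in>?F. ?G h) \<le> 9 * (1 + rel_risk / (2 * K))"
    proof -
      have "(\<Sum>h\<in>?F. ?G h) \<le> (\<Sum>h\<in>?F. pr h * exp 1)"
        using excess_nonneg pr_nonneg x0 by (intro sum_mono mult_left_mono) auto
      also have "\<dots> = exp 1 * (\<Sum>h\<in>?F. pr h)" by (simp add: sum_distrib_left mult.commute)
      also have "\<dots> \<le> 3 * (3 * (1 + rel_risk / (2 * K)))"
        using prior_mass_light_le[OF x0, of ?F] pr_nonneg by (intro mult_mono exp_le sum_nonneg) auto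
      finally show ?thesis by simp
    qed
    moreover have "(\<Sum>h\<in>?V. ?G h) \<le> 3 * (1 + 8 * sqrt rel_risk / K)" by (rule prior_sum_heavy_le[OF x0])
    moreover have "9 * (1 + rel_risk / (2 * K)) + 3 * (1 + 8 * sqrt rel_risk / K) =
        12 + 9 * rel_risk / (2 * K) + 24 * sqrt rel_risk / K" by (simp add: algebra_simps)
    ultimately show ?thesis by linarith
  qed
  have "(1 - 1 / sqrt rel_risk) * mean_energy \<le>
      ln (12 + 9 * rel_risk / (2 * K) + 24 * sqrt rel_risk / K) - (\<integral>\<xi>. L \<xi> \<partial>noise n)"
  proof (rule mean_energy_le_prior_sum[OF inverse_sqrt_rel_risk(1,2)[OF x] _ _ iL L])
    show "0 < 12 + 9 * rel_risk / (2 * K) + 24 * sqrt rel_risk / K" using x K by (intro add_pos_nonneg) auto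
    show "(\<Sum>h\<in>H. pr h * exp ((1 / sqrt rel_risk)\<^sup>2 * rel_risk - 1 / sqrt rel_risk / 2 * excess h)) \<le>
        12 + 9 * rel_risk / (2 * K) + 24 * sqrt rel_risk / K"
      using b unfolding inverse_sqrt_rel_risk(3)[OF x] .
  qed
  then show ?thesis using EL by linarith
qed

end

section \<open>The oracle inequality\<close>

lemma eventual_inequalities:
  fixes K c D :: real
  assumes K: "0 < K" and D: "0 < D" and c: "0 < c" and B: "0 < B"
  obtains X where "16 \<le> X" "\<And>x. X \<le> x \<Longrightarrow> 13 + 13 / 32 * x + 24 * sqrt x / K \<le> x / 2"
    "\<And>x. X \<le> x \<Longrightarrow> ln (x / 2) \<le> (1 - 1 / sqrt x) * ln x"
    "\<And>x. X \<le> x \<Longrightarrow> c * sqrt x \<le> x" "\<And>x. X \<le> x \<Longrightarrow> B \<le> sqrt x"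
    "\<And>x. X \<le> x \<Longrightarrow> ln (12 + 9 * x / (2 * K) + 24 * sqrt x / K) \<le> D * sqrt x"
proof -
  have "eventually (\<lambda>x. 13 + 13 / 32 * x + 24 * sqrt x / K \<le> x / 2) at_top"
    using K by real_asymp
  moreover have "eventually (\<lambda>x::real. ln (x / 2) \<le> (1 - 1 / sqrt x) * ln x) at_top"
    by real_asymp
  moreover have "eventually (\<lambda>x. c * sqrt x \<le> x) at_top"
    using c by real_asymp
  moreover have "eventually (\<lambda>x. B \<le> sqrt x) at_top"
    using B by real_asymp
  moreover have "eventually (\<lambda>x. ln (12 + 9 * x / (2 * K) + 24 * sqrt x / K) \<le> D * sqrt x) at_top"
    using K D by real_asymp
  moreover have "eventually (\<lambda>x::real. 16 \<le> x) at_top" by (rule eventually_ge_at_top)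
  ultimately have "eventually (\<lambda>x. 16 \<le> x \<and> 13 + 13 / 32 * x + 24 * sqrt x / K \<le> x / 2 \<and>
      ln (x / 2) \<le> (1 - 1 / sqrt x) * ln x \<and> c * sqrt x \<le> x \<and> B \<le> sqrt x \<and>
      ln (12 + 9 * x / (2 * K) + 24 * sqrt x / K) \<le> D * sqrt x) at_top"
    by eventually_elim simp
  then obtain X where "\<And>x. X \<le> x \<Longrightarrow> 16 \<le> x \<and> 13 + 13 / 32 * x + 24 * sqrt x / K \<le> x / 2 \<and>
      ln (x / 2) \<le> (1 - 1 / sqrt x) * ln x \<and> c * sqrt x \<le> x \<and> B \<le> sqrt x \<and>
      ln (12 + 9 * x / (2 * K) + 24 * sqrt x / K) \<le> D * sqrt x"
    unfolding eventually_at_top_linorder by blast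
  then show ?thesis using that[of X] by blast
qed

text \<open>
  The threshold depends on \<open>\<beta>\<close> and \<open>K\<close> only, which is why it is obtained before the model is
  fixed.
\<close>

lemma mean_energy_le_ln_rel_risk:
  fixes \<beta> K :: real
  assumes beta: "4 \<le> \<beta>" and K: "0 < K" "K \<le> 1"
  obtains X where "0 < X"
    "\<And>n \<sigma> H \<mu> hs. regular_oracle_model n \<beta> \<sigma> H \<mu> hs K \<Longrightarrow> X \<le> oracle_model.rel_risk n \<sigma> \<mu> hs \<Longrightarrow>
      oracle_model.mean_energy n \<beta> \<sigma> H \<mu> hs \<le> ln (oracle_model.rel_risk n \<sigma> \<mu> hs)"
proof -
  define c where "c = 2 * ln (36 / K)"
  define B where "B = 16 * \<beta>\<^sup>2 * (c + 1) / spread_const K"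
  define M where "M = exp (4 * B\<^sup>2 * (1 + 2 * c))"
  have "0 < ln (36 / K)" using K by (intro ln_gt_zero) simp
  then have c: "0 < c" unfolding c_def by simp
  have B: "0 < B" unfolding B_def using c beta spread_const_bounds(1)[OF K] by simp
  have D: "0 < 2 / (B * M\<^sup>2)" using B by (simp add: M_def)
  have c2: "0 < 2 * \<beta> * c" and B2: "0 < 2 * B" using c beta B by auto
  obtain X where X: "16 \<le> X" "\<And>x. X \<le> x \<Longrightarrow> 13 + 13 / 32 * x + 24 * sqrt x / K \<le> x / 2"
    "\<And>x. X \<le> x \<Longrightarrow> ln (x / 2) \<le> (1 - 1 / sqrt x) * ln x"
    "\<And>x. X \<le> x \<Longrightarrow> 2 * \<beta> * c * sqrt x \<le> x" "\<And>x. X \<le> x \<Longrightarrow> 2 * B \<le> sqrt x"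
    "\<And>x. X \<le> x \<Longrightarrow> ln (12 + 9 * x / (2 * K) + 24 * sqrt x / K) \<le> 2 / (B * M\<^sup>2) * sqrt x"
    by (rule eventual_inequalities[OF K(1) D c2 B2]) blast
  show ?thesis
  proof (rule that)
    show "0 < X" using X(1) by simp
    fix n \<sigma> H \<mu> hs
    assume model: "regular_oracle_model n \<beta> \<sigma> H \<mu> hs K" and large: "X \<le> oracle_model.rel_risk n \<sigma> \<mu> hs"
    interpret regular_oracle_model n \<beta> \<sigma> H \<mu> hs K by (rule model)
    have x: "16 \<le> rel_risk" using X(1) large by simp
    have pos: "0 < 1 - 1 / sqrt rel_risk" using inverse_sqrt_rel_risk(2)[OF x] by linarith
    show "mean_energy \<le> ln rel_risk"
    proof (cases "\<exists>h\<in>H. rel_risk / 16 < \<bar>l1norm n h - l1norm n hs\<bar> \<and> excess h < c * sqrt rel_risk")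
      case True
      then obtain h where h: "h \<in> H" "rel_risk / 16 < \<bar>l1norm n h - l1norm n hs\<bar>" "excess h < c * sqrt rel_risk"
        by blast
      have "(1 - 1 / sqrt rel_risk) * mean_energy \<le>
          ln (12 + 9 * rel_risk / (2 * K) + 24 * sqrt rel_risk / K) - 2 * sqrt rel_risk / (B * M\<^sup>2)"
        using X(4,5)[OF large] c h
        by (intro mean_energy_le_if_far_cheap[OF x _ h(1,2) _ _ B_def _ M_def]) (auto simp: mult.assoc)
      also have "\<dots> \<le> 0" using X(6)[OF large] by simp
      finally have "mean_energy \<le> 0" using pos by (simp add: mult_le_0_iff)
      also have "0 \<le> ln rel_risk" using x by simp
      finally show ?thesis .
    next
      case False
      have "(1 - 1 / sqrt rel_risk) * mean_energy \<le> ln (13 + 13 / 32 * rel_risk + 24 * sqrt rel_risk / K)"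
        using False by (intro mean_energy_le_if_far_costly[OF x c_def]) force
      also have "\<dots> \<le> ln (rel_risk / 2)"
        using X(2)[OF large] x K by (subst ln_le_cancel_iff) (auto intro!: add_pos_nonneg)
      also have "\<dots> \<le> (1 - 1 / sqrt rel_risk) * ln rel_risk" by (rule X(3)[OF large])
      finally show ?thesis using pos by simp
    qed
  qed
qed

text \<open>
  Below the threshold \<open>X\<close> the mean energy is at most \<open>ln \<Psi>\<close>, above it at most \<open>ln x\<close>; both are at
  most \<open>ln (x + \<Psi>)\<close>.
\<close>

lemma exp_weighting_oracle_inequality:
  fixes \<beta> K :: real
  assumes beta: "4 \<le> \<beta>" and K: "0 < K" "K \<le> 1"
  obtains \<Psi> where "0 < \<Psi>"
    "\<And>n \<sigma> H \<mu>. regular_smoothing_model n \<beta> \<sigma> H K \<Longrightarrow>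
      expect n \<sigma> \<mu> (\<lambda>Y. loss n (exp_weighting n \<beta> \<sigma> H Y) \<mu>) \<le> oracle_risk n \<sigma> H \<mu> +
        2 * \<beta> * \<sigma>\<^sup>2 * ln (oracle_risk n \<sigma> H \<mu> / \<sigma>\<^sup>2 + \<Psi>)"
proof -
  obtain X where X0: "0 < X" and X: "\<And>n \<sigma> H \<mu> hs. regular_oracle_model n \<beta> \<sigma> H \<mu> hs K \<Longrightarrow>
      X \<le> oracle_model.rel_risk n \<sigma> \<mu> hs \<Longrightarrow>
      oracle_model.mean_energy n \<beta> \<sigma> H \<mu> hs \<le> ln (oracle_model.rel_risk n \<sigma> \<mu> hs)"
    by (rule mean_energy_le_ln_rel_risk[OF assms]) blast
  define \<Psi> where "\<Psi> = exp (X + 2 * ln (1 + 16 / K))"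
  show ?thesis
  proof (rule that)
    show "0 < \<Psi>" by (simp add: \<Psi>_def)
    fix n \<sigma> H \<mu> assume "regular_smoothing_model n \<beta> \<sigma> H K"
    then interpret regular_smoothing_model n \<beta> \<sigma> H \<mu> K .
    have "Min (risk ` H) \<in> risk ` H" using finite_H nonempty_H by (intro Min_in) auto
    then obtain hs where best: "hs \<in> H" "risk hs = Min (risk ` H)" by (metis imageE)
    interpret regular_oracle_model n \<beta> \<sigma> H \<mu> hs K
      using best finite_H by unfold_locales auto
    have r: "oracle_risk n \<sigma> H \<mu> = risk hs"
      unfolding best(2) unfolding oracle_risk_eq risk_def[abs_def] ..
    have "mean_energy \<le> ln (rel_risk + \<Psi>)"
    proof (cases "X \<le> rel_risk")
      case True
      have "mean_energy \<le> ln rel_risk" using X[OF regular_oracle_model_axioms True] .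
      also have "\<dots> \<le> ln (rel_risk + \<Psi>)" using True X0 \<open>0 < \<Psi>\<close> by simp
      finally show ?thesis .
    next
      case False
      have "mean_energy \<le> ln \<Psi>" using mean_energy_le_rel_risk False by (simp add: \<Psi>_def)
      also have "\<dots> \<le> ln (rel_risk + \<Psi>)" using rel_risk_nonneg \<open>0 < \<Psi>\<close> by simp
      finally show ?thesis .
    qed
    then have "2 * \<beta> * \<sigma>\<^sup>2 * mean_energy \<le> 2 * \<beta> * \<sigma>\<^sup>2 * ln (rel_risk + \<Psi>)"
      using beta by (intro mult_left_mono) auto
    then show "expect n \<sigma> \<mu> (\<lambda>Y. loss n (exp_weighting n \<beta> \<sigma> H Y) \<mu>) \<le> oracle_risk n \<sigma> H \<mu> +
        2 * \<beta> * \<sigma>\<^sup>2 * ln (oracle_risk n \<sigma> H \<mu> / \<sigma>\<^sup>2 + \<Psi>)"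
      using risk_le_mean_energy unfolding r rel_risk_def[symmetric] by linarith
  qed
qed

theorem theorem1p3:
  fixes \<beta> K\<^sub>l K\<^sub>u :: real
  assumes "\<beta> \<ge> 4" and "K\<^sub>l > 0" and "K\<^sub>u > 0"
  shows "\<exists>(\<Psi> :: real \<Rightarrow> real) (C :: real).
    \<Psi> \<in> {0..} \<rightarrow> {0<..} \<and>
    mono_on {0..} \<Psi> \<and>
    (\<exists>\<delta>>0. bdd_above (\<Psi> ` {0..<\<delta>})) \<and>
    (\<forall>x>1. \<Psi> x \<le> C * x / ln x) \<and>
    (\<forall>(n :: nat) (\<sigma> :: real) (H :: (nat \<Rightarrow> real) set).
       n \<ge> 1 \<longrightarrow> \<sigma> > 0 \<longrightarrow> ordered_multipliers n H \<longrightarrow>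
       (\<forall>h\<in>H. \<forall>g\<in>H. g \<le> h \<longrightarrow>
          (\<Sum>i=1..n. (h i)\<^sup>2 - (g i)\<^sup>2) \<ge> K\<^sub>l * (l1norm n h - l1norm n g)) \<longrightarrow>
       (\<forall>h\<in>H. h \<noteq> hmax H \<longrightarrow> sqnorm n (hsucc H h) \<le> K\<^sub>u * sqnorm n h) \<longrightarrow>
       (\<forall>\<mu>\<in>vectors n.
          expect n \<sigma> \<mu> (\<lambda>Y. loss n (exp_weighting n \<beta> \<sigma> H Y) \<mu>)
            \<le> oracle_risk n \<sigma> H \<mu> +
               2 * \<beta> * \<sigma>\<^sup>2 *
               ln (oracle_risk n \<sigma> H \<mu> / \<sigma>\<^sup>2 + \<Psi> (oracle_risk n \<sigma> H \<mu> / \<sigma>\<^sup>2))))"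
proof -
  \<comment> \<open>the condition on increments persists when its constant is lowered\<close>
  define K where "K = min K\<^sub>l 1"
  have K: "0 < K" "K \<le> 1" "K \<le> K\<^sub>l" using assms(2) by (auto simp: K_def)
  obtain \<Psi> where pos: "0 < \<Psi>" and bound:
    "\<And>n \<sigma> H \<mu>. regular_smoothing_model n \<beta> \<sigma> H K \<Longrightarrow>
      expect n \<sigma> \<mu> (\<lambda>Y. loss n (exp_weighting n \<beta> \<sigma> H Y) \<mu>) \<le> oracle_risk n \<sigma> H \<mu> +
        2 * \<beta> * \<sigma>\<^sup>2 * ln (oracle_risk n \<sigma> H \<mu> / \<sigma>\<^sup>2 + \<Psi>)"
    by (rule exp_weighting_oracle_inequality[OF assms(1) K(1,2)]) blast
  have growth: "\<Psi> \<le> \<Psi> * x / ln x" if "1 < x" for x :: real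
  proof -
    have "0 < ln x" "ln x \<le> x" using that ln_le_minus_one[of x] by auto
    then show ?thesis using pos by (simp add: le_divide_eq mult_left_mono)
  qed
  show ?thesis
  proof (rule exI[of _ "\<lambda>_. \<Psi>"], rule exI[of _ \<Psi>], intro conjI allI impI ballI)
    show "(\<lambda>_. \<Psi>) \<in> {0..} \<rightarrow> {0<..}" using pos by simp
    show "mono_on {0..} (\<lambda>_. \<Psi>)" by (simp add: mono_on_def)
    show "\<exists>\<delta>>0. bdd_above ((\<lambda>_::real. \<Psi>) ` {0..<\<delta>})" by (intro exI[of _ "1::real"]) auto
    show "\<Psi> \<le> \<Psi> * x / ln x" if "1 < x" for x :: real using growth[OF that] .
    fix n :: nat and \<sigma> :: real and H and \<mu> :: "nat \<Rightarrow> real"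
    assume model: "0 < \<sigma>" "ordered_multipliers n H"
      and regular: "\<forall>h\<in>H. \<forall>g\<in>H. g \<le> h \<longrightarrow>
        (\<Sum>i=1..n. (h i)\<^sup>2 - (g i)\<^sup>2) \<ge> K\<^sub>l * (l1norm n h - l1norm n g)"
    interpret smoothing_model n \<beta> \<sigma> H \<mu>
      using assms(1) model by unfold_locales auto
    have "regular_smoothing_model n \<beta> \<sigma> H K"
    proof unfold_locales
      fix h g assume hg: "h \<in> H" "g \<in> H" "g \<le> h"
      have "K * (l1norm n h - l1norm n g) \<le> K\<^sub>l * (l1norm n h - l1norm n g)"
        using l1norm_mono[OF hg(2,1,3)] K(3) by (intro mult_right_mono) auto
      also have "\<dots> \<le> (\<Sum>i=1..n. (h i)\<^sup>2 - (g i)\<^sup>2)" using regular hg by blast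
      also have "\<dots> = sqnorm n h - sqnorm n g" by (simp add: sqnorm_def sum_subtractf)
      finally show "K * (l1norm n h - l1norm n g) \<le> sqnorm n h - sqnorm n g" .
    qed (use K in auto)
    then show "expect n \<sigma> \<mu> (\<lambda>Y. loss n (exp_weighting n \<beta> \<sigma> H Y) \<mu>)
        \<le> oracle_risk n \<sigma> H \<mu> + 2 * \<beta> * \<sigma>\<^sup>2 * ln (oracle_risk n \<sigma> H \<mu> / \<sigma>\<^sup>2 + \<Psi>)"
      by (rule bound)
  qed
qed

end
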